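(* As $n\to\infty$, $$m(n)\sim m_{\mathcal P(\sqrt n)}(n)\sim\frac{4n^{3/2}}{3\log n}.$$ Moreover, for every fixed $c\in(0,1)$, uniformly over integers $k$ with $c\sqrt n\le k<\sqrt n$, $$m_k(n)=\left(1-\frac{k^2}{3n}+o_c(1)\right)\frac{kn}{\log k}\qquad (n\to\infty),$$ that is, for every $c\in(0,1)$ and $\varepsilon>0$ there is $n_0$ such that for all $n\ge n_0$ and all integers $k$ with $c\sqrt n\le k<\sqrt n$ one has $\left|\,m_k(n)\frac{\log k}{kn}-\left(1-\frac{k^2}{3n}\right)\right|\le\varepsilon$.
   Context: For $N\in\mathbb N=\{1,2,\dots\}$ write $[N]=\{1,\dots,N\}$. A finite family $(C_d)_{d\in D}$ of finite subsets of $\mathbb Z$ is packed into $[N]$ if there are integers $\sigma_d$ ($d\in D$) such that $\sigma_d+C_d\subseteq[N]$ for every $d\in D$ and the sets $\sigma_d+C_d$ are pairwise disjoint. For $n\in\mathbb N$ and $d\in[n]$ put $A_d=\{jd:1\le j\le\lfloor n/d\rfloor\}$ (depending on $n$). For $D\subseteq[n]$, $m_D(n)$ is the least $N$ for which $(A_d)_{d\in D}$ can be packed into $[N]$. Write $m_k(n)=m_{[k]}(n)$ and $m(n)=m_n(n)$. Also $\mathcal P(x)=\{p\le x: p\text{ prime}\}$. Logarithms are natural, and $f\sim g$ means $f/g\to1$. *)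

theory Defs
  imports
    Complex_Main
    "HOL-Library.Disjoint_Sets"
    "HOL-Library.Landau_Symbols"
    "HOL-Computational_Algebra.Primes"
begin

definition packed_into :: "'i set \<Rightarrow> ('i \<Rightarrow> int set) \<Rightarrow> nat \<Rightarrow> bool" where
  "packed_into D C N \<longleftrightarrow>
     (\<exists>\<sigma> :: 'i \<Rightarrow> int.
        (\<forall>d\<in>D. (\<lambda>x. \<sigma> d + x) ` C d \<subseteq> {1..int N}) \<and>
        disjoint_family_on (\<lambda>d. (\<lambda>x. \<sigma> d + x) ` C d) D)"

definition multiples_set :: "nat \<Rightarrow> nat \<Rightarrow> int set" where
  "multiples_set n d = {int (j * d) | j. 1 \<le> j \<and> j \<le> n div d}"

text \<open>
  The length N of the interval ranges over the positive integers, so the empty family has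
  packing number 1. For D contained in {1..n}, a suitable N always exists
  (shift the d-th set by d * n).
\<close>
definition packing_number :: "nat set \<Rightarrow> nat \<Rightarrow> nat" where
  "packing_number D n = (LEAST N. 1 \<le> N \<and> packed_into D (multiples_set n) N)"

definition packing_number_upto :: "nat \<Rightarrow> nat \<Rightarrow> nat" where
  "packing_number_upto k n = packing_number {1..k} n"

definition primes_upto :: "real \<Rightarrow> nat set" where
  "primes_upto x = {p. prime p \<and> real p \<le> x}"

end

theory Submission
  imports Defs "HOL-Complex_Analysis.Complex_Analysis" "HOL-Real_Asymp.Real_Asymp"
    "HOL-Number_Theory.Cong" "HOL-Number_Theory.Prime_Powers"
begin

text \<open>
  Two progressions with coprime differences p and q meet in every interval of p q consecutive
  integers on which both of them run. Hence disjoint translates of the progressions of two primes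
  p, q \<le> sqrt n, each of span about n, overlap in fewer than p q integers, so their left end points
  are at least n - p q - O(sqrt n) \<ge> n - (p^2 + q^2) / 2 - O(sqrt n) apart. Adding this up over
  the translates in the order of their left end points shows that the primes up to k \<le> sqrt n need
  an interval of length at least main_term n k - O(n), where main_term n k is the sum of
  n - p^2 over the primes p \<le> k (lemma packed_primes_lower_bound).

  The same main term suffices, up to o(n^(3/2) / log n), for all the differences. Take primes
  p_0 < ... < p_(m-1) that are close together and translate the progression of p_i by
  s_i = \<Sum>_(k<i) (D p_k + E p_(k+1)). Every p_k between p_j and p_i is a convex combination of
  p_j and p_i; if D and E are divisible by p_i - p_j, the weights clear and
  s_i - s_j = u p_j + v p_i with integers v \<ge> 0 and u \<ge> D. By coprimality a collision
  s_i + b p_i = s_j + a p_j forces a \<ge> u + p_i, which exceeds n / p_j as soon as D is slightly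
  larger than n / p_0 - p_0. So one step of the cluster costs D p_k, about n - p^2, and each
  cluster wastes one further n; this waste is the fraction 1/m of what a trivial packing costs, and
  m is arbitrary. Adding a little to D and E creates room for n^(2 \<eta>) translates of each of the
  progressions in different residue classes, and these contain the progressions of all the multiples
  s p with s \<le> n^(2 \<eta>) (lemmas cluster_disjoint, packed_into_cluster, fits_prime_multiples).

  The other differences are cheap. Those above n^(1/2 + \<eta>) are placed greedily. If d = s P with
  a prime P > sqrt n, then for fixed s no translation is needed at all. All remaining d have no
  prime factor above n^(1/2 - \<eta>); they are very small or have a divisor e in
  [n^(2 \<eta>), n^(1/2 - \<eta>)], and e differences divisible by e fit into different residue classes
  modulo e of one interval of length n + e.

  The main term is evaluated by the prime number theorem and partial summation. The prime number
  theorem is proved along Newman's lines: (s - 1) zeta(s) extends to Re s > 0 and has no zero on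
  Re s \<ge> 1, hence the Dirichlet series with the bounded coefficients (psi(n) - n) / n extends
  beyond the line Re s = 1; the Tauberian theorem newman makes it converge at s = 1, and since psi
  is monotone, this is only possible if psi(n) ~ n.
\<close>

section \<open>Packing families of progressions\<close>

text \<open>
  The length is a real upper bound so that the costs of subfamilies can be added and
  estimated without rounding.
\<close>
definition fits :: "nat set \<Rightarrow> nat \<Rightarrow> real \<Rightarrow> bool" where
  "fits D n x \<longleftrightarrow> (\<exists>N. real N \<le> x \<and> packed_into D (multiples_set n) N)"

lemma packed_into_multiples_iff:
  "packed_into D (multiples_set n) N \<longleftrightarrow>
    (\<exists>\<sigma>. (\<forall>d\<in>D. \<forall>j\<in>{1..n div d}. \<sigma> d + int (j * d) \<in> {1..int N}) \<and>
         (\<forall>d\<in>D. \<forall>e\<in>D. d \<noteq> e \<longrightarrow>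
           (\<forall>i\<in>{1..n div d}. \<forall>j\<in>{1..n div e}. \<sigma> d + int (i * d) \<noteq> \<sigma> e + int (j * e))))"
proof -
  have eq: "(\<lambda>x. \<sigma> d + x) ` multiples_set n d = (\<lambda>j. \<sigma> d + int (j * d)) ` {1..n div d}"
    for \<sigma> :: "nat \<Rightarrow> int" and d
  proof -
    have "multiples_set n d = (\<lambda>j. int (j * d)) ` {1..n div d}"
      unfolding multiples_set_def by auto
    then show ?thesis by (simp add: image_image)
  qed
  show ?thesis
    unfolding packed_into_def eq disjoint_family_on_def
    by (intro ex_cong1 conj_cong) (simp_all add: image_subset_iff disjoint_iff image_iff, metis)
qed

lemma progression_term_bounds:
  fixes d j n :: nat
  assumes "j \<in> {1..n div d}"
  shows "1 \<le> j * d" and "j * d \<le> n"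
proof -
  have "d > 0" using assms by (cases d) auto
  then show "1 \<le> j * d" using assms by simp
  show "j * d \<le> n"
    using assms by (metis atLeastAtMost_iff div_times_less_eq_dividend mult_le_mono1 order_trans)
qed

lemma packed_into_mono:
  assumes "packed_into D C N" "D' \<subseteq> D" "N \<le> N'"
  shows "packed_into D' C N'"
proof -
  obtain \<sigma> where 1: "\<forall>d\<in>D. (\<lambda>x. \<sigma> d + x) ` C d \<subseteq> {1..int N}"
    and 2: "disjoint_family_on (\<lambda>d. (\<lambda>x. \<sigma> d + x) ` C d) D"
    using assms(1) unfolding packed_into_def by blast
  have "{1..int N} \<subseteq> {1..int N'}" using assms(3) by auto
  then show ?thesis unfolding packed_into_def
    using 1 assms(2) disjoint_family_on_mono[OF assms(2) 2] by blast
qed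

lemma fits_mono:
  assumes "fits D n x" "D' \<subseteq> D" "x \<le> y"
  shows "fits D' n y"
  using assms packed_into_mono unfolding fits_def by (meson order_refl order_trans)

text \<open>
  The second packing is put behind the first one.
\<close>
lemma fits_Un:
  assumes "fits D n x" "fits D' n y"
  shows "fits (D \<union> D') n (x + y)"
proof -
  obtain N \<sigma> where N: "real N \<le> x"
    and s1: "\<And>d j. d \<in> D \<Longrightarrow> j\<in>{1..n div d} \<Longrightarrow> \<sigma> d + int (j * d) \<in> {1..int N}"
    and s2: "\<And>d e i j. d \<in> D \<Longrightarrow> e \<in> D \<Longrightarrow> d \<noteq> e \<Longrightarrow> i\<in>{1..n div d} \<Longrightarrow> j\<in>{1..n div e}
       \<Longrightarrow> \<sigma> d + int (i * d) \<noteq> \<sigma> e + int (j * e)"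
    using assms(1) unfolding fits_def packed_into_multiples_iff by blast
  obtain N' \<tau> where N': "real N' \<le> y"
    and t1: "\<And>d j. d \<in> D' \<Longrightarrow> j\<in>{1..n div d} \<Longrightarrow> \<tau> d + int (j * d) \<in> {1..int N'}"
    and t2: "\<And>d e i j. d \<in> D' \<Longrightarrow> e \<in> D' \<Longrightarrow> d \<noteq> e \<Longrightarrow> i\<in>{1..n div d} \<Longrightarrow> j\<in>{1..n div e}
       \<Longrightarrow> \<tau> d + int (i * d) \<noteq> \<tau> e + int (j * e)"
    using assms(2) unfolding fits_def packed_into_multiples_iff by blast
  define \<rho> where "\<rho> d = (if d \<in> D then \<sigma> d else int N + \<tau> d)" for d
  have "packed_into (D \<union> D') (multiples_set n) (N + N')"
    unfolding packed_into_multiples_iff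
  proof (intro exI conjI ballI impI)
    fix d j assume "d \<in> D \<union> D'" "j \<in> {1..n div d}"
    then show "\<rho> d + int (j * d) \<in> {1..int (N + N')}"
      using s1[of d j] t1[of d j] by (cases "d \<in> D") (auto simp: \<rho>_def)
  next
    fix d e i j assume "d \<in> D \<union> D'" "e \<in> D \<union> D'" "d \<noteq> e" "i \<in> {1..n div d}" "j \<in> {1..n div e}"
    then show "\<rho> d + int (i * d) \<noteq> \<rho> e + int (j * e)"
      using s1[of d i] t1[of d i] s1[of e j] t1[of e j] s2[of d e i j] t2[of d e i j]
      by (cases "d \<in> D"; cases "e \<in> D") (auto simp: \<rho>_def)
  qed
  then show ?thesis
    unfolding fits_def using N N' by (intro exI[of _ "N + N'"]) auto
qed

lemma fits_empty: "0 \<le> x \<Longrightarrow> fits {} n x"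
  unfolding fits_def packed_into_multiples_iff by (intro exI[of _ 0]) auto

lemma fits_UN:
  assumes "finite I" "\<And>i. i \<in> I \<Longrightarrow> fits (D i) n (x i)"
  shows "fits (\<Union>i\<in>I. D i) n (\<Sum>i\<in>I. x i)"
  using assms by (induction I rule: finite_induct) (auto intro: fits_empty fits_Un)

text \<open>
  The translates are placed in different residue classes modulo e.
\<close>
lemma fits_common_divisor:
  assumes "finite D" "\<And>d. d \<in> D \<Longrightarrow> e dvd d" "card D \<le> e"
  shows "fits D n (real n + real e)"
proof -
  obtain f where f: "f ` D \<subseteq> {..<e}" "inj_on f D"
    using card_le_inj[of D "{..<e}"] assms by auto
  have mod_eq_self: "(r + i * d) mod e = r" if "d \<in> D" "r < e" for d r i
  proof -
    have "e dvd i * d" using assms(2)[OF that(1)] by simp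
    then have "(r + i * d) mod e = r mod e" by (metis add.right_neutral dvd_imp_mod_0 mod_add_right_eq)
    then show ?thesis using that by simp
  qed
  have "packed_into D (multiples_set n) (n + e)"
    unfolding packed_into_multiples_iff
  proof (intro exI[of _ "\<lambda>d. int (f d)"] conjI ballI impI)
    fix d j assume "d \<in> D" and j: "j \<in> {1..n div d}"
    have "f d < e" using f \<open>d \<in> D\<close> by auto
    moreover have "1 \<le> int (j * d)" "int (j * d) \<le> int n"
      using progression_term_bounds[OF j] by linarith+
    ultimately show "int (f d) + int (j * d) \<in> {1..int (n + e)}"
      by auto
  next
    fix d d' i j assume d: "d \<in> D" "d' \<in> D" "d \<noteq> d'"
    show "int (f d) + int (i * d) \<noteq> int (f d') + int (j * d')"
    proof
      assume "int (f d) + int (i * d) = int (f d') + int (j * d')"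
      then have "f d + i * d = f d' + j * d'" by (simp flip: of_nat_add of_nat_mult)
      then have "(f d + i * d) mod e = (f d' + j * d') mod e" by simp
      moreover have "(f d + i * d) mod e = f d" "(f d' + j * d') mod e = f d'"
        using mod_eq_self[of d "f d" i] mod_eq_self[of d' "f d'" j] d f by auto
      ultimately show False using f d by (auto dest: inj_onD)
    qed
  qed
  then show ?thesis unfolding fits_def by (intro exI[of _ "n + e"]) auto
qed

lemma fits_common_divisor_groups:
  assumes "finite D" "\<And>d. d \<in> D \<Longrightarrow> e dvd d" "card D \<le> q * e"
  shows "fits D n (real q * (real n + real e))"
  using assms
proof (induction q arbitrary: D)
  case 0
  then show ?case by (auto intro: fits_empty)
next
  case (Suc q)
  show ?case
  proof (cases "card D \<le> e")
    case True
    have "real n + real e \<le> real (Suc q) * (real n + real e)"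
      by (simp add: algebra_simps)
    then show ?thesis
      using fits_mono[OF fits_common_divisor[OF Suc.prems(1,2) True]] by blast
  next
    case False
    then obtain B where B: "B \<subseteq> D" "card B = e"
      by (meson nat_le_linear obtain_subset_with_card_n)
    have "fits B n (real n + real e)"
      using B Suc.prems by (intro fits_common_divisor) (auto intro: finite_subset)
    moreover have "fits (D - B) n (real q * (real n + real e))"
      using B Suc.prems by (intro Suc.IH) (auto simp: card_Diff_subset finite_subset)
    ultimately have "fits (B \<union> (D - B)) n ((real n + real e) + real q * (real n + real e))"
      by (rule fits_Un)
    then show ?thesis using B by (auto simp: algebra_simps elim: fits_mono)
  qed
qed

lemma fits_singleton: "fits {d} n (real n)"
proof -
  have "packed_into {d} (multiples_set n) n"
    unfolding packed_into_multiples_iff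
    using progression_term_bounds[of _ n d]
    by (intro exI[of _ "\<lambda>_. 0"]) (simp flip: of_nat_mult)
  then show ?thesis unfolding fits_def by auto
qed

lemma fits_each:
  assumes "finite D"
  shows "fits D n (real (card D) * real n)"
  using fits_UN[OF assms, of "\<lambda>d. {d}" n "\<lambda>_. real n"] fits_singleton by simp

text \<open>
  The differences are placed one after the other. A shift of the new progression is ruled out
  by a pair consisting of one of its at most w terms and a term placed before, so there are
  fewer bad shifts than shifts.
\<close>
lemma fits_greedy:
  assumes "finite D" "\<And>d. d \<in> D \<Longrightarrow> n div d \<le> w"
  shows "fits D n (real (n + w * (\<Sum>d\<in>D. n div d)))"
proof -
  define T where "T = w * (\<Sum>d\<in>D. n div d)"
  have "packed_into F (multiples_set n) (n + T)" if "F \<subseteq> D" for F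
  proof -
    have "finite F" using that assms(1) finite_subset by blast
    then show ?thesis using that
    proof (induction F rule: finite_induct)
      case empty
      then show ?case by (auto simp: packed_into_multiples_iff)
    next
      case (insert d F)
      have "packed_into F (multiples_set n) (n + T)" using insert by blast
      then obtain \<sigma> where
        s1: "\<And>d j. d \<in> F \<Longrightarrow> j\<in>{1..n div d} \<Longrightarrow> \<sigma> d + int (j * d) \<in> {1..int (n + T)}"
        and s2: "\<And>d e i j. d \<in> F \<Longrightarrow> e \<in> F \<Longrightarrow> d \<noteq> e \<Longrightarrow> i\<in>{1..n div d} \<Longrightarrow> j\<in>{1..n div e}
          \<Longrightarrow> \<sigma> d + int (i * d) \<noteq> \<sigma> e + int (j * e)"
        unfolding packed_into_multiples_iff by blast
      define B where "B = (\<lambda>((e, i), j). \<sigma> e + int (i * e) - int (j * d)) `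
        (Sigma F (\<lambda>e. {1..n div e}) \<times> {1..n div d})"
      have "card B \<le> card (Sigma F (\<lambda>e. {1..n div e}) \<times> {1..n div d})"
        unfolding B_def using insert.hyps by (intro card_image_le) auto
      also have "\<dots> = (\<Sum>e\<in>F. n div e) * (n div d)"
        using insert.hyps by (simp add: card_cartesian_product card_SigmaI)
      also have "\<dots> \<le> (\<Sum>d\<in>D. n div d) * w"
        using insert.prems assms by (intro mult_le_mono sum_mono2) auto
      finally have cB: "card B \<le> T" by (simp add: T_def mult.commute)
      have "finite B" unfolding B_def using insert.hyps by auto
      have "\<not> {0..int T} \<subseteq> B"
      proof
        assume "{0..int T} \<subseteq> B"
        then have "card {0..int T} \<le> card B" using \<open>finite B\<close> by (rule card_mono[rotated])
        then show False using cB by simp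
      qed
      then obtain t where t: "t \<in> {0..int T}" "t \<notin> B" by blast
      show ?case unfolding packed_into_multiples_iff
      proof (intro exI[of _ "\<sigma>(d := t)"] conjI ballI impI)
        fix e j assume e: "e \<in> insert d F" and j: "j \<in> {1..n div e}"
        show "(\<sigma>(d := t)) e + int (j * e) \<in> {1..int (n + T)}"
        proof (cases "e = d")
          case True
          have "1 \<le> int (j * e)" "int (j * e) \<le> int n"
            using progression_term_bounds[OF j] by linarith+
          then show ?thesis using t True by auto
        next
          case False
          then show ?thesis using s1[of e j] e j by auto
        qed
      next
        fix e e' i j assume e: "e \<in> insert d F" "e' \<in> insert d F" "e \<noteq> e'"
          and ij: "i \<in> {1..n div e}" "j \<in> {1..n div e'}"
        have 1: "t + int (j * d) \<noteq> \<sigma> e + int (i * e)" if "e \<in> F" "i \<in> {1..n div e}" "j \<in> {1..n div d}" for e i j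
        proof
          assume "t + int (j * d) = \<sigma> e + int (i * e)"
          then have "t = (\<lambda>((e, i), j). \<sigma> e + int (i * e) - int (j * d)) ((e, i), j)" by simp
          then have "t \<in> B" unfolding B_def using that by blast
          then show False using t by blast
        qed
        show "(\<sigma>(d := t)) e + int (i * e) \<noteq> (\<sigma>(d := t)) e' + int (j * e')"
          using e ij 1[of e' j i] 1[of e i j] s2[of e e' i j] by (cases "e = d"; cases "e' = d") auto
      qed
    qed
  qed
  from this[of D] show ?thesis
    unfolding fits_def T_def by (intro exI[of _ "n + w * (\<Sum>d\<in>D. n div d)"]) auto
qed

text \<open>
  No translation is needed: a common multiple of s P and s R is a multiple of s P R, and
  P R > n.
\<close>
lemma fits_large_prime_multiples:
  assumes "\<And>d. d \<in> D \<Longrightarrow> \<exists>P. prime P \<and> n < P * P \<and> d = s * P"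
  shows "fits D n (real n)"
proof -
  have "packed_into D (multiples_set n) n"
    unfolding packed_into_multiples_iff
  proof (intro exI[of _ "\<lambda>_. 0"] conjI ballI impI)
    fix d j assume j: "j \<in> {1..n div d}"
    show "0 + int (j * d) \<in> {1..int n}"
      using progression_term_bounds[OF j] by (simp flip: of_nat_mult)
  next
    fix d e i j assume d: "d \<in> D" "e \<in> D" "d \<noteq> e" and i: "i \<in> {1..n div d}" and j: "j \<in> {1..n div e}"
    obtain P where P: "prime P" "n < P * P" "d = s * P" using assms d by blast
    obtain R where R: "prime R" "n < R * R" "e = s * R" using assms d by blast
    have "s > 0" using i P by (cases s) auto
    have "P \<noteq> R" using P R d by auto
    show "0 + int (i * d) \<noteq> 0 + int (j * e)"
    proof
      assume "0 + int (i * d) = 0 + int (j * e)"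
      then have "i * d = j * e" by (simp flip: of_nat_mult)
      then have eq: "i * P = j * R" using P R \<open>s > 0\<close> by (auto simp: ac_simps)
      then have "R dvd i * P" by simp
      moreover have "coprime R P" using P R \<open>P \<noteq> R\<close> primes_coprime by blast
      ultimately have "R dvd i" by (simp add: coprime_dvd_mult_left_iff)
      then have "R \<le> i" using i by (auto intro: dvd_imp_le)
      then have "R * P \<le> i * (s * P)" using \<open>s > 0\<close> by (intro mult_le_mono) auto
      also have "\<dots> \<le> n" using progression_term_bounds(2)[OF i] P(3) by simp
      finally have "R * P \<le> n" .
      moreover have "P * P \<le> R * P \<or> R * R \<le> R * P" by (metis mult_le_mono1 mult_le_mono2 nat_le_linear)
      ultimately show False using P R by linarith
    qed
  qed
  then show ?thesis unfolding fits_def by auto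
qed

section \<open>Clusters of primes\<close>

text \<open>
  The geometric core of the upper bound. With the weights cleared by M, the distance of the two
  translates is u p j + v p i with v \<ge> 0 and u \<ge> M D' - M E'. A common point would give
  (a - u) p j = (b + v) p i, so a - u would be a positive multiple of p i, and a p j > n.
  The multiples s M of the extra shift are absorbed by u and v, since M is itself an integer
  multiple of p i - p j.
\<close>
lemma cluster_disjoint:
  fixes p :: "nat \<Rightarrow> int" and M D' E' s s' a b :: int
  assumes ji: "j < i"
    and mono: "\<And>k l. j \<le> k \<Longrightarrow> k < l \<Longrightarrow> l \<le> i \<Longrightarrow> p k < p l"
    and p0: "0 < p0" "p0 \<le> p j"
    and cop: "coprime (p i) (p j)"
    and dvd: "(p i - p j) dvd M" and M: "M > 0"
    and D': "D' \<ge> 0" and E': "E' \<ge> 0" and ss: "\<bar>s - s'\<bar> \<le> E'"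
    and big: "n < (M * D' - M * E' + p0) * p0"
    and b: "b \<ge> 1" and a: "a * p j \<le> n" and n: "n \<ge> 0"
  shows "(\<Sum>k<i. M * D' * p k + M * E' * p (Suc k)) + s * M + b * p i
       \<noteq> (\<Sum>k<j. M * D' * p k + M * E' * p (Suc k)) + s' * M + a * p j"
proof
  assume eq: "(\<Sum>k<i. M * D' * p k + M * E' * p (Suc k)) + s * M + b * p i
       = (\<Sum>k<j. M * D' * p k + M * E' * p (Suc k)) + s' * M + a * p j"
  obtain M' where M': "M = (p i - p j) * M'" using dvd by (elim dvdE)
  have \<delta>: "p i - p j \<ge> 1" using mono[of j i] ji by auto
  then have M'pos: "M' > 0" using M M' by (metis zero_less_mult_pos less_le_trans zero_less_one)
  have le: "p j \<le> p k" "p k \<le> p i" if "j \<le> k" "k \<le> i" for k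
    using that mono[of j k] mono[of k i] by (cases "k = j"; cases "k = i"; force)+
  define U where "U = M' * (\<Sum>k\<in>{j..<i}. D' * (p i - p k) + E' * (p i - p (Suc k))) - (s - s') * M'"
  define V where "V = M' * (\<Sum>k\<in>{j..<i}. D' * (p k - p j) + E' * (p (Suc k) - p j)) + (s - s') * M'"
  have split: "(\<Sum>k<i. f k) = (\<Sum>k<j. f k) + (\<Sum>k\<in>{j..<i}. f k)" for f :: "nat \<Rightarrow> int"
    using ji sum.atLeastLessThan_concat[of 0 j i f] by (simp add: atLeast0LessThan)
  \<comment> \<open>Each p k is the convex combination of p j and p i, with weights that become integral
    after multiplication by M.\<close>
  have "M * D' * x + M * E' * y =
        M' * (D' * (p i - x) + E' * (p i - y)) * p j + M' * (D' * (x - p j) + E' * (y - p j)) * p i" for x y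
    unfolding M' by (simp add: algebra_simps)
  then have "(\<Sum>k\<in>{j..<i}. M * D' * p k + M * E' * p (Suc k)) =
      (\<Sum>k\<in>{j..<i}. M' * (D' * (p i - p k) + E' * (p i - p (Suc k))) * p j
        + M' * (D' * (p k - p j) + E' * (p (Suc k) - p j)) * p i)"
    by simp
  also have "\<dots> = M' * (\<Sum>k\<in>{j..<i}. D' * (p i - p k) + E' * (p i - p (Suc k))) * p j
      + M' * (\<Sum>k\<in>{j..<i}. D' * (p k - p j) + E' * (p (Suc k) - p j)) * p i"
    by (simp only: sum.distrib sum_distrib_left[symmetric] sum_distrib_right[symmetric])
  finally have "(\<Sum>k\<in>{j..<i}. M * D' * p k + M * E' * p (Suc k)) + (s - s') * M = U * p j + V * p i"
    unfolding U_def V_def by (simp add: M' algebra_simps)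
  with eq have key: "(a - U) * p j = (b + V) * p i"
    by (simp add: split algebra_simps)
  have "M' * E' \<ge> \<bar>s - s'\<bar> * M'"
    using ss M'pos by (simp add: mult.commute)
  then have sM: "(s - s') * M' \<le> M' * E'" "- ((s - s') * M') \<le> M' * E'"
    using M'pos by (smt (verit) mult_minus_left mult_right_mono)+
  have "E' * (p i - p j) \<le> D' * (p (i-1) - p j) + E' * (p (Suc (i-1)) - p j)"
    using ji D' le(1)[of "i-1"] by simp
  also have "\<dots> \<le> (\<Sum>k\<in>{j..<i}. D' * (p k - p j) + E' * (p (Suc k) - p j))"
    using ji D' E' le by (intro member_le_sum add_nonneg_nonneg mult_nonneg_nonneg) auto
  finally have "M' * (E' * (p i - p j)) \<le> M' * (\<Sum>k\<in>{j..<i}. D' * (p k - p j) + E' * (p (Suc k) - p j))"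
    using M'pos by simp
  moreover have "M' * E' \<le> M' * (E' * (p i - p j))"
    using M'pos E' \<delta> by (intro mult_left_mono) (auto simp: mult_le_cancel_left1)
  ultimately have V0: "V \<ge> 0" unfolding V_def using sM by linarith
  have "D' * (p i - p j) \<le> D' * (p i - p j) + E' * (p i - p (Suc j))"
    using ji E' le(2)[of "Suc j"] by simp
  also have "\<dots> \<le> (\<Sum>k\<in>{j..<i}. D' * (p i - p k) + E' * (p i - p (Suc k)))"
    using ji D' E' le
    by (intro member_le_sum[of j _ "\<lambda>k. D' * (p i - p k) + E' * (p i - p (Suc k))"]
        add_nonneg_nonneg mult_nonneg_nonneg) auto
  finally have "M' * (D' * (p i - p j)) \<le> M' * (\<Sum>k\<in>{j..<i}. D' * (p i - p k) + E' * (p i - p (Suc k)))"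
    using M'pos by simp
  moreover have "M' * (D' * (p i - p j)) = M * D'" unfolding M' by (simp add: algebra_simps)
  moreover have "M' * E' \<le> M * E'"
    unfolding M' using M'pos E' \<delta> by (intro mult_right_mono) (auto simp: mult_le_cancel_right1)
  ultimately have U0: "U \<ge> M * D' - M * E'" unfolding U_def using sM by linarith
  have pp: "p j > 0" "p i > 0" using p0 le[of i] ji by auto
  have "p i dvd (a - U) * p j" using key by simp
  then have "p i dvd a - U" using cop by (simp add: coprime_dvd_mult_left_iff)
  moreover have "a - U > 0"
  proof -
    have "(b + V) * p i > 0" using b V0 pp by (intro mult_pos_pos) auto
    then show ?thesis using key pp by (metis zero_less_mult_pos2)
  qed
  ultimately have "p i \<le> a - U" by (rule zdvd_imp_le)
  then have a': "a \<ge> M * D' - M * E' + p0" using U0 le[of i] p0 ji by auto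
  have "(M * D' - M * E' + p0) * p0 \<le> a * p j"
  proof -
    have "M * D' - M * E' + p0 > 0" using big n p0
      by (metis le_less_trans zero_less_mult_pos2)
    then show ?thesis using a' p0 by (intro mult_mono) auto
  qed
  then show False using big a by linarith
qed

text \<open>
  The progression of s p lies in that of p, so the multiples of p with cofactor at most S
  can be handled together with p.
\<close>
definition cofactor_multiples :: "nat set \<Rightarrow> nat \<Rightarrow> nat set" where
  "cofactor_multiples T S = {s * p | s p. p \<in> T \<and> 1 \<le> s \<and> s \<le> S}"

lemma cofactor_multiples_Un:
  "cofactor_multiples (A \<union> B) S = cofactor_multiples A S \<union> cofactor_multiples B S"
  unfolding cofactor_multiples_def by auto

text \<open>
  The progression of s p i is translated by t i + s M. For different i these translates are
  disjoint by lemma cluster_disjoint; for the same i and different s they lie in different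
  residue classes modulo p i, because p i does not divide M.
\<close>
lemma packed_into_cluster:
  fixes p :: "nat \<Rightarrow> nat"
  assumes mono: "\<And>k l. k < l \<Longrightarrow> l < m \<Longrightarrow> p k < p l"
    and prime: "\<And>k. k < m \<Longrightarrow> prime (p k)"
    and M: "\<And>k l. k < l \<Longrightarrow> l < m \<Longrightarrow> (p l - p k) dvd M" "M > 0"
    and cM: "\<And>k. k < m \<Longrightarrow> coprime (p k) M" and S: "\<And>k. k < m \<Longrightarrow> S < p k"
    and D': "S \<le> D'" "n < (M * (D' - S) + p 0) * p 0"
    and m: "m > 0"
  shows "packed_into (cofactor_multiples (p ` {..<m}) S) (multiples_set n)
     (n + S * M + (\<Sum>k<m-1. M * D' * p k + M * S * p (Suc k)))"
proof -
  define t where "t i = (\<Sum>k<i. M * D' * p k + M * S * p (Suc k))" for i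
  have "\<forall>d\<in>cofactor_multiples (p ` {..<m}) S. \<exists>i s. i < m \<and> 1 \<le> s \<and> s \<le> S \<and> d = s * p i"
    unfolding cofactor_multiples_def by blast
  then obtain ii ss where rep:
    "\<And>d. d \<in> cofactor_multiples (p ` {..<m}) S \<Longrightarrow> ii d < m \<and> 1 \<le> ss d \<and> ss d \<le> S \<and> d = ss d * p (ii d)"
    by metis
  have bound: "a * ss d * p (ii d) \<le> n" if "a \<in> {1..n div d}" "d \<in> cofactor_multiples (p ` {..<m}) S" for a d
    using progression_term_bounds(2)[OF that(1)] rep[OF that(2)] by (metis mult.assoc)
  have t_mono: "t i \<le> t (m - 1)" if "i < m" for i
    unfolding t_def using that by (intro sum_mono2) auto
  have cross: "t i + s * M + b * p i \<noteq> t j + s' * M + a * p j"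
    if "j < i" "i < m" "s \<le> S" "s' \<le> S" "b \<ge> 1" "a * p j \<le> n" for i j s s' a b
  proof -
    have pj: "p 0 \<le> p j" using mono[of 0 j] that by (cases "j = 0") auto
    have p0: "p 0 > 0" using prime[of 0] m prime_gt_0_nat by blast
    have lt: "p j < p i" using mono that by auto
    have "coprime (p i) (p j)" using prime[of i] prime[of j] that lt by (intro primes_coprime) auto
    then have 1: "coprime (int (p i)) (int (p j))" by simp
    have "int (p i - p j) dvd int M" using M(1)[of j i] that by simp
    then have 2: "(int (p i) - int (p j)) dvd int M" using lt by (simp add: of_nat_diff)
    have 3: "int n < (int M * int D' - int M * int S + int (p 0)) * int (p 0)"
    proof -
      have "int n < int ((M * (D' - S) + p 0) * p 0)" using D'(2) by linarith
      also have "\<dots> = (int M * int D' - int M * int S + int (p 0)) * int (p 0)"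
        using D'(1) by (simp add: of_nat_diff right_diff_distrib)
      finally show ?thesis .
    qed
    have 4: "int a * int (p j) \<le> int n" using that by (simp flip: of_nat_mult)
    have "(\<Sum>k<i. int M * int D' * int (p k) + int M * int S * int (p (Suc k))) + int s * int M + int b * int (p i)
       \<noteq> (\<Sum>k<j. int M * int D' * int (p k) + int M * int S * int (p (Suc k))) + int s' * int M + int a * int (p j)"
      using that M(2) p0 pj
      by (intro cluster_disjoint[where p="\<lambda>k. int (p k)" and n="int n", OF that(1) _ _ _ 1 2 _ _ _ _ 3 _ 4]) (auto intro: mono)
    then have "int (t i + s * M + b * p i) \<noteq> int (t j + s' * M + a * p j)"
      unfolding t_def by simp
    then show ?thesis by (metis of_nat_eq_iff)
  qed
  have same: "t i + s * M + b * p i \<noteq> t i + s' * M + a * p i"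
    if "i < m" "s < s'" "s' \<le> S" for i s s' a b
  proof
    assume "t i + s * M + b * p i = t i + s' * M + a * p i"
    then have "b * p i = (s' - s) * M + a * p i"
      using that(2) by (auto simp: algebra_simps diff_mult_distrib le_add_diff_inverse)
    then have "p i dvd (s' - s) * M" by (metis dvd_add_left_iff dvd_triv_right)
    then have "p i dvd s' - s" using cM[OF that(1)] by (simp add: coprime_dvd_mult_left_iff)
    then have "p i \<le> s' - s" using that by (intro dvd_imp_le) auto
    then show False using S[OF that(1)] that by linarith
  qed
  show ?thesis unfolding packed_into_multiples_iff
  proof (intro exI[of _ "\<lambda>d. int (t (ii d) + ss d * M)"] conjI ballI impI)
    fix d j assume d: "d \<in> cofactor_multiples (p ` {..<m}) S" and j: "j \<in> {1..n div d}"
    have "d > 0" using j by (cases d) auto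
    have jd: "j * d \<le> n" using bound[OF j d] rep[OF d] by (metis mult.assoc)
    have "ss d * M \<le> S * M" using rep[OF d] by (intro mult_le_mono1) auto
    moreover have "t (ii d) \<le> t (m - 1)" using rep[OF d] t_mono by auto
    ultimately have "t (ii d) + ss d * M + j * d \<le> n + S * M + t (m - 1)" using jd by linarith
    moreover have "j * d > 0" using j \<open>d > 0\<close> by simp
    ultimately show "int (t (ii d) + ss d * M) + int (j * d)
      \<in> {1..int (n + S * M + (\<Sum>k<m-1. M * D' * p k + M * S * p (Suc k)))}"
      unfolding t_def by (auto simp flip: of_nat_add of_nat_mult simp: Suc_le_eq)
  next
    fix d e i j assume d: "d \<in> cofactor_multiples (p ` {..<m}) S" and e: "e \<in> cofactor_multiples (p ` {..<m}) S"
      and ne: "d \<noteq> e" and i: "i \<in> {1..n div d}" and j: "j \<in> {1..n div e}"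
    have i': "i * ss d \<ge> 1" "i * ss d * p (ii d) \<le> n" using i rep[OF d] bound[OF i d] by auto
    have j': "j * ss e \<ge> 1" "j * ss e * p (ii e) \<le> n" using j rep[OF e] bound[OF j e] by auto
    have "t (ii d) + ss d * M + i * ss d * p (ii d) \<noteq> t (ii e) + ss e * M + j * ss e * p (ii e)"
    proof (cases "ii d" "ii e" rule: linorder_cases)
      case less
      then show ?thesis using cross[of "ii d" "ii e" "ss e" "ss d" "j * ss e" "i * ss d"] rep[OF d] rep[OF e] i' j' by auto
    next
      case greater
      then show ?thesis using cross[of "ii e" "ii d" "ss d" "ss e" "i * ss d" "j * ss e"] rep[OF d] rep[OF e] i' j' by auto
    next
      case equal
      then have "ss d \<noteq> ss e" using rep[OF d] rep[OF e] ne by metis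
      then consider "ss d < ss e" | "ss e < ss d" by linarith
      then show ?thesis
      proof cases
        case 1
        then show ?thesis using same[of "ii d" "ss d" "ss e" "i * ss d" "j * ss e"] rep[OF d] rep[OF e] equal by auto
      next
        case 2
        then show ?thesis using same[of "ii d" "ss e" "ss d" "j * ss e" "i * ss d"] rep[OF d] rep[OF e] equal by auto
      qed
    qed
    moreover have "i * ss d * p (ii d) = i * d" "j * ss e * p (ii e) = j * e"
      using rep[OF d] rep[OF e] by (metis mult.assoc)+
    ultimately have "t (ii d) + ss d * M + i * d \<noteq> t (ii e) + ss e * M + j * e" by metis
    then show "int (t (ii d) + ss d * M) + int (i * d) \<noteq> int (t (ii e) + ss e * M) + int (j * e)"
      by (metis of_nat_add of_nat_eq_iff)
  qed
qed

text \<open>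
  Here M is the product of all differences of the primes in T, which is at most H^(m^2), and
  M D' is only slightly larger than n / p 0 - p 0, as lemma packed_into_cluster needs it. A step
  then costs about (n / p 0 - p 0) (p 0 + H), that is n - p^2 up to the error term, and the summand
  real n is the span of the last progression.
\<close>
lemma fits_cluster:
  fixes H L :: real
  assumes T: "finite T" "card T = m" "m > 0"
    and pr: "\<And>p. p \<in> T \<Longrightarrow> prime p" and S: "\<And>p. p \<in> T \<Longrightarrow> S < p" "1 \<le> S"
    and sq: "\<And>p. p \<in> T \<Longrightarrow> p * p \<le> n"
    and L: "\<And>p. p \<in> T \<Longrightarrow> L \<le> real p" "H < L"
    and H: "\<And>p q. p \<in> T \<Longrightarrow> q \<in> T \<Longrightarrow> real q - real p \<le> H" "1 \<le> H"
  shows "fits (cofactor_multiples T S) n (real n + (\<Sum>p\<in>T. real n - real p ^ 2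
     + (H * (3 * sqrt n + n / L) + 9 * real S * H ^ (m * m) * sqrt n)))"
proof -
  define p where "p k = sorted_list_of_set T ! k" for k
  have len: "length (sorted_list_of_set T) = m" using T by simp
  have Tp: "T = p ` {..<m}"
  proof -
    have "T = set (sorted_list_of_set T)" using T by simp
    also have "\<dots> = p ` {..<m}" unfolding set_conv_nth len p_def by auto
    finally show ?thesis .
  qed
  have mono: "p k < p l" if "k < l" "l < m" for k l
    using sorted_wrt_nth_less[OF strict_sorted_list_of_set[of T] that(1)] that len unfolding p_def by simp
  have pT: "p k \<in> T" if "k < m" for k using that Tp by auto
  have p0: "p 0 \<in> T" using pT T by auto
  define M where "M = (\<Prod>l<m. \<Prod>k<l. p l - p k)"
  have diff: "0 < p l - p k" "real (p l - p k) \<le> H" if "k < l" "l < m" for k l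
    using mono[OF that] H(1)[of "p k" "p l"] pT[of k] pT[of l] that by (auto simp: of_nat_diff)
  have Mpos: "M > 0" unfolding M_def using diff by (auto intro!: prod_pos)
  have Mdvd: "(p l - p k) dvd M" if "k < l" "l < m" for k l
  proof -
    have "(p l - p k) dvd (\<Prod>k<l. p l - p k)" using that by (intro dvd_prodI) auto
    also have "\<dots> dvd M" unfolding M_def
      using that by (intro dvd_prodI[where f="\<lambda>l. \<Prod>k<l. p l - p k"]) auto
    finally show ?thesis .
  qed
  have cop: "coprime (p k) M" if k: "k < m" for k
    unfolding M_def
  proof (intro prod_coprime_right)
    fix l k' assume "l \<in> {..<m}" "k' \<in> {..<l}"
    then have d: "0 < p l - p k'" "real (p l - p k') \<le> H" using diff by auto
    have "real (p l - p k') < real (p k)" using d L(1)[OF pT[OF k]] L(2) by linarith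
    then have "\<not> p k dvd p l - p k'" using d by (auto dest: dvd_imp_le)
    then show "coprime (p k) (p l - p k')" using pr[OF pT[OF k]] prime_imp_coprime by blast
  qed
  have MH: "real M \<le> H ^ (m * m)"
  proof -
    have "real M = (\<Prod>l<m. \<Prod>k<l. real (p l - p k))" unfolding M_def by simp
    also have "\<dots> \<le> (\<Prod>l<m. H ^ m)"
    proof (intro prod_mono conjI prod_nonneg)
      fix l assume l: "l \<in> {..<m}"
      have "(\<Prod>k<l. real (p l - p k)) \<le> (\<Prod>k<l. H)"
        using l diff by (intro prod_mono) auto
      also have "\<dots> \<le> H ^ m" using l H by (auto intro: power_increasing)
      finally show "(\<Prod>k<l. real (p l - p k)) \<le> H ^ m" .
    qed auto
    also have "\<dots> = H ^ (m * m)" by (simp add: power_mult)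
    finally show ?thesis .
  qed
  define X where "X = n div p 0 - p 0 + 1"
  define D' where "D' = X div M + 1 + S"
  have p0pos: "p 0 > 0" using pr[OF p0] prime_gt_0_nat by blast
  have p0n: "p 0 \<le> n div p 0" using sq[OF p0] p0pos by (simp add: less_eq_div_iff_mult_less_eq)
  \<comment> \<open>M (D' - S) is the least multiple of M above X, and X + p 0 exceeds n / p 0.\<close>
  have big: "n < (M * (D' - S) + p 0) * p 0"
  proof -
    have "X < M * (D' - S)" unfolding D'_def using Mpos by (simp add: dividend_less_times_div)
    then have "n div p 0 + 1 \<le> M * (D' - S) + p 0" unfolding X_def using p0n by linarith
    then have "(n div p 0 + 1) * p 0 \<le> (M * (D' - S) + p 0) * p 0" by (rule mult_le_mono1)
    moreover have "n < (n div p 0 + 1) * p 0" using p0pos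
      by (metis add.commute dividend_less_div_times mult.commute mult_Suc_right plus_1_eq_Suc)
    ultimately show ?thesis by linarith
  qed
  have pk: "packed_into (cofactor_multiples (p ` {..<m}) S) (multiples_set n)
     (n + S * M + (\<Sum>k<m-1. M * D' * p k + M * S * p (Suc k)))"
    using S pr pT T(3) big Mpos by (intro packed_into_cluster mono Mdvd cop) (auto simp: D'_def)
  define r where "r = sqrt (real n)"
  define W where "W = H ^ (m * m)"
  define err where "err = H * (3 * r + n / L) + 8 * real S * W * r"
  have W1: "W \<ge> 1" "real M \<le> W" unfolding W_def using H(2) MH by auto
  have rp: "real q \<le> r" if "q \<in> T" for q
    unfolding r_def using sq[OF that] by (intro real_le_rsqrt) (simp add: power2_eq_square flip: of_nat_mult)
  have L0: "L > 0" using L H by auto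
  have H0r: "H \<le> real (p 0)" "real (p 0) \<le> r" using L(1)[OF p0] L(2) rp[OF p0] by auto
  have r1: "r \<ge> 1" using H0r H by linarith
  have SW: "1 \<le> real S * W" "real M \<le> real S * W" "real S * real M \<le> real S * W"
  proof -
    show "1 \<le> real S * W" using mult_mono[of 1 "real S" 1 W] S(2) W1 by simp
    show "real S * real M \<le> real S * W" using W1 by (intro mult_left_mono) auto
    have "real M \<le> real S * real M" using S(2) by (simp add: mult_le_cancel_right1)
    also have "\<dots> \<le> real S * W" using W1 by (intro mult_left_mono) auto
    finally show "real M \<le> real S * W" .
  qed
  have err0: "err \<ge> 0" unfolding err_def using H(2) r1 L0 W1 by (intro add_nonneg_nonneg mult_nonneg_nonneg) auto
  have step: "real (M * D' * p k + M * S * p (Suc k)) \<le> real n - real (p k) ^ 2 + err" if k: "k < m - 1" for k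
  proof -
    define x where "x = real (p 0)"
    have x: "x > 0" "H \<le> x" "x \<le> r" "L \<le> x" using p0pos H0r L(1)[OF p0] by (auto simp: x_def)
    have pk: "real (p k) \<le> x + H" "real (p (Suc k)) \<le> x + H"
      using H(1)[OF p0 pT[of k]] H(1)[OF p0 pT[of "Suc k"]] k unfolding x_def by linarith+
    have "M * D' \<le> X + M + S * M"
      unfolding D'_def by (simp add: algebra_simps)
    then have "real (M * D') \<le> real (X + M + S * M)" by linarith
    moreover have "real X \<le> real n / x - x + 1"
      unfolding X_def x_def using p0n of_nat_div_le_of_nat[of n "p 0"] by (simp add: of_nat_diff)
    ultimately have MD: "real (M * D') + real (M * S) \<le> (real n / x - x) + (1 + real M + 2 * (real S * real M))"
      by (simp add: algebra_simps)
    have "real (M * D' * p k + M * S * p (Suc k)) \<le> real (M * D') * (x + H) + real (M * S) * (x + H)"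
      unfolding of_nat_add of_nat_mult[of "M * D'"] of_nat_mult[of "M * S"] using pk
      by (intro add_mono mult_left_mono) auto
    also have "\<dots> = (real (M * D') + real (M * S)) * (x + H)" by (simp add: algebra_simps)
    also have "\<dots> \<le> ((real n / x - x) + (1 + real M + 2 * (real S * real M))) * (x + H)"
      using MD x H by (intro mult_right_mono) auto
    also have "\<dots> = real n - x\<^sup>2 + (H * (real n / x) - H * x) + (1 + real M + 2 * (real S * real M)) * (x + H)"
      using x by (simp add: field_simps power2_eq_square)
    also have "H * (real n / x) - H * x \<le> H * (real n / L)"
    proof -
      have "real n / x \<le> real n / L" using x L0 by (intro divide_left_mono) auto
      then have "H * (real n / x) \<le> H * (real n / L)" using H by (intro mult_left_mono) auto
      moreover have "H * x \<ge> 0" using x H by auto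
      ultimately show ?thesis by linarith
    qed
    also have "(1 + real M + 2 * (real S * real M)) * (x + H) \<le> (4 * (real S * W)) * (2 * r)"
      using SW x H by (intro mult_mono) auto
    finally have A: "real (M * D' * p k + M * S * p (Suc k)) \<le> real n - x\<^sup>2 + H * (real n / L) + 8 * real S * W * r"
      by (simp add: algebra_simps)
    have "real (p k) ^ 2 \<le> (x + H) ^ 2" using pk by (intro power_mono) auto
    also have "\<dots> = x\<^sup>2 + 2 * (H * x) + H * H" by (simp add: power2_eq_square algebra_simps)
    also have "\<dots> \<le> x\<^sup>2 + 3 * (H * r)"
    proof -
      have "H * x \<le> H * r" "H * H \<le> H * r" using x H by (auto intro!: mult_left_mono)
      then show ?thesis by linarith
    qed
    finally show ?thesis using A unfolding err_def by (simp add: algebra_simps)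
  qed
  have nn: "0 \<le> real n - real q ^ 2" if "q \<in> T" for q
    using sq[OF that] by (simp add: power2_eq_square flip: of_nat_mult)
  have "real (n + S * M + (\<Sum>k<m-1. M * D' * p k + M * S * p (Suc k)))
     \<le> real n + real S * real M + (\<Sum>k<m-1. real n - real (p k) ^ 2 + err)"
    using sum_mono[of "{..<m-1}" "\<lambda>k. real (M * D' * p k + M * S * p (Suc k))"] step by simp
  also have "(\<Sum>k<m-1. real n - real (p k) ^ 2 + err) \<le> (\<Sum>k<m. real n - real (p k) ^ 2 + err)"
    using err0 nn pT by (intro sum_mono2 add_nonneg_nonneg) auto
  also have "\<dots> = (\<Sum>q\<in>T. real n - real q ^ 2 + err)"
  proof -
    have "inj_on p {..<m}" using mono by (intro linorder_inj_onI') (metis lessThan_iff less_irrefl)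
    then show ?thesis unfolding Tp by (simp add: sum.reindex)
  qed
  also have "real S * real M \<le> real m * (real S * W * r)"
  proof -
    have "0 \<le> real S * W" using SW by linarith
    have "real S * real M * 1 \<le> (real S * W) * r"
      using SW W1 r1 \<open>0 \<le> real S * W\<close> by (intro mult_mono) auto
    also have "\<dots> = 1 * (real S * W * r)" by simp
    also have "\<dots> \<le> real m * (real S * W * r)"
      using T r1 \<open>0 \<le> real S * W\<close> by (intro mult_right_mono) auto
    finally show ?thesis by simp
  qed
  also have "real n + real m * (real S * W * r) + (\<Sum>q\<in>T. real n - real q ^ 2 + err)
     = real n + (\<Sum>q\<in>T. real n - real q ^ 2 + (err + real S * W * r))"
    using T by (simp add: sum.distrib sum_subtractf algebra_simps)
  also have "err + real S * W * r = H * (3 * r + n / L) + 9 * real S * W * r" unfolding err_def by simp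
  finally have "real (n + S * M + (\<Sum>k<m-1. M * D' * p k + M * S * p (Suc k)))
     \<le> real n + (\<Sum>p\<in>T. real n - real p ^ 2 + (H * (3 * r + n / L) + 9 * real S * W * r))"
    by simp
  then show ?thesis unfolding fits_def W_def r_def using pk[folded Tp] by blast
qed

lemma fits_cofactor_multiples_trivial:
  assumes "finite T" "\<And>p. p \<in> T \<Longrightarrow> S \<le> p" "\<And>p. p \<in> T \<Longrightarrow> p \<le> n"
  shows "fits (cofactor_multiples T S) n (2 * real n * card T)"
proof -
  have eq: "cofactor_multiples T S = (\<Union>p\<in>T. (\<lambda>s. s * p) ` {1..S})"
    (is "_ = ?R")
  proof (intro equalityI subsetI)
    fix x assume "x \<in> cofactor_multiples T S"
    then obtain s p where "x = s * p" "p \<in> T" "s \<in> {1..S}" unfolding cofactor_multiples_def by auto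
    then show "x \<in> (\<Union>p\<in>T. (\<lambda>s. s * p) ` {1..S})" by blast
  next
    fix x assume "x \<in> (\<Union>p\<in>T. (\<lambda>s. s * p) ` {1..S})"
    then obtain s p where "x = s * p" "p \<in> T" "s \<in> {1..S}" by blast
    then show "x \<in> cofactor_multiples T S" unfolding cofactor_multiples_def by auto
  qed
  have "fits ((\<lambda>s. s * p) ` {1..S}) n (2 * real n)" if "p \<in> T" for p
  proof -
    have "card ((\<lambda>s. s * p) ` {1..S}) \<le> p"
      using card_image_le[of "{1..S}" "\<lambda>s. s * p"] assms(2)[OF that] by simp
    then have "fits ((\<lambda>s. s * p) ` {1..S}) n (real n + real p)"
      by (intro fits_common_divisor) auto
    then show ?thesis using assms(3)[OF that] by (auto elim: fits_mono)
  qed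
  then have "fits (cofactor_multiples T S) n (\<Sum>p\<in>T. 2 * real n)"
    unfolding eq using assms(1) by (intro fits_UN) auto
  then show ?thesis by (simp add: mult.commute)
qed

text \<open>
  Clusters of m primes are split off as long as possible. The fewer than m primes left over
  are packed separately.
\<close>
lemma fits_prime_window:
  fixes H L :: real
  assumes "finite T" and m: "m > 0"
    and pr: "\<And>p. p \<in> T \<Longrightarrow> prime p" and S: "\<And>p. p \<in> T \<Longrightarrow> S < p" "1 \<le> S"
    and sq: "\<And>p. p \<in> T \<Longrightarrow> p * p \<le> n"
    and L: "\<And>p. p \<in> T \<Longrightarrow> L \<le> real p" "H < L"
    and H: "\<And>p q. p \<in> T \<Longrightarrow> q \<in> T \<Longrightarrow> real q - real p \<le> H" "1 \<le> H"
  shows "fits (cofactor_multiples T S) n ((\<Sum>p\<in>T. real n - real p ^ 2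
     + (H * (3 * sqrt n + n / L) + 9 * real S * H ^ (m * m) * sqrt n)) + real n * card T / m + 2 * real n * m)"
  using assms
proof (induction T rule: finite_psubset_induct)
  case (psubset T)
  let ?g = "\<lambda>p. real n - real p ^ 2 + (H * (3 * sqrt n + n / L) + 9 * real S * H ^ (m * m) * sqrt n)"
  have L0: "L > 0" using psubset.prems by auto
  have g0: "0 \<le> ?g p" if "p \<in> T" for p
  proof -
    have "0 \<le> real n - real p ^ 2"
      using psubset.prems(5)[OF that] by (simp add: power2_eq_square flip: of_nat_mult)
    then show ?thesis using psubset.prems L0 by (intro add_nonneg_nonneg) auto
  qed
  show ?case
  proof (cases "card T < m")
    case True
    have "fits (cofactor_multiples T S) n (2 * real n * card T)"
    proof (rule fits_cofactor_multiples_trivial)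
      fix p assume "p \<in> T"
      then show "S \<le> p" using psubset.prems(3) by (auto intro: less_imp_le)
      have "p * 1 \<le> p * p" using psubset.prems(2)[OF \<open>p \<in> T\<close>] prime_gt_0_nat[of p] by (intro mult_le_mono2) auto
      then show "p \<le> n" using psubset.prems(5)[OF \<open>p \<in> T\<close>] by linarith
    qed (use psubset.hyps in auto)
    moreover have "2 * real n * card T \<le> sum ?g T + real n * card T / m + 2 * real n * m"
    proof -
      have "2 * real n * card T \<le> 2 * real n * m" using True by (intro mult_left_mono) auto
      moreover have "0 \<le> sum ?g T" using g0 by (intro sum_nonneg) auto
      moreover have "0 \<le> real n * card T / m" by simp
      ultimately show ?thesis by linarith
    qed
    ultimately show ?thesis using fits_mono by blast
  next
    case False
    then obtain B where B: "B \<subseteq> T" "card B = m" by (meson not_less obtain_subset_with_card_n)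
    have fB: "finite B" using B psubset.hyps finite_subset by blast
    have "fits (cofactor_multiples B S) n (real n + sum ?g B)"
    proof (rule fits_cluster)
      show "real q - real p \<le> H" if "p \<in> B" "q \<in> B" for p q
        using psubset.prems(8)[of p q] that B by auto
    qed (use B fB psubset.prems in auto)
    moreover have "fits (cofactor_multiples (T - B) S) n (sum ?g (T - B) + real n * card (T - B) / m + 2 * real n * m)"
    proof (rule psubset.IH)
      show "T - B \<subset> T" using B m by (metis Diff_cancel Diff_disjoint card.empty inf.absorb_iff2 psubsetI Diff_subset less_irrefl inf_commute)
    qed (use psubset.prems in auto)
    ultimately have "fits (cofactor_multiples B S \<union> cofactor_multiples (T - B) S) n
        ((real n + sum ?g B) + (sum ?g (T - B) + real n * card (T - B) / m + 2 * real n * m))"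
      by (rule fits_Un)
    moreover have "cofactor_multiples B S \<union> cofactor_multiples (T - B) S = cofactor_multiples T S"
      using B by (simp add: cofactor_multiples_Un[symmetric] Un_absorb1)
    moreover have "(real n + sum ?g B) + (sum ?g (T - B) + real n * card (T - B) / m + 2 * real n * m)
        = sum ?g T + real n * card T / m + 2 * real n * m"
    proof -
      have "sum ?g T = sum ?g B + sum ?g (T - B)"
        using sum.subset_diff[OF B(1) psubset.hyps(1), of ?g] by simp
      moreover have "card (T - B) = card T - m" using B fB by (simp add: card_Diff_subset)
      then have "real n * card (T - B) / m = real n * card T / m - real n"
        using m False by (simp add: of_nat_diff field_simps)
      ultimately show ?thesis by simp
    qed
    ultimately show ?thesis by simp
  qed
qed

text \<open>
  The primes up to sqrt n are distributed to windows of length H.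
\<close>
lemma fits_prime_multiples:
  fixes H L :: real
  assumes "finite T" and m: "m > 0"
    and pr: "\<And>p. p \<in> T \<Longrightarrow> prime p" and S: "\<And>p. p \<in> T \<Longrightarrow> S < p" "1 \<le> S"
    and sq: "\<And>p. p \<in> T \<Longrightarrow> p * p \<le> n"
    and L: "\<And>p. p \<in> T \<Longrightarrow> L \<le> real p" "H < L" and H: "1 \<le> H"
  shows "fits (cofactor_multiples T S) n ((\<Sum>p\<in>T. real n - real p ^ 2
     + (H * (3 * sqrt n + n / L) + 9 * real S * H ^ (m * m) * sqrt n)) + real n * card T / m
     + 2 * real n * m * (sqrt n / H + 1))"
proof -
  let ?g = "\<lambda>p. real n - real p ^ 2 + (H * (3 * sqrt n + n / L) + 9 * real S * H ^ (m * m) * sqrt n)"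
  define J where "J = nat \<lfloor>sqrt n / H\<rfloor>"
  define h where "h p = nat \<lfloor>real p / H\<rfloor>" for p
  have rp: "real q \<le> sqrt n" if "q \<in> T" for q
    using sq[OF that] by (intro real_le_rsqrt) (simp add: power2_eq_square flip: of_nat_mult)
  have hJ: "h ` T \<subseteq> {..J}"
    unfolding h_def J_def using rp H by (auto intro!: nat_mono floor_mono divide_right_mono)
  have "fits (cofactor_multiples {p\<in>T. h p = j} S) n
     (sum ?g {p\<in>T. h p = j} + real n * card {p\<in>T. h p = j} / m + 2 * real n * m)" for j
  proof (rule fits_prime_window)
    fix p q assume p: "p \<in> {p \<in> T. h p = j}" and q: "q \<in> {p \<in> T. h p = j}"
    have "\<lfloor>real p / H\<rfloor> = \<lfloor>real q / H\<rfloor>"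
    proof -
      have "\<lfloor>real p / H\<rfloor> \<ge> 0" "\<lfloor>real q / H\<rfloor> \<ge> 0" using H by auto
      then show ?thesis using p q unfolding h_def by (metis (mono_tags, lifting) eq_nat_nat_iff mem_Collect_eq)
    qed
    then have "real q / H - real p / H \<le> 1" by linarith
    then show "real q - real p \<le> H" using H by (simp add: field_simps)
  qed (use assms in auto)
  then have f: "fits (\<Union>j\<in>{..J}. cofactor_multiples {p\<in>T. h p = j} S) n
     (\<Sum>j\<in>{..J}. sum ?g {p\<in>T. h p = j} + real n * card {p\<in>T. h p = j} / m + 2 * real n * m)"
    by (intro fits_UN) auto
  have eq: "(\<Union>j\<in>{..J}. cofactor_multiples {p\<in>T. h p = j} S) = cofactor_multiples T S"
    using hJ unfolding cofactor_multiples_def by (auto simp: image_subset_iff)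
  have le: "(\<Sum>j\<in>{..J}. sum ?g {p\<in>T. h p = j} + real n * card {p\<in>T. h p = j} / m + 2 * real n * m)
     \<le> sum ?g T + real n * card T / m + 2 * real n * m * (sqrt n / H + 1)"
  proof -
    have 1: "(\<Sum>j\<in>{..J}. sum ?g {p\<in>T. h p = j}) = sum ?g T"
      using assms(1) hJ by (intro sum.group) auto
    have "(\<Sum>j\<in>{..J}. sum (\<lambda>_. 1) {p\<in>T. h p = j}) = sum (\<lambda>_. 1::real) T"
      using assms(1) hJ by (intro sum.group) auto
    then have 2: "(\<Sum>j\<in>{..J}. real (card {p\<in>T. h p = j})) = card T" by simp
    have 3: "real (card {..J}) \<le> sqrt n / H + 1" unfolding J_def using H by simp
    have "(\<Sum>j\<in>{..J}. real n * card {p\<in>T. h p = j} / m) = real n / m * (\<Sum>j\<in>{..J}. real (card {p\<in>T. h p = j}))"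
      by (simp add: sum_distrib_left)
    also have "\<dots> = real n * card T / m" using 2 by simp
    finally have 4: "(\<Sum>j\<in>{..J}. real n * card {p\<in>T. h p = j} / m) = real n * card T / m" .
    have 5: "(\<Sum>j\<in>{..J}. 2 * real n * m) \<le> 2 * real n * m * (sqrt n / H + 1)"
      using mult_left_mono[OF 3, of "2 * real n * m"] by (simp add: mult.commute)
    have "(\<Sum>j\<in>{..J}. sum ?g {p\<in>T. h p = j} + real n * card {p\<in>T. h p = j} / m + 2 * real n * m)
       = (\<Sum>j\<in>{..J}. sum ?g {p\<in>T. h p = j}) + (\<Sum>j\<in>{..J}. real n * card {p\<in>T. h p = j} / m)
         + (\<Sum>j\<in>{..J}. 2 * real n * m)"
      by (simp only: sum.distrib)
    then show ?thesis unfolding 1 4 using 5 by linarith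
  qed
  show ?thesis by (rule fits_mono[OF f[unfolded eq] order_refl le])
qed

section \<open>The remaining differences\<close>

lemma sum_inverse_squares_le:
  fixes a b :: nat
  assumes "1 \<le> a"
  shows "(\<Sum>e\<in>{a..b}. 1 / real e ^ 2) \<le> 2 / real a"
proof -
  have "(\<Sum>e\<in>{a..b}. 1 / real e ^ 2) \<le> 2 / real a - 1 / real b" if "a \<le> b"
    using that
  proof (induction b rule: dec_induct)
    case base
    have "1 / real a ^ 2 \<le> 1 / real a" using assms by (simp add: field_simps power2_eq_square)
    then show ?case by simp
  next
    case (step b)
    have b: "real b > 0" using step assms by simp
    have "1 / real (Suc b) ^ 2 \<le> 1 / (real b * real (Suc b))"
      unfolding power2_eq_square using b by (intro divide_left_mono mult_right_mono) auto
    also have "\<dots> = 1 / real b - 1 / real (Suc b)" using b by (simp add: field_simps)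
    finally have "1 / real (Suc b) ^ 2 \<le> 1 / real b - 1 / real (Suc b)" .
    then show ?case using step by simp
  qed
  moreover have "0 \<le> 1 / real b" by simp
  ultimately show ?thesis by (cases "a \<le> b") (linarith, simp)
qed

text \<open>
  Every d is assigned to one of its divisors e. At most X / e differences are assigned to e,
  and they are packed in groups of e, which makes at most X / e^2 + 1 intervals of length at
  most 2 n.
\<close>
lemma fits_divisor_in_range:
  fixes X Z :: real and a :: nat
  assumes D: "\<And>d. d \<in> D \<Longrightarrow> 1 \<le> d \<and> real d \<le> X"
    and ex: "\<And>d. d \<in> D \<Longrightarrow> \<exists>e. e dvd d \<and> a \<le> e \<and> real e \<le> Z"
    and a: "1 \<le> a" and Z: "0 \<le> Z" "Z \<le> n" and X: "0 \<le> X"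
  shows "fits D n (2 * real n * (Z + 2 * X / a))"
proof -
  define E where "E = {a..nat \<lfloor>Z\<rfloor>}"
  have fD: "finite D" by (rule finite_subset[of _ "{..nat \<lfloor>X\<rfloor>}"]) (use D in \<open>auto intro: le_nat_floor\<close>)
  have DE: "D = (\<Union>e\<in>E. {d\<in>D. e dvd d})"
    using ex unfolding E_def by (fastforce intro: le_nat_floor)
  have "fits {d\<in>D. e dvd d} n ((X * (1 / real e ^ 2) + 1) * (2 * real n))" if e: "e \<in> E" for e
  proof -
    have e0: "e > 0" and en: "e \<le> n" using e a Z unfolding E_def by (auto simp: le_nat_iff le_floor_iff)
    define q where "q = card {d\<in>D. e dvd d} div e + 1"
    have "card {d\<in>D. e dvd d} \<le> q * e"
      unfolding q_def using e0 dividend_less_div_times[of e "card {d\<in>D. e dvd d}"] by simp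
    then have f: "fits {d\<in>D. e dvd d} n (real q * (real n + real e))"
      using fD by (intro fits_common_divisor_groups) auto
    have "{d\<in>D. e dvd d} \<subseteq> (\<lambda>k. e * k) ` {1..nat \<lfloor>X / e\<rfloor>}"
    proof
      fix d assume d: "d \<in> {d\<in>D. e dvd d}"
      then obtain k where k: "d = e * k" by auto
      have "k \<ge> 1" using d D[of d] k by (cases k) auto
      moreover have "real k \<le> X / e" using D[of d] d k e0 by (simp add: field_simps)
      then have "k \<le> nat \<lfloor>X / e\<rfloor>" by (rule le_nat_floor)
      ultimately have "k \<in> {1..nat \<lfloor>X / e\<rfloor>}" by simp
      then show "d \<in> (\<lambda>k. e * k) ` {1..nat \<lfloor>X / e\<rfloor>}" using k by blast
    qed
    then have "card {d\<in>D. e dvd d} \<le> card {1..nat \<lfloor>X / e\<rfloor>}"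
      by (meson card_image_le card_mono finite_atLeastAtMost finite_imageI order_trans)
    then have "card {d\<in>D. e dvd d} \<le> nat \<lfloor>X / e\<rfloor>" by simp
    moreover have "real (nat \<lfloor>X / e\<rfloor>) \<le> X / e" using X by (simp add: of_nat_floor)
    ultimately have "real (card {d\<in>D. e dvd d}) \<le> X / e" by linarith
    then have "real (card {d\<in>D. e dvd d}) / e \<le> X / e / e" by (intro divide_right_mono) auto
    moreover have "real (card {d\<in>D. e dvd d} div e) \<le> real (card {d\<in>D. e dvd d}) / e"
      by (rule of_nat_div_le_of_nat)
    ultimately have "real q \<le> X * (1 / real e ^ 2) + 1" unfolding q_def by (simp add: power2_eq_square)
    then have "real q * (real n + real e) \<le> (X * (1 / real e ^ 2) + 1) * (2 * real n)"
      using en X by (intro mult_mono) auto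
    then show ?thesis using f fits_mono by blast
  qed
  then have "fits (\<Union>e\<in>E. {d\<in>D. e dvd d}) n (\<Sum>e\<in>E. (X * (1 / real e ^ 2) + 1) * (2 * real n))"
    by (intro fits_UN) (auto simp: E_def)
  moreover have "(\<Sum>e\<in>E. (X * (1 / real e ^ 2) + 1) * (2 * real n))
      = (X * (\<Sum>e\<in>E. 1 / real e ^ 2) + real (card E)) * (2 * real n)"
    by (simp add: sum_distrib_left sum_distrib_right sum.distrib algebra_simps)
  moreover have "\<dots> \<le> (X * (2 / a) + Z) * (2 * real n)"
  proof -
    have "real (card E) \<le> real (nat \<lfloor>Z\<rfloor>)" unfolding E_def using a by simp
    also have "\<dots> \<le> Z" using Z by (simp add: of_nat_floor)
    finally have "real (card E) \<le> Z" .
    then show ?thesis using sum_inverse_squares_le[OF a] X unfolding E_def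
      by (intro mult_right_mono add_mono mult_left_mono) auto
  qed
  ultimately show ?thesis using DE by (auto simp: algebra_simps elim: fits_mono)
qed

text \<open>
  Take the least divisor e \<ge> a. If q is a prime factor of e then e / q < a; so either q < a
  and e < a^2, or q itself is such a divisor and e = q.
\<close>
lemma exists_divisor_in_range:
  fixes Z :: real and a d :: nat
  assumes "\<And>q. prime q \<Longrightarrow> q dvd d \<Longrightarrow> real q \<le> Z" "1 \<le> a" "real a * real a \<le> Z" "a \<le> d"
  shows "\<exists>e. e dvd d \<and> a \<le> e \<and> real e \<le> Z"
proof -
  define e where "e = (LEAST e. e dvd d \<and> a \<le> e)"
  have e: "e dvd d" "a \<le> e"
    using LeastI[of "\<lambda>e. e dvd d \<and> a \<le> e" d] assms(4) unfolding e_def by auto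
  have least: "e \<le> e'" if "e' dvd d" "a \<le> e'" for e' unfolding e_def using that by (intro Least_le) auto
  have "real e \<le> Z"
  proof (cases "e = 1")
    case True
    have "1 \<le> real a * real a" using assms(2) by (metis mult_le_mono nat_mult_1 of_nat_1 of_nat_le_iff of_nat_mult)
    then show ?thesis using True assms(3) by simp
  next
    case False
    then obtain q where q: "prime q" "q dvd e" using prime_factor_nat by blast
    then obtain e' where e': "e = q * e'" by auto
    have "e > 0" using e assms(2) by linarith
    then have "e' < e" using e' prime_gt_1_nat[OF q(1)] by (simp add: n_less_m_mult_n)
    moreover have "e' dvd d" using e e' by (metis dvd_mult_right)
    ultimately have "e' < a" using least[of e'] by (meson not_le)
    show ?thesis
    proof (cases "q < a")
      case True
      then have "e \<le> a * a" using e' \<open>e' < a\<close> by (simp add: mult_le_mono)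
      then have "real e \<le> real a * real a" by (metis of_nat_le_iff of_nat_mult)
      then show ?thesis using assms(3) by linarith
    next
      case False
      then have "e \<le> q" using least[of q] q e by (meson dvd_trans not_less)
      moreover have "real q \<le> Z" using assms(1) q e by (meson dvd_trans)
      ultimately show ?thesis by linarith
    qed
  qed
  then show ?thesis using e by blast
qed

text \<open>
  A difference d is less than a, or has all its prime factors up to Z and therefore a divisor
  between a and Z, or is s p with a prime p > Z and a cofactor s \<le> X / Z.
\<close>
lemma fits_small_prime_factors:
  fixes X Z H k :: real and a :: nat
  assumes D: "\<And>d. d \<in> D \<Longrightarrow> 1 \<le> d \<and> real d \<le> X"
    and fac: "\<And>d q. d \<in> D \<Longrightarrow> prime q \<Longrightarrow> q dvd d \<Longrightarrow> real q \<le> k"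
    and k: "k \<le> sqrt n" and a: "1 \<le> a" "real a * real a \<le> Z" and H: "1 \<le> H" "H < Z"
    and Z: "Z \<le> n" "Z \<le> X" "X < Z * Z" and m: "m > 0"
  shows "fits D n ((\<Sum>p | prime p \<and> real p \<le> k. real n - real p ^ 2)
     + (real a * n + 2 * real n * (Z + 2 * X / a)
     + sqrt n * (H * (3 * sqrt n + n / Z) + 9 * (X / Z) * H ^ (m * m) * sqrt n)
     + real n * card {p. prime p \<and> real p \<le> sqrt n} / m
     + 2 * real n * m * (sqrt n / H + 1)))"
proof -
  define T where "T = {p. prime p \<and> Z < real p \<and> real p \<le> k}"
  define S where "S = nat \<lfloor>X / Z\<rfloor>"
  have Z0: "Z > 0" using H by linarith
  have X0: "X > 0" using Z Z0 by linarith
  have fin: "finite {p. prime p \<and> real p \<le> x}" for x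
    by (rule finite_subset[of _ "{..nat \<lfloor>x\<rfloor>}"]) (auto intro: le_nat_floor)
  have finT: "finite T" unfolding T_def by (rule finite_subset[OF _ fin[of k]]) auto
  have S: "real S \<le> X / Z" unfolding S_def using X0 Z0 by (simp add: of_nat_floor)
  have S1: "1 \<le> S" unfolding S_def using Z Z0 by (simp add: le_nat_iff le_floor_iff)
  have sq: "p * p \<le> n" if "real p \<le> sqrt n" for p
  proof -
    have "real p * real p \<le> sqrt n * sqrt n" using that by (intro mult_mono) auto
    then have "real (p * p) \<le> real n" by simp
    then show ?thesis by linarith
  qed
  have nn: "0 \<le> real n - real p ^ 2" if "real p \<le> sqrt n" for p
    using sq[OF that] by (simp add: power2_eq_square flip: of_nat_mult)
  define D1 where "D1 = {d\<in>D. d < a}"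
  define D2 where "D2 = {d\<in>D. a \<le> d \<and> (\<forall>q. prime q \<longrightarrow> q dvd d \<longrightarrow> real q \<le> Z)}"
  have D3: "D \<subseteq> D1 \<union> D2 \<union> cofactor_multiples T S"
  proof
    fix d assume d: "d \<in> D"
    show "d \<in> D1 \<union> D2 \<union> cofactor_multiples T S"
    proof (cases "\<exists>p. prime p \<and> p dvd d \<and> Z < real p")
      case True
      then obtain p s where p: "prime p" "Z < real p" "d = s * p" by (auto simp: mult.commute)
      have "p \<in> T" unfolding T_def using p fac[OF d] by auto
      moreover have "1 \<le> s" using D[OF d] p by (cases s) auto
      moreover have "s \<le> S"
      proof -
        have "real s * Z \<le> real s * real p" using p by (intro mult_left_mono) auto
        also have "\<dots> \<le> X" using D[OF d] p by simp
        finally have "real s \<le> X / Z" using Z0 by (simp add: field_simps)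
        then show ?thesis unfolding S_def by (rule le_nat_floor)
      qed
      ultimately show ?thesis unfolding cofactor_multiples_def using p by blast
    next
      case False
      then show ?thesis using d unfolding D1_def D2_def by (force simp: not_less)
    qed
  qed
  have "D1 \<subseteq> {1..<a}" unfolding D1_def using D by auto
  then have "finite D1" "card D1 \<le> a" using finite_subset card_mono[of "{1..<a}" D1] by auto
  then have f1: "fits D1 n (real a * n)"
    using fits_each[of D1 n] by (auto elim!: fits_mono intro!: mult_right_mono)
  have f2: "fits D2 n (2 * real n * (Z + 2 * X / a))"
    using D a Z Z0 X0 unfolding D2_def
    by (intro fits_divisor_in_range) (auto intro!: exists_divisor_in_range)
  have f3: "fits (cofactor_multiples T S) n ((\<Sum>p\<in>T. real n - real p ^ 2
     + (H * (3 * sqrt n + n / Z) + 9 * real S * H ^ (m * m) * sqrt n)) + real n * card T / m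
     + 2 * real n * m * (sqrt n / H + 1))"
  proof (rule fits_prime_multiples)
    fix p assume p: "p \<in> T"
    have "X / Z < Z" using Z Z0 by (simp add: field_simps)
    moreover have "Z < real p" using p unfolding T_def by auto
    ultimately have "real S < real p" using S by linarith
    then show "S < p" by simp
    show "p * p \<le> n" using p k unfolding T_def by (intro sq) auto
    show "Z \<le> real p" "prime p" using p unfolding T_def by auto
  qed (use finT m S1 H in auto)
  have sub: "T \<subseteq> {p. prime p \<and> real p \<le> sqrt n}" unfolding T_def using k by auto
  have cT: "card T \<le> card {p. prime p \<and> real p \<le> sqrt n}" using sub fin by (intro card_mono)
  have cr: "real (card T) \<le> sqrt n"
  proof -
    have "T \<subseteq> {1..nat \<lfloor>sqrt n\<rfloor>}"
    proof
      fix p assume "p \<in> T"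
      then have "prime p" "real p \<le> sqrt n" using sub by auto
      then show "p \<in> {1..nat \<lfloor>sqrt n\<rfloor>}" using prime_gt_0_nat[of p] by (auto intro: le_nat_floor)
    qed
    then have "card T \<le> nat \<lfloor>sqrt n\<rfloor>" using card_mono[of "{1..nat \<lfloor>sqrt n\<rfloor>}" T] by simp
    then show ?thesis by (simp add: le_nat_iff le_floor_iff)
  qed
  have m1: "(\<Sum>p\<in>T. real n - real p ^ 2) \<le> (\<Sum>p | prime p \<and> real p \<le> k. real n - real p ^ 2)"
    using nn k by (intro sum_mono2 fin) (auto simp: T_def)
  have err: "H * (3 * sqrt n + n / Z) + 9 * real S * H ^ (m * m) * sqrt n
    \<le> H * (3 * sqrt n + n / Z) + 9 * (X / Z) * H ^ (m * m) * sqrt n"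
    using S H by (intro add_left_mono mult_right_mono mult_left_mono) auto
  have err0: "0 \<le> H * (3 * sqrt n + n / Z) + 9 * real S * H ^ (m * m) * sqrt n"
    using H Z0 by (intro add_nonneg_nonneg mult_nonneg_nonneg) auto
  have m2: "(\<Sum>p\<in>T. H * (3 * sqrt n + n / Z) + 9 * real S * H ^ (m * m) * sqrt n)
     \<le> sqrt n * (H * (3 * sqrt n + n / Z) + 9 * (X / Z) * H ^ (m * m) * sqrt n)"
    using mult_mono[OF cr err _ err0] by simp
  have m3: "real n * card T / m \<le> real n * card {p. prime p \<and> real p \<le> sqrt n} / m"
    using cT by (intro divide_right_mono mult_left_mono) auto
  have "fits (D1 \<union> D2 \<union> cofactor_multiples T S) n (real a * n + 2 * real n * (Z + 2 * X / a) +
     ((\<Sum>p\<in>T. real n - real p ^ 2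
     + (H * (3 * sqrt n + n / Z) + 9 * real S * H ^ (m * m) * sqrt n)) + real n * card T / m
     + 2 * real n * m * (sqrt n / H + 1)))"
    by (intro fits_Un f1 f2 f3)
  then show ?thesis
    by (rule fits_mono[OF _ D3]) (use m1 m2 m3 in \<open>simp add: sum.distrib\<close>)
qed

lemma sum_div_le_ln:
  assumes "n \<ge> 1"
  shows "real (\<Sum>d\<in>{1..n}. n div d) \<le> real n * (ln n + 1)"
proof -
  have "real (\<Sum>d\<in>{1..n}. n div d) \<le> (\<Sum>d\<in>{1..n}. real n * (1 / real d))"
    unfolding of_nat_sum by (intro sum_mono) (use of_nat_div_le_of_nat in auto)
  also have "\<dots> = real n * harm n" unfolding harm_def by (simp add: sum_distrib_left inverse_eq_divide)
  also have "\<dots> \<le> real n * (ln n + 1)" using euler_mascheroni_sequence_decreasing[of 1 n] assms by (intro mult_left_mono) (auto simp: harm_expand)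
  finally show ?thesis .
qed

text \<open>
  The progressions are short, with at most n / X terms each, which is what the greedy packing
  needs.
\<close>
lemma fits_large_differences:
  fixes X :: real
  assumes X: "X > 0" and n: "n \<ge> 1"
  shows "fits {d. X < real d \<and> d \<le> n} n (real n + real n / X * (real n * (ln n + 1)))"
proof -
  let ?D = "{d. X < real d \<and> d \<le> n}"
  define w where "w = nat \<lfloor>real n / X\<rfloor>"
  have w: "n div d \<le> w" if "d \<in> ?D" for d
  proof -
    have "real (n div d) \<le> real n / real d" by (rule of_nat_div_le_of_nat)
    also have "\<dots> \<le> real n / X" using that X by (intro divide_left_mono) auto
    finally show ?thesis unfolding w_def by (rule le_nat_floor)
  qed
  have fin: "finite ?D" by (rule finite_subset[of _ "{..n}"]) auto
  have f: "fits ?D n (real (n + w * (\<Sum>d\<in>?D. n div d)))" using w fin by (intro fits_greedy)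
  have "(\<Sum>d\<in>?D. n div d) \<le> (\<Sum>d\<in>{1..n}. n div d)"
    using X by (intro sum_mono2) (auto simp: Suc_le_eq intro: Nat.gr0I)
  then have "real (\<Sum>d\<in>?D. n div d) \<le> real n * (ln n + 1)"
    using sum_div_le_ln[OF n] by linarith
  moreover have "real w \<le> real n / X" unfolding w_def using X by (simp add: of_nat_floor)
  ultimately have "real w * real (\<Sum>d\<in>?D. n div d) \<le> real n / X * (real n * (ln n + 1))"
    using X by (intro mult_mono) (auto intro: sum_nonneg)
  then have "real (n + w * (\<Sum>d\<in>?D. n div d)) \<le> real n + real n / X * (real n * (ln n + 1))" by simp
  then show ?thesis using f fits_mono by blast
qed

lemma fits_large_prime_factor:
  fixes X :: real
  assumes n: "n \<ge> 1" and X: "X \<ge> 0"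
  shows "fits {d. 1 \<le> d \<and> real d \<le> X \<and> (\<exists>P. prime P \<and> P dvd d \<and> sqrt n < real P)} n
    (X / sqrt n * real n)"
proof -
  let ?D = "{d. 1 \<le> d \<and> real d \<le> X \<and> (\<exists>P. prime P \<and> P dvd d \<and> sqrt n < real P)}"
  define S where "S = nat \<lfloor>X / sqrt n\<rfloor>"
  have r0: "sqrt n > 0" using n by simp
  have sub: "?D \<subseteq> (\<Union>s\<in>{1..S}. {s * P | P. prime P \<and> sqrt n < real P})"
  proof
    fix d assume d: "d \<in> ?D"
    then obtain P s where P: "prime P" "sqrt n < real P" "d = s * P" by (auto simp: mult.commute)
    have "1 \<le> s" using d P by (cases s) auto
    moreover have "s \<le> S"
    proof -
      have "real s * sqrt n \<le> real s * real P" using P by (intro mult_left_mono) auto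
      also have "\<dots> \<le> X" using d P by simp
      finally have "real s \<le> X / sqrt n" using r0 by (simp add: field_simps)
      then show ?thesis unfolding S_def by (rule le_nat_floor)
    qed
    ultimately show "d \<in> (\<Union>s\<in>{1..S}. {s * P | P. prime P \<and> sqrt n < real P})" using P by auto
  qed
  have f: "fits (\<Union>s\<in>{1..S}. {s * P | P. prime P \<and> sqrt n < real P}) n (\<Sum>s\<in>{1..S}. real n)"
  proof (intro fits_UN)
    fix s
    have "n < P * P" if "sqrt n < real P" for P
    proof -
      have "sqrt n * sqrt n < real P * real P" using that r0 by (intro mult_strict_mono) linarith+
      then have "real n < real (P * P)" by simp
      then show ?thesis by linarith
    qed
    then show "fits {s * P | P. prime P \<and> sqrt n < real P} n (real n)"
      by (intro fits_large_prime_multiples[where s=s]) auto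
  qed auto
  have le: "(\<Sum>s\<in>{1..S}. real n) \<le> X / sqrt n * real n"
  proof -
    have "real S \<le> X / sqrt n" unfolding S_def using X by (intro of_nat_floor) auto
    then have "real S * real n \<le> X / sqrt n * real n" by (intro mult_right_mono) auto
    then show ?thesis by simp
  qed
  show ?thesis by (rule fits_mono[OF f sub le])
qed

section \<open>The lower bound from primes\<close>

text \<open>
  By the Chinese remainder theorem the two translates, extended indefinitely, meet among the
  first p q integers from the start of the second one; disjointness means that one of them has
  ended before.
\<close>
lemma overlap_bound:
  fixes p q n :: nat and \<sigma> \<tau> :: int
  assumes cop: "coprime p q" and pos: "p > 0" "q > 0"
    and disj: "\<And>i j. i \<in> {1..n div p} \<Longrightarrow> j \<in> {1..n div q} \<Longrightarrow> \<sigma> + int (i * p) \<noteq> \<tau> + int (j * q)"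
    and order: "\<sigma> + int p \<le> \<tau> + int q"
  shows "int n - int p * int q - 2 * int (max p q) \<le> (\<tau> + int q) - (\<sigma> + int p)"
proof -
  obtain y where y: "[y = \<sigma>] (mod int p)" "[y = \<tau>] (mod int q)"
    using binary_chinese_remainder_int[of "int p" "int q" \<sigma> \<tau>] cop by auto
  define x where "x = \<tau> + int q + (y - (\<tau> + int q)) mod (int p * int q)"
  have pq: "int p * int q > 0" using pos by simp
  have xr: "\<tau> + int q \<le> x" "x < \<tau> + int q + int p * int q"
    unfolding x_def using pq by auto
  have "[x = y] (mod int p * int q)"
    unfolding x_def cong_def by (simp add: mod_add_right_eq)
  then have "[x = y] (mod int p)" "[x = y] (mod int q)"
    by (auto intro: cong_dvd_modulus simp: dvd_def)
  then have cp: "int p dvd x - \<sigma>" and cq: "int q dvd x - \<tau>"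
    using y cong_trans cong_iff_dvd_diff by blast+
  have divn: "int n - int d < int (n div d) * int d" if "d > 0" for d
  proof -
    have "n < (n div d + 1) * d" using that dividend_less_div_times[of d n] by simp
    then have "int n < int ((n div d + 1) * d)" by linarith
    then show ?thesis by (simp add: algebra_simps)
  qed
  consider "x > \<sigma> + int (n div p) * int p" | "x > \<tau> + int (n div q) * int q"
    | "x \<le> \<sigma> + int (n div p) * int p" "x \<le> \<tau> + int (n div q) * int q" by linarith
  then show ?thesis
  proof cases
    case 1
    then show ?thesis using xr divn[OF pos(1)] by linarith
  next
    case 2
    then show ?thesis using xr divn[OF pos(2)] order by linarith
  next
    case 3
    have repr: "\<exists>i\<in>{1..n div d}. x = \<rho> + int (i * d)"
      if d: "d > 0" and dv: "int d dvd x - \<rho>" and lo: "\<rho> + int d \<le> x" and hi: "x \<le> \<rho> + int (n div d) * int d" for d \<rho>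
    proof -
      obtain k where k: "x - \<rho> = int d * k" using dv by auto
      have "int d * 1 \<le> int d * k" "int d * k \<le> int d * int (n div d)"
        using k lo hi by (auto simp: algebra_simps)
      then have "1 \<le> k" "k \<le> int (n div d)" using d by (simp_all only: mult_le_cancel_left_pos of_nat_0_less_iff)
      then show ?thesis using k by (intro bexI[of _ "nat k"]) (auto simp: algebra_simps nat_le_iff)
    qed
    obtain i where i: "i \<in> {1..n div p}" "x = \<sigma> + int (i * p)"
      using repr[OF pos(1) cp] order xr 3 by force
    obtain j where j: "j \<in> {1..n div q}" "x = \<tau> + int (j * q)"
      using repr[OF pos(2) cq] xr 3 by force
    show ?thesis using disj[OF i(1) j(1)] i j by metis
  qed
qed

text \<open>
  The points are added in increasing order of t. The summand a x / 2 for the current last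
  point x makes the induction work: the next step needs half of a x and half of its own a.
\<close>
lemma spread_of_separated_points:
  fixes t a :: "'a \<Rightarrow> real"
  assumes "finite T" "T \<noteq> {}" "\<And>x. x \<in> T \<Longrightarrow> a x \<ge> 0"
    and "\<And>x y. x \<in> T \<Longrightarrow> y \<in> T \<Longrightarrow> x \<noteq> y \<Longrightarrow> t x \<le> t y \<Longrightarrow> C - (a x + a y) / 2 \<le> t y - t x"
  shows "\<exists>x\<in>T. \<exists>y\<in>T. (\<forall>z\<in>T. t z \<le> t x) \<and> (real (card T) - 1) * C - sum a T + a x / 2 \<le> t x - t y"
  using assms
proof (induction T rule: finite_ranking_induct[where f=t])
  case empty
  then show ?case by simp
next
  case (insert x T)
  show ?case
  proof (cases "T = {}")
    case True
    then show ?thesis using insert.prems by auto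
  next
    case False
    obtain u v where uv: "u \<in> T" "v \<in> T" "\<forall>z\<in>T. t z \<le> t u"
      "(real (card T) - 1) * C - sum a T + a u / 2 \<le> t u - t v"
      using insert.IH False insert.prems by auto
    show ?thesis
    proof (cases "x \<in> T")
      case True
      then show ?thesis using insert.IH False insert.prems by (simp add: insert_absorb)
    next
      case xT: False
    have "C - (a u + a x) / 2 \<le> t x - t u"
      using insert.prems(3)[of u x] insert.hyps uv xT by auto
    then have "(real (card (insert x T)) - 1) * C - sum a (insert x T) + a x / 2 \<le> t x - t v"
    proof -
      have "real (card (insert x T)) - 1 = (real (card T) - 1) + 1"
        using insert.hyps xT by simp
      then have "(real (card (insert x T)) - 1) * C = (real (card T) - 1) * C + C"
        by (simp only: distrib_right mult_1)
      moreover have "sum a (insert x T) = a x + sum a T" using insert.hyps xT by simp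
      ultimately show ?thesis using uv(4) \<open>C - (a u + a x) / 2 \<le> t x - t u\<close>
        by (simp add: add_divide_distrib)
    qed
    then show ?thesis using uv insert.hyps by blast
    qed
  qed
qed

lemma packed_primes_lower_bound:
  assumes packed: "packed_into T (multiples_set n) N" and fin: "finite T"
    and pr: "\<And>p. p \<in> T \<Longrightarrow> prime p" and sq: "\<And>p. p \<in> T \<Longrightarrow> real p \<le> sqrt n"
  shows "(\<Sum>p\<in>T. real n - real p ^ 2) - 3 * real n \<le> real N"
proof (cases "T = {}")
  case False
  obtain \<sigma> where s1: "\<And>d j. d \<in> T \<Longrightarrow> j\<in>{1..n div d} \<Longrightarrow> \<sigma> d + int (j * d) \<in> {1..int N}"
    and s2: "\<And>d e i j. d \<in> T \<Longrightarrow> e \<in> T \<Longrightarrow> d \<noteq> e \<Longrightarrow> i\<in>{1..n div d} \<Longrightarrow> j\<in>{1..n div e}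
       \<Longrightarrow> \<sigma> d + int (i * d) \<noteq> \<sigma> e + int (j * e)"
    using packed unfolding packed_into_multiples_iff by blast
  define t where "t p = real_of_int (\<sigma> p + int p)" for p
  define C where "C = real n - 2 * sqrt n"
  have "C - (real p ^ 2 + real q ^ 2) / 2 \<le> t q - t p" if pq: "p \<in> T" "q \<in> T" "p \<noteq> q" "t p \<le> t q" for p q
  proof -
    have "coprime p q" using pq pr primes_coprime by blast
    then have "int n - int p * int q - 2 * int (max p q) \<le> (\<sigma> q + int q) - (\<sigma> p + int p)"
      using pq pr prime_gt_0_nat s2 by (intro overlap_bound) (auto simp: t_def)
    then have "real n - real p * real q - 2 * real (max p q) \<le> t q - t p"
      unfolding t_def by (metis (mono_tags) of_int_diff of_int_le_iff of_int_mult of_int_numeral of_int_of_nat_eq)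
    moreover have "real (max p q) \<le> sqrt n" using sq pq by (simp add: max_def)
    moreover have "real p * real q \<le> (real p ^ 2 + real q ^ 2) / 2"
      using sum_squares_bound[of "real p" "real q"] by simp
    ultimately show ?thesis unfolding C_def by linarith
  qed
  then obtain x y where xy: "x \<in> T" "y \<in> T"
    "(real (card T) - 1) * C - (\<Sum>p\<in>T. real p ^ 2) + real x ^ 2 / 2 \<le> t x - t y"
    using spread_of_separated_points[OF fin False, where a="\<lambda>p. real p ^ 2" and C=C and t=t] by auto
  have pn: "p \<le> n" if "p \<in> T" for p
  proof -
    have "real p * real p \<le> sqrt n * sqrt n" using sq[OF that] by (intro mult_mono) auto
    then have "real (p * p) \<le> real n" by simp
    then have "p * p \<le> n" by linarith
    moreover have "p * 1 \<le> p * p" using pr[OF that] prime_gt_0_nat[of p] by (intro mult_le_mono2) auto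
    ultimately show ?thesis by linarith
  qed
  have t: "1 \<le> t p" "t p \<le> real N" if "p \<in> T" for p
  proof -
    have "1 \<in> {1..n div p}"
      using pn[OF that] pr[OF that] prime_gt_0_nat[of p] by (simp add: Suc_le_eq div_greater_zero_iff)
    from s1[OF that this] have "1 \<le> \<sigma> p + int p" "\<sigma> p + int p \<le> int N" by auto
    then show "1 \<le> t p" "t p \<le> real N" unfolding t_def by linarith+
  qed
  have "(real (card T) - 1) * C - (\<Sum>p\<in>T. real p ^ 2) \<le> real N"
  proof -
    have "0 \<le> real x ^ 2 / 2" by simp
    then show ?thesis using xy(3) t[OF xy(1)] t[OF xy(2)] by linarith
  qed
  moreover have "(\<Sum>p\<in>T. real n - real p ^ 2) = real (card T) * real n - (\<Sum>p\<in>T. real p ^ 2)"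
    by (simp add: sum_subtractf)
  moreover have "2 * sqrt n * card T \<le> 2 * real n"
  proof -
    have "T \<subseteq> {1..nat \<lfloor>sqrt n\<rfloor>}"
      using sq pr prime_gt_0_nat by (auto intro!: le_nat_floor simp: Suc_le_eq)
    then have "card T \<le> nat \<lfloor>sqrt n\<rfloor>" using card_mono[of "{1..nat \<lfloor>sqrt n\<rfloor>}" T] by simp
    then have "real (card T) \<le> sqrt n" by (simp add: le_nat_iff le_floor_iff)
    then have "sqrt n * card T \<le> sqrt n * sqrt n" by (intro mult_left_mono) auto
    then show ?thesis by simp
  qed
  moreover have "(real (card T) - 1) * C = real (card T) * real n - 2 * sqrt n * card T - real n + 2 * sqrt n"
    unfolding C_def by (simp add: algebra_simps)
  moreover have "sqrt n \<ge> 0" by simp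
  ultimately show ?thesis by linarith
qed auto

lemma packing_number_packed:
  assumes "finite D"
  shows "1 \<le> packing_number D n \<and> packed_into D (multiples_set n) (packing_number D n)"
proof -
  obtain N where "packed_into D (multiples_set n) N"
    using fits_each[OF assms, of n] unfolding fits_def by blast
  then have "1 \<le> max 1 N \<and> packed_into D (multiples_set n) (max 1 N)"
    using packed_into_mono[of D _ N D "max 1 N"] by auto
  then show ?thesis unfolding packing_number_def by (rule LeastI)
qed

lemma packing_number_le:
  assumes "fits D n x" "1 \<le> x"
  shows "real (packing_number D n) \<le> x"
proof -
  obtain N where N: "real N \<le> x" "packed_into D (multiples_set n) N"
    using assms(1) unfolding fits_def by blast
  then have "1 \<le> max 1 N \<and> packed_into D (multiples_set n) (max 1 N)"
    using packed_into_mono[of D _ N D "max 1 N"] by auto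
  then have "packing_number D n \<le> max 1 N" unfolding packing_number_def by (rule Least_le)
  then show ?thesis using N assms(2) by (simp add: max_def split: if_splits)
qed

section \<open>Newman's Tauberian theorem\<close>

lemma powr_increment_bounds:
  fixes u c :: real
  assumes "u > 0" "c \<noteq> 0"
  shows "\<exists>\<xi>\<in>{u<..<u+1}. (u + 1) powr c - u powr c = c * \<xi> powr (c - 1)"
proof -
  have "\<exists>z>u. z < u + 1 \<and> (u + 1) powr c - u powr c = (u + 1 - u) * (c * z powr (c - 1))"
    using assms by (intro MVT2) (auto intro!: derivative_eq_intros)
  then show ?thesis by auto
qed

lemma tail_sum_powr:
  fixes x :: real
  assumes x: "x > 0" and N: "N \<ge> 1"
  shows "summable (\<lambda>n. real (Suc (n + N)) powr (-1 - x))"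
    and "(\<Sum>n. real (Suc (n + N)) powr (-1 - x)) \<le> real N powr (-x) / x"
proof -
  define g where "g n = real (n + N) powr (-x) / x" for n
  have le: "real (Suc (n + N)) powr (-1 - x) \<le> g n - g (Suc n)" for n
  proof -
    obtain \<xi> where \<xi>: "\<xi> \<in> {real (n+N)<..<real (n+N)+1}"
      "(real (n+N) + 1) powr (-x) - real (n+N) powr (-x) = (-x) * \<xi> powr (-x - 1)"
      using powr_increment_bounds[of "real (n+N)" "-x"] N x by auto
    have "(real (n+N) + 1) powr (-x-1) \<le> \<xi> powr (-x-1)"
      using \<xi>(1) x N by (intro powr_mono2') auto
    moreover have "g n - g (Suc n) = \<xi> powr (-x - 1)"
      using \<xi>(2) x unfolding g_def by (simp add: field_simps)
    ultimately show ?thesis by (simp add: add_ac minus_diff_commute)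
  qed
  have "g \<longlonglongrightarrow> 0" unfolding g_def using x by real_asymp
  from telescope_sums'[OF this] have s: "(\<lambda>n. g n - g (Suc n)) sums g 0" by simp
  show "summable (\<lambda>n. real (Suc (n + N)) powr (-1 - x))"
    by (rule summable_comparison_test[OF _ sums_summable[OF s]]) (use le in auto)
  then have "(\<Sum>n. real (Suc (n + N)) powr (-1 - x)) \<le> (\<Sum>n. g n - g (Suc n))"
    using le s by (intro suminf_le) (auto simp: sums_iff)
  also have "\<dots> = g 0" using s by (simp add: sums_iff)
  finally show "(\<Sum>n. real (Suc (n + N)) powr (-1 - x)) \<le> real N powr (-x) / x" by (simp add: g_def)
qed

text \<open>
  Each term is compared with the integral of u^(y-1) over the preceding or the following unit
  interval, according as this function decreases (y \<le> 1) or increases; in the second case the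
  summand 1 / N pays for the last term.
\<close>
lemma head_sum_powr:
  fixes y :: real
  assumes y: "y > 0" and N: "N \<ge> 1"
  shows "(\<Sum>n<N. real (Suc n) powr (-1 + y)) \<le> real N powr y * (1 / N + 1 / y)"
proof (cases "y \<le> 1")
  case True
  have "real (Suc n) powr (-1 + y) \<le> real (Suc n) powr y / y - real n powr y / y" for n
  proof (cases "n = 0")
    case False
    obtain \<xi> where \<xi>: "\<xi> \<in> {real n<..<real n+1}"
      "(real n + 1) powr y - real n powr y = y * \<xi> powr (y - 1)"
      using powr_increment_bounds[of "real n" y] False y by auto
    have "(real n + 1) powr (y-1) \<le> \<xi> powr (y-1)"
      using \<xi>(1) True by (intro powr_mono2') auto
    moreover have "real (Suc n) powr y / y - real n powr y / y = \<xi> powr (y - 1)"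
      using \<xi>(2) y by (simp add: field_simps)
    ultimately show ?thesis by (simp add: add_ac)
  qed (use y True in auto)
  then have "(\<Sum>n<N. real (Suc n) powr (-1 + y)) \<le> (\<Sum>n<N. real (Suc n) powr y / y - real n powr y / y)"
    by (rule sum_mono)
  also have "\<dots> = real N powr y / y" using y by (subst sum_lessThan_telescope) auto
  also have "\<dots> \<le> real N powr y * (1 / N + 1 / y)" by (simp add: algebra_simps)
  finally show ?thesis .
next
  case False
  obtain K where K: "N = Suc K" using N by (cases N) auto
  have "real (Suc n) powr (-1 + y) \<le> real (Suc (Suc n)) powr y / y - real (Suc n) powr y / y" for n
  proof -
    obtain \<xi> where \<xi>: "\<xi> \<in> {real (Suc n)<..<real (Suc n)+1}"
      "(real (Suc n) + 1) powr y - real (Suc n) powr y = y * \<xi> powr (y - 1)"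
      using powr_increment_bounds[of "real (Suc n)" y] y by auto
    have "real (Suc n) powr (y-1) \<le> \<xi> powr (y-1)"
      using \<xi>(1) False by (intro powr_mono2) auto
    moreover have "real (Suc (Suc n)) powr y / y - real (Suc n) powr y / y = \<xi> powr (y - 1)"
      using \<xi>(2) y by (simp add: field_simps)
    ultimately show ?thesis by (simp add: add_ac)
  qed
  then have "(\<Sum>n<K. real (Suc n) powr (-1 + y)) \<le> (\<Sum>n<K. real (Suc (Suc n)) powr y / y - real (Suc n) powr y / y)"
    by (rule sum_mono)
  also have "\<dots> = real N powr y / y - 1 / y"
    unfolding K by (subst sum_lessThan_telescope[where f="\<lambda>n. real (Suc n) powr y / y"]) auto
  also have "\<dots> \<le> real N powr y / y" using y by simp
  finally have "(\<Sum>n<N. real (Suc n) powr (-1 + y)) \<le> real N powr y / y + real N powr (-1 + y)"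
    unfolding K by simp
  also have "real N powr (-1 + y) = real N powr y / N"
    using N by (simp add: powr_diff)
  finally show ?thesis by (simp add: algebra_simps)
qed

text \<open>
  On the circle Newman's kernel is real and vanishes at the imaginary axis, where the bounds
  for the tails and the partial sums blow up.
\<close>
lemma kernel_on_circle:
  assumes "norm z = R" "R > 0"
  shows "1 / z * (1 + z\<^sup>2 / of_real (R\<^sup>2)) = of_real (2 * Re z / R\<^sup>2)"
proof -
  have z0: "z \<noteq> 0" using assms by auto
  have "of_real (R\<^sup>2) = z * cnj z" using assms complex_norm_square[of z] by simp
  moreover have "z * cnj z \<noteq> 0" using z0 by simp
  moreover have "z + cnj z = of_real (2 * Re z)" by (rule complex_add_cnj)
  ultimately show ?thesis using z0 by (simp add: field_simps power2_eq_square)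
qed

lemma part_circlepath_imageE:
  assumes "z \<in> path_image (part_circlepath 0 R s t)" "s \<le> t"
  obtains u where "u \<in> {s..t}" "z = of_real R * cis u"
  using assms unfolding path_image_part_circlepath' by (auto simp: closed_segment_eq_real_ivl)

text \<open>
  Multiply by n^z and Newman's kernel and integrate over a circle of radius R. On the right half
  the tail f - S N, and on the left half the partial sum S N, contributes O(C / R). What is left
  is the integral of f over the right half, which by Cauchy's theorem on the half disc is
  an integral over the segment on the imaginary axis; as f 0 = 0, the integrand has no pole there,
  and the integral tends to 0 by partial integration.
\<close>
lemma newman_vanishing:
  fixes a :: "nat \<Rightarrow> complex" and f :: "complex \<Rightarrow> complex"
  assumes bound: "\<And>n. norm (a n) \<le> C"
    and hol: "f holomorphic_on U" and U: "open U" "{z. 0 \<le> Re z} \<subseteq> U"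
    and sums: "\<And>z. Re z > 0 \<Longrightarrow> (\<lambda>n. a n * of_nat (Suc n) powr (-1 - z)) sums f z"
    and f0: "f 0 = 0"
  shows "(\<lambda>N. \<Sum>n<N. a n / of_nat (Suc n)) \<longlonglongrightarrow> 0"
proof -
  define S where "S N z = (\<Sum>n<N. a n * of_nat (Suc n) powr (-1 - z))" for N and z :: complex
  define E where "E N z = exp (z * of_real (ln (real N)))" for N :: nat and z :: complex
  define \<phi> where "\<phi> z = (if z = 0 then deriv f 0 else f z / z)" for z
  have C0: "C \<ge> 0" using bound[of 0] norm_ge_zero order_trans by blast
  have h\<phi>: "\<phi> holomorphic_on U"
  proof -
    have "\<phi> = (\<lambda>z. if z = 0 then deriv f 0 else (f z - f 0) / (z - 0))"
      unfolding \<phi>_def f0 by auto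
    then show ?thesis using pole_lemma_open[OF hol U(1), of 0] by simp
  qed
  have normE: "norm (E N z) = real N powr Re z" if "N \<ge> 1" for N z
    unfolding E_def using that by (simp add: norm_exp_eq_Re powr_def)
  have hS: "S N holomorphic_on X" for N X unfolding S_def by (intro holomorphic_intros)
  have hE: "E N holomorphic_on X" for N X unfolding E_def by (intro holomorphic_intros)
  have npow: "norm (of_nat (Suc n) powr (-1 - z :: complex)) = real (Suc n) powr (-1 - Re z)" for n z
    by (subst norm_powr_real_powr) auto
  have S0: "S N 0 = (\<Sum>n<N. a n / of_nat (Suc n))" for N
    unfolding S_def by (intro sum.cong refl) (simp add: powr_minus divide_inverse)
  have tail: "norm (f z - S N z) \<le> C * (real N powr (- Re z) / Re z)" if z: "Re z > 0" and N: "N \<ge> 1" for z N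
  proof -
    have "(\<lambda>n. a (n + N) * of_nat (Suc (n + N)) powr (-1 - z)) sums (f z - S N z)"
      unfolding S_def using sums_split_initial_segment[OF sums[OF z], of N] by simp
    moreover have b: "norm (a (n + N) * of_nat (Suc (n + N)) powr (-1 - z)) \<le> C * real (Suc (n + N)) powr (-1 - Re z)" for n
      unfolding norm_mult npow using bound by (intro mult_right_mono) auto
    have sm: "summable (\<lambda>n. C * real (Suc (n + N)) powr (-1 - Re z))"
      using tail_sum_powr(1)[OF z N] by (rule summable_mult)
    ultimately have "norm (f z - S N z) \<le> (\<Sum>n. C * real (Suc (n + N)) powr (-1 - Re z))"
      using norm_suminf_le[OF b sm] by (simp add: sums_iff)
    also have "\<dots> = C * (\<Sum>n. real (Suc (n + N)) powr (-1 - Re z))"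
      using tail_sum_powr(1)[OF z N] by (rule suminf_mult)
    also have "\<dots> \<le> C * (real N powr (- Re z) / Re z)"
      using tail_sum_powr(2)[OF z N] C0 by (intro mult_left_mono)
    finally show ?thesis .
  qed
  have head: "norm (S N z) \<le> C * (real N powr (- Re z) * (1 / N + 1 / (- Re z)))" if z: "Re z < 0" and N: "N \<ge> 1" for z N
  proof -
    have "norm (S N z) \<le> (\<Sum>n<N. C * real (Suc n) powr (-1 + (- Re z)))"
      unfolding S_def
    proof (rule sum_norm_le)
      fix n
      show "norm (a n * of_nat (Suc n) powr (-1 - z)) \<le> C * real (Suc n) powr (-1 + (- Re z))"
        unfolding norm_mult npow using bound by (simp add: mult_right_mono)
    qed
    also have "\<dots> = C * (\<Sum>n<N. real (Suc n) powr (-1 + (- Re z)))" by (simp add: sum_distrib_left)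
    also have "\<dots> \<le> C * (real N powr (- Re z) * (1 / N + 1 / (- Re z)))"
      using head_sum_powr[of "- Re z" N] z N C0 by (intro mult_left_mono) auto
    finally show ?thesis .
  qed
  have main: "\<exists>B\<ge>0. \<forall>N\<ge>2. norm (S N 0) \<le> 2 * C / R + C / N + B / ln N" if R: "R > 0" for R :: real
  proof -
    let ?I = "closed_segment (\<i> * of_real R) (- \<i> * of_real R)"
    define Q where "Q z = 1 + z\<^sup>2 / of_real (R\<^sup>2)" for z :: complex
    define c1 where "c1 = part_circlepath 0 R (3 * pi / 2) (2 * pi)"
    define c2 where "c2 = part_circlepath 0 R 0 (pi / 2)"
    define c3 where "c3 = part_circlepath 0 R (pi / 2) (3 * pi / 2)"
    define l where "l = linepath (\<i> * of_real R) (- \<i> * of_real R)"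
    have hQ: "Q holomorphic_on X" for X unfolding Q_def using R by (intro holomorphic_intros) auto
    have path1: "Re z \<ge> 0" "norm z = R" if z: "z \<in> path_image c1" for z
    proof -
      obtain t where t: "t \<in> {3*pi/2..2*pi}" "z = of_real R * cis t"
        using z pi_gt_zero unfolding c1_def by (auto elim!: part_circlepath_imageE)
      have "cos (2 * pi - t) \<ge> 0" using t by (intro cos_ge_zero) auto
      then have "cos t \<ge> 0" by (simp add: cos_diff)
      then show "Re z \<ge> 0" "norm z = R" using t R by (auto simp: norm_mult)
    qed
    have path2: "Re z \<ge> 0" "norm z = R" if z: "z \<in> path_image c2" for z
    proof -
      obtain t where t: "t \<in> {0..pi/2}" "z = of_real R * cis t"
        using z pi_gt_zero unfolding c2_def by (auto elim!: part_circlepath_imageE)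
      have "cos t \<ge> 0" using t by (intro cos_ge_zero) auto
      then show "Re z \<ge> 0" "norm z = R" using t R by (auto simp: norm_mult)
    qed
    have path3: "Re z \<le> 0" "norm z = R" if z: "z \<in> path_image c3" for z
    proof -
      obtain t where t: "t \<in> {pi/2..3*pi/2}" "z = of_real R * cis t"
        using z pi_gt_zero unfolding c3_def by (auto elim!: part_circlepath_imageE)
      have "cos (t - pi) \<ge> 0" using t by (intro cos_ge_zero) auto
      then have "cos t \<le> 0" by (simp add: cos_diff)
      then show "Re z \<le> 0" "norm z = R" using t R by (auto simp: norm_mult mult_nonneg_nonpos)
    qed
    \<comment> \<open>The two points where the arcs meet the imaginary axis are excluded in the estimates.\<close>
    define k where "k = {\<i> * of_real R, - \<i> * of_real R :: complex}"
    have excl: "z \<in> k" if "Re z = 0" "norm z = R" for z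
    proof -
      have "\<bar>Im z\<bar> = R" using that by (simp add: cmod_def)
      then have "Im z = R \<or> Im z = - R" by linarith
      then show ?thesis using that unfolding k_def by (auto simp: complex_eq_iff)
    qed
    define D where "D = cball 0 R \<inter> {z. Re z \<ge> 0}"
    have DU: "D \<subseteq> U" unfolding D_def using U by auto
    have cD: "convex D" unfolding D_def by (intro convex_Int convex_cball convex_halfspace_Re_ge)
    have lpi: "z \<in> D \<and> Re z = 0" if z: "z \<in> ?I" for z
    proof -
      obtain u where u: "0 \<le> u" "u \<le> 1" "z = (1 - u) *\<^sub>R (\<i> * of_real R) + u *\<^sub>R (- \<i> * of_real R)"
        using z unfolding closed_segment_def by auto
      have "z = \<i> * of_real (R * (1 - 2 * u))" using u by (simp add: scaleR_conv_of_real algebra_simps)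
      moreover have "\<bar>R * (1 - 2 * u)\<bar> \<le> R * 1"
        unfolding abs_mult using R u by (intro mult_mono) auto
      ultimately have "norm z \<le> R" "Re z = 0" by (simp_all only: norm_mult norm_of_real) simp_all
      then show ?thesis unfolding D_def by simp
    qed
    define G where "G N z = \<phi> z * E N z * Q z" for N z
    define T where "T N z = S N z * E N z * Q z" for N z
    have hG: "G N holomorphic_on D" for N
      unfolding G_def using h\<phi> DU by (intro holomorphic_intros hE hQ) (auto intro: holomorphic_on_subset)
    have hT: "T N holomorphic_on X" for N X unfolding T_def by (intro holomorphic_intros hE hQ hS)
    have hTz: "(\<lambda>z. T N z / z) holomorphic_on - {0}" for N
      by (intro holomorphic_intros hT) auto
    have im: "path_image c1 \<subseteq> D" "path_image c2 \<subseteq> D" "path_image l \<subseteq> D"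
      "path_image c1 \<subseteq> - {0}" "path_image c2 \<subseteq> - {0}" "path_image c3 \<subseteq> - {0}"
      using path1 path2 path3 lpi R unfolding D_def l_def by force+
    have vp: "valid_path c1" "valid_path c2" "valid_path c3" "valid_path l"
      unfolding c1_def c2_def c3_def l_def by auto
    have cont: "G N contour_integrable_on c1" "G N contour_integrable_on c2" "G N contour_integrable_on l"
      "(\<lambda>z. T N z / z) contour_integrable_on c1" "(\<lambda>z. T N z / z) contour_integrable_on c2"
      "(\<lambda>z. T N z / z) contour_integrable_on c3" for N
      unfolding c1_def c2_def c3_def l_def
      by (intro contour_integrable_continuous_part_circlepath contour_integrable_continuous_linepath
          holomorphic_on_imp_continuous_on holomorphic_on_subset[OF hG[of N]] holomorphic_on_subset[OF hTz[of N]]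
          im[unfolded c1_def c2_def c3_def l_def path_image_linepath])+
    have pp: "pathfinish c1 = pathstart c2" "pathfinish c2 = pathstart l" "pathfinish l = pathstart c1"
    proof -
      have e: "exp (\<i> * of_real t) = cis t" for t by (simp add: cis_conv_exp)
      have "cis (3 * pi / 2) = cis (pi + pi / 2)" by (rule arg_cong[where f=cis]) simp
      also have "\<dots> = - \<i>" unfolding cis_mult[symmetric] by simp
      finally have c: "cis (3 * pi / 2) = - \<i>" .
      show "pathfinish c1 = pathstart c2" "pathfinish c2 = pathstart l" "pathfinish l = pathstart c1"
        unfolding c1_def c2_def l_def pathstart_part_circlepath pathfinish_part_circlepath
          pathstart_linepath pathfinish_linepath e c cis_2pi by (simp_all add: mult.commute)
    qed
    have closed: "contour_integral c1 (G N) + contour_integral c2 (G N) + contour_integral l (G N) = 0" for N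
    proof -
      have "(G N has_contour_integral 0) (c1 +++ c2 +++ l)"
      proof (rule Cauchy_theorem_convex_simple[OF hG cD])
        show "valid_path (c1 +++ c2 +++ l)" using vp pp by (auto intro!: valid_path_join)
        show "path_image (c1 +++ c2 +++ l) \<subseteq> D" using im pp by (simp add: path_image_join)
        show "pathfinish (c1 +++ c2 +++ l) = pathstart (c1 +++ c2 +++ l)" using pp by simp
      qed
      then have "contour_integral (c1 +++ c2 +++ l) (G N) = 0" by (rule contour_integral_unique)
      moreover have "contour_integral (c1 +++ c2 +++ l) (G N)
          = contour_integral c1 (G N) + contour_integral (c2 +++ l) (G N)"
        using cont[of N] vp pp by (intro contour_integral_join) (auto intro!: valid_path_join)
      moreover have "contour_integral (c2 +++ l) (G N) = contour_integral c2 (G N) + contour_integral l (G N)"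
        using cont[of N] vp by (intro contour_integral_join) auto
      ultimately show ?thesis by (simp add: add.assoc)
    qed
    have circle: "contour_integral c1 (\<lambda>z. T N z / z) + contour_integral c2 (\<lambda>z. T N z / z)
       + contour_integral c3 (\<lambda>z. T N z / z) = 2 * pi * \<i> * S N 0" for N
    proof -
      define g where "g = (\<lambda>t. T N (0 + of_real R * cis t) / (0 + of_real R * cis t) * of_real R * \<i> * cis t)"
      have "((\<lambda>u. T N u / (u - 0)) has_contour_integral (2 * of_real pi * \<i> * T N 0)) (circlepath 0 R)"
        using R by (intro Cauchy_integral_circlepath_simple hT) auto
      then have "((\<lambda>u. T N u / u) has_contour_integral (2 * of_real pi * \<i> * T N 0)) (part_circlepath 0 R 0 (2 * pi))"
        unfolding circlepath_def by simp
      then have I: "(g has_integral (2 * of_real pi * \<i> * T N 0)) {0..2*pi}"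
        unfolding g_def by (rule has_contour_integral_part_circlepath_iff[THEN iffD1, rotated]) simp
      have int: "g integrable_on {u..v}" if "0 \<le> u" "v \<le> 2*pi" for u v
        using I that by (intro integrable_on_subinterval[of g "{0..2*pi}" u v]) (auto simp: integrable_on_def)
      have "integral {0..2*pi} g = integral {0..pi/2} g + integral {pi/2..2*pi} g"
        by (intro Henstock_Kurzweil_Integration.integral_combine[symmetric] int) auto
      also have "integral {pi/2..2*pi} g = integral {pi/2..3*pi/2} g + integral {3*pi/2..2*pi} g"
        by (intro Henstock_Kurzweil_Integration.integral_combine[symmetric] int) auto
      finally have tot: "2 * of_real pi * \<i> * T N 0 = integral {0..pi/2} g + (integral {pi/2..3*pi/2} g + integral {3*pi/2..2*pi} g)"
        using I by (simp add: integral_unique)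
      have TS: "T N 0 = S N 0" unfolding T_def E_def Q_def by simp
      show ?thesis
      proof -
        have "contour_integral c1 (\<lambda>z. T N z / z) = integral {3*pi/2..2*pi} g"
          "contour_integral c2 (\<lambda>z. T N z / z) = integral {0..pi/2} g"
          "contour_integral c3 (\<lambda>z. T N z / z) = integral {pi/2..3*pi/2} g"
          unfolding c1_def c2_def c3_def g_def by (rule contour_integral_part_circlepath_eq; simp)+
        then show ?thesis using tot TS by simp
      qed
    qed
    have right: "norm (contour_integral c (\<lambda>z. T N z / z) - contour_integral c (G N)) \<le> pi * C / R"
      if N: "N \<ge> 1" and c: "c = part_circlepath 0 R s (s + pi / 2)" and pc: "\<And>z. z \<in> path_image c \<Longrightarrow> Re z \<ge> 0 \<and> norm z = R"
        and ci: "G N contour_integrable_on c" "(\<lambda>z. T N z / z) contour_integrable_on c" for N c s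
    proof -
      have "((\<lambda>z. T N z / z - G N z) has_contour_integral
          (contour_integral c (\<lambda>z. T N z / z) - contour_integral c (G N))) c"
        using ci by (intro has_contour_integral_diff has_contour_integral_integral)
      then have "norm (contour_integral c (\<lambda>z. T N z / z) - contour_integral c (G N)) \<le> 2 * C / R\<^sup>2 * R * (s + pi / 2 - s)"
        unfolding c
      proof (rule has_contour_integral_bound_part_circlepath_strong[where k=k])
        fix z assume z: "z \<in> path_image (part_circlepath 0 R s (s + pi / 2)) - k"
        then have nz: "norm z = R" and "Re z \<ge> 0" "z \<notin> k" using pc[of z] unfolding c by auto
        then have Rz: "Re z > 0" using excl[of z] by fastforce
        have z0: "z \<noteq> 0" using Rz by auto
        have "T N z / z - G N z = - (f z - S N z) * E N z * (1 / z * Q z)"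
          unfolding T_def G_def \<phi>_def using z0 by (simp add: field_simps)
        also have "1 / z * Q z = of_real (2 * Re z / R\<^sup>2)" unfolding Q_def by (rule kernel_on_circle[OF nz R])
        finally have eq: "T N z / z - G N z = - (f z - S N z) * E N z * of_real (2 * Re z / R\<^sup>2)" .
        have "norm (T N z / z - G N z) = norm (f z - S N z) * real N powr Re z * (2 * Re z / R\<^sup>2)"
          unfolding eq norm_mult norm_minus_cancel norm_of_real normE[OF N] using Rz by simp
        also have "\<dots> \<le> (C * (real N powr (- Re z) / Re z)) * real N powr Re z * (2 * Re z / R\<^sup>2)"
          using tail[OF Rz N] Rz by (intro mult_right_mono) auto
        also have "\<dots> = 2 * C / R\<^sup>2"
          using Rz N by (simp add: powr_minus field_simps)
        finally show "norm (T N z / z - G N z) \<le> 2 * C / R\<^sup>2" .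
      qed (use R C0 k_def in auto)
      also have "\<dots> = pi * C / R" using R by (simp add: power2_eq_square field_simps)
      finally show ?thesis .
    qed
    have left: "norm (contour_integral c3 (\<lambda>z. T N z / z)) \<le> 2 * pi * C / R + 2 * pi * C / N" if N: "N \<ge> 1" for N
    proof -
      have "((\<lambda>z. T N z / z) has_contour_integral contour_integral c3 (\<lambda>z. T N z / z)) c3"
        using cont by (intro has_contour_integral_integral)
      then have "norm (contour_integral c3 (\<lambda>z. T N z / z)) \<le> (2 * C / R\<^sup>2 + 2 * C / (R * N)) * R * (3 * pi / 2 - pi / 2)"
        unfolding c3_def
      proof (rule has_contour_integral_bound_part_circlepath_strong[where k=k])
        fix z assume z: "z \<in> path_image (part_circlepath 0 R (pi / 2) (3 * pi / 2)) - k"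
        then have nz: "norm z = R" and "Re z \<le> 0" "z \<notin> k" using path3[of z] unfolding c3_def by auto
        then have Rz: "Re z < 0" using excl[of z] by fastforce
        have z0: "z \<noteq> 0" using Rz by auto
        define y where "y = - Re z"
        have y: "0 < y" "y \<le> R" using Rz nz abs_Re_le_cmod[of z] unfolding y_def by auto
        have "T N z / z = S N z * E N z * (1 / z * Q z)"
          unfolding T_def using z0 by (simp add: field_simps)
        also have "1 / z * Q z = of_real (2 * Re z / R\<^sup>2)" unfolding Q_def by (rule kernel_on_circle[OF nz R])
        finally have eq: "T N z / z = S N z * E N z * of_real (2 * Re z / R\<^sup>2)" .
        have "norm (T N z / z) = norm (S N z) * real N powr (- y) * (2 * y / R\<^sup>2)"
          unfolding eq norm_mult norm_of_real normE[OF N] using Rz by (simp add: y_def)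
        also have "\<dots> \<le> (C * (real N powr y * (1 / N + 1 / y))) * real N powr (- y) * (2 * y / R\<^sup>2)"
        proof (intro mult_right_mono)
          show "norm (S N z) \<le> C * (real N powr y * (1 / N + 1 / y))"
            using head[OF Rz N] by (simp add: y_def)
        qed (use y in auto)
        also have "\<dots> = 2 * C / R\<^sup>2 + 2 * C / (R * N) * (y / R)"
          using y N R by (simp add: powr_minus field_simps power2_eq_square)
        also have "\<dots> \<le> 2 * C / R\<^sup>2 + 2 * C / (R * N) * 1"
          using y N R C0 by (intro add_left_mono mult_left_mono) auto
        finally show "norm (T N z / z) \<le> 2 * C / R\<^sup>2 + 2 * C / (R * N)" by simp
      qed (use R C0 k_def in auto)
      also have "\<dots> = 2 * pi * C / R + 2 * pi * C / N"
        using R N by (simp add: power2_eq_square field_simps)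
      finally show ?thesis .
    qed
    \<comment> \<open>Riemann--Lebesgue on the segment: integrate by parts, the factor E N having derivative ln N * E N.\<close>
    define \<psi> where "\<psi> z = \<phi> z * Q z" for z
    have h\<psi>: "\<psi> holomorphic_on U" unfolding \<psi>_def by (intro holomorphic_intros h\<phi> hQ)
    have "\<exists>B0\<ge>0. \<forall>z\<in>?I. norm (\<psi> z) \<le> B0 \<and> norm (deriv \<psi> z) \<le> B0"
    proof -
      have sub: "?I \<subseteq> U" using lpi DU by auto
      have "compact (\<psi> ` ?I)"
        using h\<psi> sub by (intro compact_continuous_image holomorphic_on_imp_continuous_on)
          (auto intro: holomorphic_on_subset)
      then obtain b1 where b1: "\<forall>x\<in>\<psi> ` ?I. norm x \<le> b1"
        using compact_imp_bounded bounded_iff by blast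
      have "deriv \<psi> holomorphic_on U" using h\<psi> U(1) by (rule holomorphic_deriv)
      then have "compact (deriv \<psi> ` ?I)"
        using sub by (intro compact_continuous_image holomorphic_on_imp_continuous_on)
          (auto intro: holomorphic_on_subset)
      then obtain b2 where b2: "\<forall>x\<in>deriv \<psi> ` ?I. norm x \<le> b2"
        using compact_imp_bounded bounded_iff by blast
      show ?thesis using b1 b2 by (intro exI[of _ "max 0 (max b1 b2)"]) (auto simp: le_max_iff_disj)
    qed
    then obtain B0 where B0: "B0 \<ge> 0" "\<And>z. z \<in> ?I \<Longrightarrow> norm (\<psi> z) \<le> B0"
      "\<And>z. z \<in> ?I \<Longrightarrow> norm (deriv \<psi> z) \<le> B0" by blast
    have seg: "norm (contour_integral l (G N)) \<le> (2 * B0 + B0 * (2 * R)) / ln N" if N: "N \<ge> 2" for N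
    proof -
      let ?J = "\<psi> (- \<i> * of_real R) * E N (- \<i> * of_real R) - \<psi> (\<i> * of_real R) * E N (\<i> * of_real R)"
      have lnN: "ln (real N) > 0" using N by simp
      have "((\<lambda>z. deriv \<psi> z * E N z + ln (real N) * G N z) has_contour_integral
         (\<psi> (pathfinish l) * E N (pathfinish l) - \<psi> (pathstart l) * E N (pathstart l))) l"
      proof (rule contour_integral_primitive[where S=U])
        fix z assume z: "z \<in> U"
        have d1: "(\<psi> has_field_derivative deriv \<psi> z) (at z)"
          using h\<psi> U(1) z by (rule holomorphic_derivI)
        have d2: "((\<lambda>z. E N z) has_field_derivative of_real (ln (real N)) * E N z) (at z)"
          unfolding E_def by (auto intro!: derivative_eq_intros)
        have "((\<lambda>z. \<psi> z * E N z) has_field_derivative deriv \<psi> z * E N z + ln (real N) * G N z) (at z)"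
          using DERIV_mult[OF d1 d2] unfolding G_def \<psi>_def by (simp add: mult_ac)
        then show "((\<lambda>z. \<psi> z * E N z) has_field_derivative deriv \<psi> z * E N z + ln (real N) * G N z) (at z within U)"
          by (rule has_field_derivative_at_within)
      qed (use vp im DU in auto)
      then have I: "((\<lambda>z. deriv \<psi> z * E N z + ln (real N) * G N z) has_contour_integral
         ?J) l"
        by (simp add: l_def)
      have "((\<lambda>z. ln (real N) * G N z) has_contour_integral (ln (real N) * contour_integral l (G N))) l"
        using cont by (intro has_contour_integral_lmul has_contour_integral_integral)
      from has_contour_integral_diff[OF I this]
      have "((\<lambda>z. deriv \<psi> z * E N z) has_contour_integral
         (?J
          - ln (real N) * contour_integral l (G N))) (linepath (\<i> * of_real R) (- \<i> * of_real R))"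
        by (simp add: l_def)
      then have "norm (?J
          - ln (real N) * contour_integral l (G N)) \<le> B0 * norm (- \<i> * of_real R - \<i> * of_real R)"
      proof (rule has_contour_integral_bound_linepath)
        fix z assume z: "z \<in> ?I"
        show "norm (deriv \<psi> z * E N z) \<le> B0"
          using B0(3)[OF z] normE[of N z] lpi[OF z] N by (simp add: norm_mult)
      qed (use B0 in auto)
      also have "norm (- \<i> * of_real R - \<i> * of_real R) = 2 * R"
      proof -
        have "- \<i> * of_real R - \<i> * of_real R = - \<i> * of_real (2 * R)" by simp
        then show ?thesis using R by (simp only: norm_mult norm_of_real) simp
      qed
      finally have 1: "norm (?J
          - ln (real N) * contour_integral l (G N)) \<le> B0 * (2 * R)" .
      have 2: "norm ?J \<le> 2 * B0"
      proof -
        have "norm (\<psi> w * E N w) \<le> B0" if "w \<in> {\<i> * of_real R, - \<i> * of_real R}" for w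
        proof -
          have "w \<in> ?I" using that by auto
          then show ?thesis using B0(2)[of w] normE[of N w] lpi[of w] N by (simp add: norm_mult)
        qed
        from this[of "\<i> * of_real R"] this[of "- \<i> * of_real R"] show ?thesis
          using norm_triangle_ineq4[of "\<psi> (- \<i> * of_real R) * E N (- \<i> * of_real R)" "\<psi> (\<i> * of_real R) * E N (\<i> * of_real R)"]
          by auto
      qed
      have "norm (ln (real N) * contour_integral l (G N)) \<le> 2 * B0 + B0 * (2 * R)"
        using 1 2 norm_triangle_ineq4[of "?J"
          "?J
          - ln (real N) * contour_integral l (G N)"] by simp
      then show ?thesis using lnN by (simp add: norm_mult field_simps)
    qed
    define B where "B = (2 * B0 + B0 * (2 * R)) / (2 * pi)"
    have "B \<ge> 0" unfolding B_def using B0 R by simp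
    moreover have "norm (S N 0) \<le> 2 * C / R + C / N + B / ln N" if N: "N \<ge> 2" for N
    proof -
      have N1: "N \<ge> 1" using N by simp
      have r1: "norm (contour_integral c1 (\<lambda>z. T N z / z) - contour_integral c1 (G N)) \<le> pi * C / R"
        using path1 cont by (intro right[OF N1, where s="3*pi/2"]) (auto simp: c1_def)
      have r2: "norm (contour_integral c2 (\<lambda>z. T N z / z) - contour_integral c2 (G N)) \<le> pi * C / R"
        using path2 cont by (intro right[OF N1, where s=0]) (auto simp: c2_def)
      have eq: "2 * pi * \<i> * S N 0 = (contour_integral c1 (\<lambda>z. T N z / z) - contour_integral c1 (G N))
          + (contour_integral c2 (\<lambda>z. T N z / z) - contour_integral c2 (G N))
          + contour_integral c3 (\<lambda>z. T N z / z) - contour_integral l (G N)"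
        using closed[of N] circle[of N] by (simp add: algebra_simps add_eq_0_iff2)
      have "norm (2 * pi * \<i> * S N 0) \<le> pi * C / R + pi * C / R + (2 * pi * C / R + 2 * pi * C / N) + (2 * B0 + B0 * (2 * R)) / ln N"
        unfolding eq
        by (intro norm_triangle_le_diff norm_triangle_le add_mono order_trans[OF norm_triangle_ineq4]
            order_trans[OF norm_triangle_ineq] r1 r2 left[OF N1] seg[OF N])
      also have "2 * B0 + B0 * (2 * R) = 2 * pi * B" unfolding B_def by simp
      also have "pi * C / R + pi * C / R + (2 * pi * C / R + 2 * pi * C / N) + 2 * pi * B / ln N
          = 2 * pi * (2 * C / R + C / N + B / ln N)" by (simp add: algebra_simps)
      also have "norm (2 * pi * \<i> * S N 0) = 2 * pi * norm (S N 0)" by (simp add: norm_mult)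
      finally have "2 * pi * norm (S N 0) \<le> 2 * pi * (2 * C / R + C / N + B / ln N)" .
      then show ?thesis by (simp only: mult_le_cancel_left_pos pi_gt_zero zero_less_mult_iff zero_less_numeral simp_thms)
    qed
    ultimately show ?thesis by blast
  qed
  show ?thesis
  proof (rule LIMSEQ_I)
    fix \<epsilon> :: real assume \<epsilon>: "\<epsilon> > 0"
    define R where "R = (4 * C + 1) / \<epsilon>"
    have R: "R > 0" unfolding R_def using C0 \<epsilon> by simp
    obtain B where B: "\<And>N. N \<ge> 2 \<Longrightarrow> norm (S N 0) \<le> 2 * C / R + C / N + B / ln N" using main[OF R] by blast
    have "2 * C / R < \<epsilon>" unfolding R_def using C0 \<epsilon> by (auto simp: field_simps intro!: add_pos_nonneg)
    moreover have "(\<lambda>N. 2 * C / R + C / real N + B / ln (real N)) \<longlonglongrightarrow> 2 * C / R" by real_asymp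
    ultimately have "eventually (\<lambda>N. 2 * C / R + C / real N + B / ln (real N) < \<epsilon>) sequentially"
      by (rule order_tendstoD(2)[rotated])
    then have "eventually (\<lambda>N. norm ((\<Sum>n<N. a n / of_nat (Suc n)) - 0) < \<epsilon>) sequentially"
      using eventually_ge_at_top[of 2]
    proof eventually_elim
      case (elim N)
      then show ?case using B[of N] S0[of N] by simp
    qed
    then show "\<exists>N0. \<forall>N\<ge>N0. norm ((\<Sum>n<N. a n / of_nat (Suc n)) - 0) < \<epsilon>"
      by (simp add: eventually_sequentially)
  qed
qed

text \<open>
  Subtracting f 0 from the coefficient of n = 1 makes the value at 0 vanish.
\<close>
theorem newman:
  fixes a :: "nat \<Rightarrow> complex" and f :: "complex \<Rightarrow> complex"
  assumes bound: "\<And>n. norm (a n) \<le> C"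
    and hol: "f holomorphic_on U" and U: "open U" "{z. 0 \<le> Re z} \<subseteq> U"
    and sums: "\<And>z. Re z > 0 \<Longrightarrow> (\<lambda>n. a n * of_nat (Suc n) powr (-1 - z)) sums f z"
  shows "(\<lambda>n. a n / of_nat (Suc n)) sums f 0"
proof -
  define b where "b n = (if n = 0 then a 0 - f 0 else a n)" for n
  have "(\<lambda>N. \<Sum>n<N. b n / of_nat (Suc n)) \<longlonglongrightarrow> 0"
  proof (rule newman_vanishing[where f="\<lambda>z. f z - f 0", OF _ _ U])
    show "norm (b n) \<le> C + norm (f 0)" for n
      unfolding b_def using bound[of n] norm_triangle_ineq4[of "a 0" "f 0"] by (auto intro: add_increasing2)
    show "(\<lambda>z. f z - f 0) holomorphic_on U" using hol by (intro holomorphic_intros)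
    fix z :: complex assume z: "Re z > 0"
    have "(\<lambda>n. a n * of_nat (Suc n) powr (-1 - z) - (if n = 0 then f 0 else 0)) sums (f z - f 0)"
      by (intro sums_diff sums[OF z]) (use sums_single[of 0 "\<lambda>_. f 0"] in simp)
    then show "(\<lambda>n. b n * of_nat (Suc n) powr (-1 - z)) sums (f z - f 0)"
      by (rule sums_cong[THEN iffD1, rotated]) (auto simp: b_def algebra_simps)
  qed simp
  then have "(\<lambda>n. b n / of_nat (Suc n)) sums 0" unfolding sums_def .
  moreover have "(\<lambda>n. if n = 0 then f 0 else 0) sums f 0" using sums_single[of 0 "\<lambda>_. f 0"] by simp
  ultimately have "(\<lambda>n. b n / of_nat (Suc n) + (if n = 0 then f 0 else 0)) sums (0 + f 0)" by (rule sums_add)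
  then show ?thesis by (simp add: b_def cong: if_cong) (rule sums_cong[THEN iffD1, rotated], assumption, auto simp: b_def)
qed

section \<open>The zeta function and the von Mangoldt series\<close>

lemma norm_nat_powr: "n > 0 \<Longrightarrow> norm (of_nat n powr z :: complex) = real n powr Re z"
  by (subst norm_powr_real_powr) auto

text \<open>
  This is (s - 1) times the integral of (n+1)^(-s) - x^(-s) for x from n+1 to n+2. Summing over n
  gives (s - 1) zeta(s) - 1 where the series for zeta converges, but the terms are smaller by
  a factor n.
\<close>
definition zeta_term :: "nat \<Rightarrow> complex \<Rightarrow> complex" where
  "zeta_term n s = (s - 1) * of_nat (Suc n) powr (-s)
     + of_nat (Suc (Suc n)) powr (1 - s) - of_nat (Suc n) powr (1 - s)"

text \<open>
  Bounds on the segment of integration for the two mean value estimates in the next lemma.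
\<close>
lemma real_segment_powr_bound:
  fixes w z :: complex and a :: real
  assumes a: "a > 0" and w: "Re w \<le> 0" and z: "z \<in> closed_segment (of_real a) (of_real (a + 1))"
  shows "norm (z powr w) \<le> a powr Re w" "z \<in> \<real>" "Re z \<ge> a" "norm (z - of_real a) \<le> 1"
proof -
  obtain u where u: "0 \<le> u" "u \<le> 1" "z = (1 - u) *\<^sub>R of_real a + u *\<^sub>R of_real (a + 1)"
    using z unfolding closed_segment_def by auto
  have zu: "z = of_real (a + u)" using u by (simp add: scaleR_conv_of_real algebra_simps)
  show "z \<in> \<real>" "Re z \<ge> a" "norm (z - of_real a) \<le> 1" using u(1,2) unfolding zu by auto
  then have "norm (z powr w) = (a + u) powr Re w"
    using zu a u by (subst norm_powr_real_powr) auto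
  also have "\<dots> \<le> a powr Re w" using a u w by (intro powr_mono2') auto
  finally show "norm (z powr w) \<le> a powr Re w" .
qed

lemma norm_zeta_term_le:
  assumes s: "Re s > 0"
  shows "norm (zeta_term n s) \<le> norm (s - 1) * norm s * real (Suc n) powr (- Re s - 1)"
proof -
  define a where "a = real (Suc n)"
  define I where "I = closed_segment (complex_of_real a) (of_real (a + 1))"
  define g where "g z = (s - 1) * of_real a powr (-s) * z + z powr (1 - s)" for z
  have a: "a > 0" unfolding a_def by simp
  have ends: "of_real a \<in> I" "of_real (a + 1) \<in> I" unfolding I_def by auto
  have notneg: "z \<notin> \<real>\<^sub>\<le>\<^sub>0" if "z \<in> I" for z
    using real_segment_powr_bound(3)[OF a _ that[unfolded I_def], of 0] a by (auto simp: complex_nonpos_Reals_iff)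
  have inner: "norm (z powr (-s) - of_real a powr (-s)) \<le> norm s * a powr (- Re s - 1)" if z: "z \<in> I" for z
  proof -
    have "norm (z powr (-s) - of_real a powr (-s)) \<le> norm s * a powr (- Re s - 1) * norm (z - of_real a)"
    proof (rule field_differentiable_bound[where S=I and f'="\<lambda>z. (-s) * z powr (-s - 1)"])
      fix x assume x: "x \<in> I"
      show "((\<lambda>z. z powr (-s)) has_field_derivative (-s) * x powr (-s - 1)) (at x within I)"
        using has_field_derivative_powr[OF notneg[OF x], of "-s"] by (rule has_field_derivative_at_within)
      show "norm ((-s) * x powr (-s - 1)) \<le> norm s * a powr (- Re s - 1)"
        using real_segment_powr_bound(1)[OF a _ x[unfolded I_def], of "-s-1"] s
        by (simp add: norm_mult mult_left_mono)
    qed (use z ends in \<open>auto simp: I_def\<close>)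
    also have "\<dots> \<le> norm s * a powr (- Re s - 1) * 1"
      using real_segment_powr_bound(4)[OF a _ z[unfolded I_def], of 0] by (intro mult_left_mono) auto
    finally show ?thesis by simp
  qed
  have "norm (g (of_real (a + 1)) - g (of_real a)) \<le> norm (s - 1) * norm s * a powr (- Re s - 1) * norm (of_real (a + 1) - of_real a :: complex)"
  proof (rule field_differentiable_bound[where S=I and f'="\<lambda>z. (s - 1) * (of_real a powr (-s) - z powr (-s))"])
    fix x assume x: "x \<in> I"
    have "((\<lambda>z. z powr (1 - s)) has_field_derivative (1 - s) * x powr (1 - s - 1)) (at x within I)"
      using has_field_derivative_powr[OF notneg[OF x], of "1 - s"] by (rule has_field_derivative_at_within)
    moreover have "((\<lambda>z. (s - 1) * of_real a powr (-s) * z) has_field_derivative (s - 1) * of_real a powr (-s)) (at x within I)"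
      by (rule DERIV_cmult_Id)
    ultimately have "(g has_field_derivative (s - 1) * of_real a powr (-s) + (1 - s) * x powr (1 - s - 1)) (at x within I)"
      unfolding g_def by (intro DERIV_add)
    then show "(g has_field_derivative (s - 1) * (of_real a powr (-s) - x powr (-s))) (at x within I)"
      by (simp add: algebra_simps)
    have "norm (of_real a powr (-s) - x powr (-s)) \<le> norm s * a powr (- Re s - 1)"
      using inner[OF x] by (simp add: norm_minus_commute)
    then show "norm ((s - 1) * (of_real a powr (-s) - x powr (-s))) \<le> norm (s - 1) * norm s * a powr (- Re s - 1)"
      unfolding norm_mult by (simp add: mult_left_mono mult.assoc)
  qed (use ends in \<open>auto simp: I_def\<close>)
  moreover have "g (of_real (a + 1)) - g (of_real a) = zeta_term n s"
    unfolding g_def zeta_term_def a_def by (simp add: algebra_simps)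
  ultimately show ?thesis by (simp add: a_def)
qed

text \<open>
  With weights 1 this continues (s - 1) zeta(s). With the weights psi(n) - n and s + 1 instead
  of s it controls the error of a partial summation.
\<close>
lemma weighted_zeta_series:
  fixes c :: "nat \<Rightarrow> complex"
  assumes c: "\<And>n. norm (c n) \<le> C * real (Suc n) powr \<alpha>" and \<alpha>: "\<alpha> \<ge> 0"
  shows "(\<lambda>s. \<Sum>n. c n * zeta_term n s) holomorphic_on {s. Re s > \<alpha>}"
    and "\<And>s. Re s > \<alpha> \<Longrightarrow> summable (\<lambda>n. c n * zeta_term n s)"
proof -
  let ?S = "{s. Re s > \<alpha>}"
  have op: "open ?S" by (rule open_halfspace_Re_gt)
  have C0: "C \<ge> 0" using order_trans[OF norm_ge_zero c[of 0]] by simp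
  have "\<exists>d h. 0 < d \<and> summable h \<and> (\<forall>\<^sub>F n in sequentially. \<forall>y\<in>ball s d \<inter> ?S. norm (c n * zeta_term n y) \<le> h n)"
    if s: "s \<in> ?S" for s
  proof -
    define d where "d = (Re s - \<alpha>) / 2"
    define B where "B = norm s + d + 1"
    define h where "h n = C * B\<^sup>2 * real (Suc n) powr (-1 - d)" for n
    have d: "d > 0" and "Re s = \<alpha> + 2 * d" using s unfolding d_def by (simp_all add: field_simps)
    have "summable h"
    proof -
      have "summable (\<lambda>n. real n powr (-1 - d))" using d by (subst summable_real_powr_iff) simp
      then have "summable (\<lambda>n. real (Suc n) powr (-1 - d))" by (subst summable_Suc_iff)
      then show ?thesis unfolding h_def by (rule summable_mult)
    qed
    moreover have "norm (c n * zeta_term n y) \<le> h n" if y: "y \<in> ball s d \<inter> ?S" for n y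
    proof -
      have ds: "norm (s - y) < d" using y by (simp add: dist_norm)
      then have "\<bar>Re s - Re y\<bar> < d" using abs_Re_le_cmod[of "s - y"] by simp
      then have Rey: "Re y \<ge> \<alpha> + d" using \<open>Re s = \<alpha> + 2 * d\<close> by linarith
      have "norm y \<le> norm s + d" using ds norm_triangle_ineq4[of s "s - y"] by simp
      then have ny: "norm y \<le> B" "norm (y - 1) \<le> B"
        unfolding B_def using norm_triangle_ineq4[of y 1] by auto
      have "0 \<le> B" using ny(1) norm_ge_zero order_trans by blast
      have "norm (c n * zeta_term n y) \<le> C * real (Suc n) powr \<alpha> * (norm (y - 1) * norm y * real (Suc n) powr (- Re y - 1))"
        unfolding norm_mult[of "c n"] using c[of n] norm_zeta_term_le[of y n] Rey d \<alpha> C0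
        by (intro mult_mono) auto
      also have "\<dots> \<le> C * real (Suc n) powr \<alpha> * (B * B * real (Suc n) powr (- (\<alpha> + d) - 1))"
        using ny C0 Rey \<open>0 \<le> B\<close> by (intro mult_left_mono mult_mono powr_mono) auto
      also have "\<dots> = h n"
      proof -
        have "real (Suc n) powr \<alpha> * real (Suc n) powr (- (\<alpha> + d) - 1) = real (Suc n) powr (-1 - d)"
          by (simp add: powr_add[symmetric] algebra_simps)
        then show ?thesis unfolding h_def power2_eq_square by (metis (no_types, opaque_lifting) mult.assoc mult.commute)
      qed
      finally show ?thesis .
    qed
    ultimately show ?thesis using d
      by (intro exI[of _ d] exI[of _ h] conjI always_eventually allI ballI) auto
  qed
  note ex = this
  have der: "((\<lambda>s. c n * zeta_term n s) has_field_derivative deriv (\<lambda>s. c n * zeta_term n s) s) (at s)"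
    if "s \<in> ?S" for n s
  proof -
    have "(\<lambda>s. c n * zeta_term n s) holomorphic_on UNIV"
      unfolding zeta_term_def by (intro holomorphic_intros)
    then show ?thesis by (intro holomorphic_derivI[of _ UNIV]) auto
  qed
  obtain g g' where g: "\<forall>x\<in>?S. ((\<lambda>n. c n * zeta_term n x) sums g x) \<and>
      ((\<lambda>n. deriv (\<lambda>s. c n * zeta_term n s) x) sums g' x) \<and> (g has_field_derivative g' x) (at x)"
    using series_and_derivative_comparison_local[OF op der ex] by blast
  show "summable (\<lambda>n. c n * zeta_term n s)" if "Re s > \<alpha>" for s using g that by (auto simp: sums_iff)
  have "g holomorphic_on ?S"
    using g op by (auto simp: holomorphic_on_open)
  then show "(\<lambda>s. \<Sum>n. c n * zeta_term n s) holomorphic_on ?S"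
    by (rule holomorphic_transform) (use g in \<open>auto simp: sums_iff\<close>)
qed

text \<open>
  The function (s - 1) zeta(s), continued to the half plane Re s > 0.
\<close>
definition pzeta :: "complex \<Rightarrow> complex" where
  "pzeta s = 1 + (\<Sum>n. zeta_term n s)"

lemma pzeta_holomorphic: "pzeta holomorphic_on {s. Re s > 0}"
  unfolding pzeta_def using weighted_zeta_series(1)[of "\<lambda>_. 1" 1 0] by (intro holomorphic_intros) simp

lemma pzeta_1: "pzeta 1 = 1"
proof -
  have "zeta_term n 1 = 0" for n unfolding zeta_term_def by (simp del: of_nat_Suc)
  then show ?thesis unfolding pzeta_def by simp
qed

definition zeta_series :: "complex \<Rightarrow> complex" where
  "zeta_series s = (\<Sum>n. of_nat n powr (-s))"

lemma summable_norm_nat_powr: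
  assumes "Re s > 1"
  shows "summable (\<lambda>n. norm (of_nat n powr (-s) :: complex))"
proof -
  have "norm (of_nat n powr (-s) :: complex) = real n powr (- Re s)" for n
    by (cases "n = 0") (auto simp: norm_nat_powr)
  then show ?thesis using assms by (simp add: summable_real_powr_iff)
qed

lemma pzeta_eq:
  assumes s: "Re s > 1"
  shows "pzeta s = (s - 1) * zeta_series s"
proof -
  have "summable (\<lambda>n. of_nat n powr (-s) :: complex)"
    using summable_norm_nat_powr[OF s] by (rule summable_norm_cancel)
  then have "(\<lambda>n. of_nat n powr (-s) :: complex) sums zeta_series s"
    unfolding zeta_series_def by (rule summable_sums)
  then have z: "(\<lambda>n. of_nat (Suc n) powr (-s) :: complex) sums zeta_series s"
    by (subst sums_Suc_iff) simp
  have "(\<lambda>n. of_nat (Suc n) powr (1 - s) :: complex) \<longlonglongrightarrow> 0"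
  proof (rule tendsto_norm_zero_cancel)
    have "(\<lambda>n. real (Suc n) powr (1 - Re s)) \<longlonglongrightarrow> 0" using s by real_asymp
    then show "(\<lambda>n. norm (of_nat (Suc n) powr (1 - s) :: complex)) \<longlonglongrightarrow> 0"
      by (simp add: norm_nat_powr del: of_nat_Suc)
  qed
  from telescope_sums[OF this]
  have t: "(\<lambda>n. of_nat (Suc (Suc n)) powr (1 - s) - of_nat (Suc n) powr (1 - s) :: complex) sums (-1)"
    by simp
  have "(\<lambda>n. (s - 1) * of_nat (Suc n) powr (-s) + (of_nat (Suc (Suc n)) powr (1 - s) - of_nat (Suc n) powr (1 - s)))
     sums ((s - 1) * zeta_series s + (-1))"
    by (intro sums_add sums_mult z t)
  then have "(\<lambda>n. zeta_term n s) sums ((s - 1) * zeta_series s - 1)"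
    unfolding zeta_term_def by (simp add: add_diff_eq)
  then show ?thesis unfolding pzeta_def by (simp add: sums_iff)
qed

lemma ln_powr_summable:
  fixes \<sigma> :: real
  assumes "\<sigma> > 1"
  shows "summable (\<lambda>n. ln (real n) * real n powr (- \<sigma>))"
proof -
  define \<delta> where "\<delta> = (\<sigma> - 1) / 2"
  have \<delta>: "\<delta> > 0" "- \<sigma> + \<delta> < -1" using assms unfolding \<delta>_def by (auto simp: field_simps)
  have "summable (\<lambda>n. real n powr (- \<sigma> + \<delta>) / \<delta>)"
    using \<delta> by (intro summable_divide) (simp add: summable_real_powr_iff)
  then show ?thesis
  proof (rule summable_comparison_test[rotated], intro exI allI impI)
    fix n :: nat
    show "norm (ln (real n) * real n powr (- \<sigma>)) \<le> real n powr (- \<sigma> + \<delta>) / \<delta>"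
    proof (cases "n = 0")
      case False
      then have "ln (real n) \<le> real n powr \<delta> / \<delta>" using \<delta> by (intro ln_powr_bound) auto
      then have "ln (real n) * real n powr (- \<sigma>) \<le> real n powr \<delta> / \<delta> * real n powr (- \<sigma>)"
        by (intro mult_right_mono) auto
      also have "\<dots> = real n powr (- \<sigma> + \<delta>) / \<delta>"
        unfolding powr_add[of _ "- \<sigma>"] by simp
      finally show ?thesis using False by simp
    qed auto
  qed
qed

lemma zeta_series_deriv:
  assumes s: "Re s > 1"
  shows "(zeta_series has_field_derivative - (\<Sum>n. of_real (ln (real n)) * of_nat n powr (-s))) (at s)"
    and "summable (\<lambda>n. norm (of_real (ln (real n)) * of_nat n powr (-s) :: complex))"
proof -
  let ?S = "{s. Re s > 1}"
  have op: "open ?S" by (rule open_halfspace_Re_gt)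
  have der: "((\<lambda>s. of_nat n powr (-s)) has_field_derivative - (of_real (ln (real n)) * of_nat n powr (-s))) (at s)"
    if "s \<in> ?S" for n :: nat and s :: complex
  proof (cases "n = 0")
    case False
    have "((\<lambda>s. exp (- s * of_real (ln (real n)))) has_field_derivative - (of_real (ln (real n)) * exp (- s * of_real (ln (real n))))) (at s)"
      by (auto intro!: derivative_eq_intros)
    moreover have "of_nat n powr (-s) = exp (- s * of_real (ln (real n)))" for s :: complex
      using False by (simp add: powr_def Ln_of_nat)
    ultimately show ?thesis by simp
  qed auto
  have ex: "\<exists>d h. 0 < d \<and> summable h \<and> (\<forall>\<^sub>F n in sequentially. \<forall>y\<in>ball s d \<inter> ?S. norm (of_nat n powr (-y) :: complex) \<le> h n)"
    if s: "s \<in> ?S" for s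
  proof -
    define d where "d = (Re s - 1) / 2"
    have d: "d > 0" and "Re s = 1 + 2 * d" using s unfolding d_def by (simp_all add: field_simps)
    have "summable (\<lambda>n. real n powr (-1 - d))" using d by (subst summable_real_powr_iff) simp
    moreover have "norm (of_nat n powr (-y) :: complex) \<le> real n powr (-1 - d)" if y: "y \<in> ball s d \<inter> ?S" for n y
    proof (cases "n = 0")
      case False
      have "\<bar>Re s - Re y\<bar> < d" using y abs_Re_le_cmod[of "s - y"] by (simp add: dist_norm)
      then have Rey: "Re y \<ge> 1 + d" using \<open>Re s = 1 + 2 * d\<close> by linarith
      then show ?thesis using False by (simp add: norm_nat_powr powr_mono)
    qed auto
    ultimately show ?thesis using d
      by (intro exI[of _ d] exI[of _ "\<lambda>n. real n powr (-1 - d)"] conjI always_eventually allI ballI) auto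
  qed
  obtain g g' where g: "\<forall>x\<in>?S. ((\<lambda>n. of_nat n powr (-x)) sums g x) \<and>
      ((\<lambda>n. - (of_real (ln (real n)) * of_nat n powr (-x))) sums g' x) \<and> (g has_field_derivative g' x) (at x)"
    using series_and_derivative_comparison_local[OF op der ex] by blast
  have "norm (of_real (ln (real n)) * of_nat n powr (-s) :: complex) = ln (real n) * real n powr (- Re s)" for n
    by (cases "n = 0") (auto simp: norm_mult norm_nat_powr)
  then show sm: "summable (\<lambda>n. norm (of_real (ln (real n)) * of_nat n powr (-s) :: complex))"
    using ln_powr_summable[OF s] by simp
  have "g' s = - (\<Sum>n. of_real (ln (real n)) * of_nat n powr (-s))"
    using g s summable_norm_cancel[OF sm] by (auto simp: sums_iff suminf_minus)
  moreover have "(zeta_series has_field_derivative g' s) (at s)"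
  proof (rule has_field_derivative_transform_within_open)
    show "(g has_field_derivative g' s) (at s)" using g s by auto
  qed (use g s op in \<open>auto simp: zeta_series_def sums_iff\<close>)
  ultimately show "(zeta_series has_field_derivative - (\<Sum>n. of_real (ln (real n)) * of_nat n powr (-s))) (at s)" by simp
qed

definition mangoldt_series :: "complex \<Rightarrow> complex" where
  "mangoldt_series s = (\<Sum>n. mangoldt n * of_nat n powr (-s))"

lemma summable_norm_mangoldt:
  assumes s: "Re s > 1"
  shows "summable (\<lambda>n. norm (mangoldt n * of_nat n powr (-s) :: complex))"
proof (rule summable_comparison_test[OF _ zeta_series_deriv(2)[OF s]], intro exI allI impI)
  fix n :: nat
  have "mangoldt n \<le> \<bar>ln (real n)\<bar>"
    using mangoldt_le[of n] by (cases "n = 0") (auto simp: abs_if intro: order_trans)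
  then show "norm (norm (mangoldt n * of_nat n powr (-s) :: complex)) \<le> norm (of_real (ln (real n)) * of_nat n powr (-s) :: complex)"
    by (simp add: norm_mult abs_mult mult_right_mono)
qed

text \<open>
  The absolutely convergent double series over d and m is rearranged by the product n = d m,
  and the values of the von Mangoldt function on the divisors of n add up to ln n.
\<close>
lemma mangoldt_series_times_zeta:
  assumes s: "Re s > 1"
  shows "mangoldt_series s * zeta_series s = (\<Sum>n. of_real (ln (real n)) * of_nat n powr (-s))"
proof -
  define f where "f d = (mangoldt d * of_nat d powr (-s) :: complex)" for d
  define g where "g m = (of_nat m powr (-s) :: complex)" for m
  define h where "h n = (of_real (ln (real n)) * of_nat n powr (-s) :: complex)" for n
  have nf: "summable (\<lambda>n. norm (f n))" and ng: "summable (\<lambda>n. norm (g n))" and nh: "summable (\<lambda>n. norm (h n))"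
    unfolding f_def g_def h_def using summable_norm_mangoldt[OF s] summable_norm_nat_powr[OF s] zeta_series_deriv(2)[OF s] by auto
  have hs: "(k has_sum suminf k) UNIV" if "summable (\<lambda>n. norm (k n))" for k :: "nat \<Rightarrow> complex"
    using that summable_norm_cancel[OF that] by (intro norm_summable_imp_has_sum) (auto simp: summable_sums)
  have af: "(\<lambda>x. norm (f x)) summable_on UNIV" "(\<lambda>x. norm (g x)) summable_on UNIV"
    using nf ng by (auto intro!: norm_summable_imp_summable_on)
  have c0: "0 \<le> (\<Sum>\<^sub>\<infinity>y. norm (g y))" by (intro infsum_nonneg) auto
  have prod: "(\<lambda>x. norm (case x of (d, m) \<Rightarrow> f d * g m)) summable_on UNIV \<times> UNIV"
    unfolding Infinite_Sum.abs_summable_on_Sigma_iff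
    using af c0 by (auto simp: norm_mult infsum_cmult_right' abs_mult intro!: summable_on_cmult_right summable_on_cmult_left)
  have infs: "(\<Sum>\<^sub>\<infinity>n. f n) = mangoldt_series s" "(\<Sum>\<^sub>\<infinity>n. g n) = zeta_series s" "(\<Sum>\<^sub>\<infinity>n. h n) = suminf h"
    using hs[OF nf] hs[OF ng] hs[OF nh] by (auto simp: infsumI mangoldt_series_def zeta_series_def f_def g_def)
  have "(\<Sum>\<^sub>\<infinity>(d, m)\<in>UNIV \<times> UNIV. f d * g m) = (\<Sum>\<^sub>\<infinity>d. \<Sum>\<^sub>\<infinity>m. f d * g m)"
    using Infinite_Sum.abs_summable_summable[OF prod] by (simp add: infsum_Sigma'_banach)
  also have "\<dots> = mangoldt_series s * zeta_series s"
    by (simp add: infsum_cmult_right' infsum_cmult_left' infs)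
  finally have 1: "(\<Sum>\<^sub>\<infinity>(d, m)\<in>UNIV \<times> UNIV. f d * g m) = mangoldt_series s * zeta_series s" .
  have 2: "(\<Sum>\<^sub>\<infinity>(d, m)\<in>UNIV \<times> UNIV. f d * g m) = (\<Sum>\<^sub>\<infinity>(d, m)\<in>{1..} \<times> {1..}. f d * g m)"
    by (rule infsum_cong_neutral) (auto simp: f_def g_def)
  have sum2: "(\<lambda>(d, m). f d * g m) summable_on {1..} \<times> {1..}"
    using Infinite_Sum.abs_summable_summable[OF prod] by (rule summable_on_subset_banach) auto
  have bij: "bij_betw (\<lambda>(n, d). (d, n div d)) (Sigma {1..} (\<lambda>n. {d. d dvd n})) ({1..} \<times> {1..} :: (nat \<times> nat) set)"
    by (rule bij_betwI[where g="\<lambda>(d, m). (d * m, d)"])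
      (auto simp: Suc_le_eq dvd_div_eq_0_iff intro: Nat.gr0I)
  have eq: "f d * g (n div d) = mangoldt d * of_nat n powr (-s)" if "d dvd n" "n \<ge> 1" for n d
  proof -
    have d: "d > 0" "n div d > 0" using that by (auto intro!: Nat.gr0I simp: dvd_div_eq_0_iff)
    have "(of_nat d powr (-s) * of_nat (n div d) powr (-s) :: complex) = (of_nat d * of_nat (n div d)) powr (-s)"
      using d by (subst powr_times_real) auto
    also have "(of_nat d * of_nat (n div d) :: complex) = of_nat n" using that by (metis dvd_mult_div_cancel of_nat_mult)
    finally show ?thesis unfolding f_def g_def by (simp add: mult.assoc)
  qed
  have "(\<Sum>\<^sub>\<infinity>(d, m)\<in>{1..} \<times> {1..}. f d * g m) = (\<Sum>\<^sub>\<infinity>(n, d)\<in>Sigma {1..} (\<lambda>n. {d. d dvd n}). f d * g (n div d))"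
    using infsum_reindex_bij_betw[OF bij, of "\<lambda>(d, m). f d * g m"] by (simp add: case_prod_unfold)
  also have "\<dots> = (\<Sum>\<^sub>\<infinity>n\<in>{1..}. \<Sum>\<^sub>\<infinity>d\<in>{d. d dvd n}. f d * g (n div d))"
  proof (subst infsum_Sigma'_banach)
    show "(\<lambda>(n, d). f d * g (n div d)) summable_on Sigma {1..} (\<lambda>n. {d. d dvd n})"
      using summable_on_reindex_bij_betw[OF bij, of "\<lambda>(d, m). f d * g m"] sum2 by (simp add: case_prod_unfold)
  qed simp
  also have "\<dots> = (\<Sum>\<^sub>\<infinity>n\<in>{1..}. h n)"
  proof (rule infsum_cong)
    fix n :: nat assume n: "n \<in> {1..}"
    have "(\<Sum>\<^sub>\<infinity>d\<in>{d. d dvd n}. f d * g (n div d)) = (\<Sum>d | d dvd n. f d * g (n div d))"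
      using n by (intro infsum_finite) auto
    also have "\<dots> = (\<Sum>d | d dvd n. mangoldt d * of_nat n powr (-s))"
      using n by (intro sum.cong refl eq) auto
    also have "\<dots> = h n" unfolding h_def sum_distrib_right[symmetric] using n by (subst mangoldt_sum) auto
    finally show "(\<Sum>\<^sub>\<infinity>d\<in>{d. d dvd n}. f d * g (n div d)) = h n" .
  qed
  also have "\<dots> = (\<Sum>\<^sub>\<infinity>n. h n)" by (rule infsum_cong_neutral) (auto simp: h_def)
  finally show ?thesis using 1 2 infs(3) unfolding h_def by simp
qed

lemma mangoldt_series_pzeta:
  assumes s: "Re s > 1"
  shows "mangoldt_series s * pzeta s = pzeta s / (s - 1) - deriv pzeta s"
proof -
  have ne: "s \<noteq> 1" using s by auto
  have "((\<lambda>s. (s - 1) * zeta_series s) has_field_derivative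
     (zeta_series s + (s - 1) * - (\<Sum>n. of_real (ln (real n)) * of_nat n powr (-s)))) (at s)"
    using zeta_series_deriv(1)[OF s] by (auto intro!: derivative_eq_intros)
  then have "(pzeta has_field_derivative
     (zeta_series s + (s - 1) * - (mangoldt_series s * zeta_series s))) (at s)"
    unfolding mangoldt_series_times_zeta[OF s, symmetric]
    by (rule has_field_derivative_transform_within_open[OF _ open_halfspace_Re_gt[of 1]]) (use s in \<open>auto simp: pzeta_eq\<close>)
  then have "deriv pzeta s = zeta_series s - (s - 1) * (mangoldt_series s * zeta_series s)"
    by (simp add: DERIV_imp_deriv)
  then show ?thesis unfolding pzeta_eq[OF s] using ne by simp
qed

section \<open>Zeros on the line Re s = 1\<close>

text \<open>
  At a zero the logarithmic derivative has a simple pole with the order of the zero as its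
  residue; where f does not vanish it is regular, and the order is 0.
\<close>
lemma log_deriv_limit:
  assumes f: "f holomorphic_on S" and S: "open S" "connected S" "z \<in> S" and nz: "w0 \<in> S" "f w0 \<noteq> 0"
  shows "nat (zorder f z) = 0 \<longleftrightarrow> f z \<noteq> 0"
    and "((\<lambda>\<epsilon>. of_real \<epsilon> * (deriv f (z + of_real \<epsilon>) / f (z + of_real \<epsilon>))) \<longlongrightarrow> of_nat (nat (zorder f z))) (at_right 0)"
    and "eventually (\<lambda>\<epsilon>. f (z + of_real \<epsilon>) \<noteq> 0) (at_right 0)"
proof -
  define \<mu> where "\<mu> = nat (zorder f z)"
  define g where "g = zor_poly f z"
  obtain r where ord: "if f z = 0 then 0 < zorder f z else zorder f z = 0"
    and r: "r > 0" "cball z r \<subseteq> S" "g holomorphic_on cball z r"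
      "\<And>w. w \<in> cball z r \<Longrightarrow> f w = g w * (w - z) ^ \<mu> \<and> g w \<noteq> 0"
    using zorder_exist_zero[OF f S] nz unfolding \<mu>_def g_def by blast
  have gb: "g holomorphic_on ball z r" using r(3) by (rule holomorphic_on_subset) auto
  have key: "(w - z) * (deriv f w / f w) = (w - z) * (deriv g w / g w) + of_nat \<mu> \<and> f w \<noteq> 0"
    if w: "w \<in> ball z r" "w \<noteq> z" for w
  proof -
    have gw: "g w \<noteq> 0" "f w = g w * (w - z) ^ \<mu>" using r(4)[of w] w by auto
    have "(g has_field_derivative deriv g w) (at w)" using gb w by (intro holomorphic_derivI) auto
    then have "((\<lambda>w. g w * (w - z) ^ \<mu>) has_field_derivative
       (deriv g w * (w - z) ^ \<mu> + g w * (of_nat \<mu> * (w - z) ^ (\<mu> - 1)))) (at w)"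
      by (auto intro!: derivative_eq_intros)
    then have "(f has_field_derivative
       (deriv g w * (w - z) ^ \<mu> + g w * (of_nat \<mu> * (w - z) ^ (\<mu> - 1)))) (at w)"
      by (rule has_field_derivative_transform_within_open[OF _ open_ball w(1)]) (use r(4) in auto)
    then have d: "deriv f w = deriv g w * (w - z) ^ \<mu> + g w * (of_nat \<mu> * (w - z) ^ (\<mu> - 1))"
      by (rule DERIV_imp_deriv)
    have p: "(w - z) * (of_nat \<mu> * (w - z) ^ (\<mu> - 1)) = of_nat \<mu> * (w - z) ^ \<mu>"
      by (cases \<mu>) auto
    have "(w - z) * deriv f w = (w - z) * deriv g w * (w - z) ^ \<mu> + g w * ((w - z) * (of_nat \<mu> * (w - z) ^ (\<mu> - 1)))"
      unfolding d by (simp add: algebra_simps)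
    also have "\<dots> = ((w - z) * (deriv g w / g w) + of_nat \<mu>) * f w"
      unfolding p gw(2) using gw(1) by (simp add: field_simps)
    finally show ?thesis using gw w by (simp add: field_simps)
  qed
  have evr: "eventually (\<lambda>\<epsilon>. \<epsilon> \<in> {0<..<r}) (at_right 0)"
    using eventually_at_right_real[OF r(1)] .
  then have ev: "eventually (\<lambda>\<epsilon>. of_real \<epsilon> * (deriv g (z + of_real \<epsilon>) / g (z + of_real \<epsilon>)) + of_nat \<mu>
        = of_real \<epsilon> * (deriv f (z + of_real \<epsilon>) / f (z + of_real \<epsilon>)) \<and> f (z + of_real \<epsilon>) \<noteq> 0) (at_right 0)"
  proof eventually_elim
    case (elim \<epsilon>)
    then show ?case using key[of "z + of_real \<epsilon>"] by (auto simp: dist_norm)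
  qed
  have "(\<lambda>w. deriv g w / g w) holomorphic_on ball z r"
    using gb r(4) by (intro holomorphic_on_divide holomorphic_deriv) auto
  then have "continuous_on (ball z r) (\<lambda>w. deriv g w / g w)" by (rule holomorphic_on_imp_continuous_on)
  then have "isCont (\<lambda>w. deriv g w / g w) z" using r(1) by (simp add: continuous_on_eq_continuous_at)
  moreover have "((\<lambda>\<epsilon>. z + of_real \<epsilon>) \<longlongrightarrow> z) (at_right 0)"
    by (auto intro!: tendsto_eq_intros)
  ultimately have "((\<lambda>\<epsilon>. deriv g (z + of_real \<epsilon>) / g (z + of_real \<epsilon>)) \<longlongrightarrow> deriv g z / g z) (at_right 0)"
    by (rule isCont_tendsto_compose)
  from tendsto_add[OF tendsto_mult[OF tendsto_of_real[OF tendsto_ident_at] this] tendsto_const[of "of_nat \<mu>"]]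
  have lim: "((\<lambda>\<epsilon>. of_real \<epsilon> * (deriv g (z + of_real \<epsilon>) / g (z + of_real \<epsilon>)) + of_nat \<mu>) \<longlongrightarrow> of_nat \<mu>) (at_right 0)"
    by simp
  show "((\<lambda>\<epsilon>. of_real \<epsilon> * (deriv f (z + of_real \<epsilon>) / f (z + of_real \<epsilon>))) \<longlongrightarrow> of_nat (nat (zorder f z))) (at_right 0)"
    unfolding \<mu>_def[symmetric]
  proof (rule Lim_transform_eventually[OF lim])
    show "eventually (\<lambda>\<epsilon>. of_real \<epsilon> * (deriv g (z + of_real \<epsilon>) / g (z + of_real \<epsilon>)) + of_nat \<mu>
        = of_real \<epsilon> * (deriv f (z + of_real \<epsilon>) / f (z + of_real \<epsilon>))) (at_right 0)"
      using ev by eventually_elim blast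
  qed
  show "eventually (\<lambda>\<epsilon>. f (z + of_real \<epsilon>) \<noteq> 0) (at_right 0)"
    using ev by eventually_elim blast
  show "nat (zorder f z) = 0 \<longleftrightarrow> f z \<noteq> 0" using ord by (auto split: if_splits)
qed

lemma mangoldt_series_limit:
  assumes s: "Re s \<ge> 1"
  shows "nat (zorder pzeta s) = 0 \<longleftrightarrow> pzeta s \<noteq> 0"
    and "((\<lambda>\<epsilon>. of_real \<epsilon> * mangoldt_series (s + of_real \<epsilon>)) \<longlongrightarrow>
      (if s = 1 then 1 else 0) - of_nat (nat (zorder pzeta s))) (at_right 0)"
proof -
  define \<mu> where "\<mu> = nat (zorder pzeta s)"
  have con: "connected {s. Re s > 0}" by (intro convex_connected convex_halfspace_Re_gt)
  have mem: "s \<in> {s. Re s > 0}" "1 \<in> {s. Re s > 0}" "pzeta 1 \<noteq> 0" using s pzeta_1 by auto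
  note ld = log_deriv_limit[OF pzeta_holomorphic open_halfspace_Re_gt con mem]
  show "nat (zorder pzeta s) = 0 \<longleftrightarrow> pzeta s \<noteq> 0" by (rule ld(1))
  note lim = ld(2)[folded \<mu>_def] and ev = ld(3)
  have "((\<lambda>\<epsilon>. of_real \<epsilon> / (s + of_real \<epsilon> - 1)) \<longlongrightarrow> (if s = 1 then 1 else 0)) (at_right 0)"
  proof (cases "s = 1")
    case True
    have "eventually (\<lambda>\<epsilon>::real. of_real \<epsilon> / (s + of_real \<epsilon> - 1) = (1::complex)) (at_right 0)"
      using eventually_at_right_less[of 0] by eventually_elim (simp add: True)
    then show ?thesis using True by (simp add: tendsto_eventually)
  next
    case False
    have "((\<lambda>\<epsilon>. of_real \<epsilon> / (s + of_real \<epsilon> - 1)) \<longlongrightarrow> of_real 0 / (s + of_real 0 - 1)) (at_right 0)"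
      using False by (intro tendsto_intros) auto
    then show ?thesis using False by simp
  qed
  from tendsto_diff[OF this lim]
  show "((\<lambda>\<epsilon>. of_real \<epsilon> * mangoldt_series (s + of_real \<epsilon>)) \<longlongrightarrow> (if s = 1 then 1 else 0) - of_nat (nat (zorder pzeta s))) (at_right 0)"
    unfolding \<mu>_def[symmetric]
  proof (rule Lim_transform_eventually)
    show "eventually (\<lambda>\<epsilon>. of_real \<epsilon> / (s + of_real \<epsilon> - 1) - of_real \<epsilon> * (deriv pzeta (s + of_real \<epsilon>) / pzeta (s + of_real \<epsilon>))
        = of_real \<epsilon> * mangoldt_series (s + of_real \<epsilon>)) (at_right 0)"
      using ev eventually_at_right_less[of 0]
    proof eventually_elim
      case (elim \<epsilon>)
      have "Re (s + of_real \<epsilon>) > 1" using s elim by simp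
      from mangoldt_series_pzeta[OF this] elim
      have eq: "mangoldt_series (s + of_real \<epsilon>) = 1 / (s + of_real \<epsilon> - 1) - deriv pzeta (s + of_real \<epsilon>) / pzeta (s + of_real \<epsilon>)"
        by (simp add: field_simps)
      show ?case unfolding eq by (simp add: right_diff_distrib)
    qed
  qed
qed

lemma mangoldt_series_sums:
  "Re s > 1 \<Longrightarrow> (\<lambda>n. mangoldt n * of_nat n powr (-s)) sums mangoldt_series s"
  unfolding mangoldt_series_def
  using summable_norm_cancel[OF summable_norm_mangoldt] by (rule summable_sums)

text \<open>
  The classical inequality 3 + 4 cos \<theta> + cos (2 \<theta>) = 2 (1 + cos \<theta>)^2 \<ge> 0, applied termwise.
\<close>
lemma three_four_one:
  fixes \<sigma> t :: real
  assumes \<sigma>: "\<sigma> > 1"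
  shows "0 \<le> Re (3 * mangoldt_series (of_real \<sigma>) + 4 * mangoldt_series (Complex \<sigma> t) + mangoldt_series (Complex \<sigma> (2 * t)))"
proof -
  let ?c = "\<lambda>n. 3 * (mangoldt n * of_nat n powr (- of_real \<sigma>)) + 4 * (mangoldt n * of_nat n powr (- Complex \<sigma> t))
     + mangoldt n * of_nat n powr (- Complex \<sigma> (2 * t)) :: complex"
  have "?c sums (3 * mangoldt_series (of_real \<sigma>) + 4 * mangoldt_series (Complex \<sigma> t) + mangoldt_series (Complex \<sigma> (2 * t)))"
    using \<sigma> by (intro sums_add sums_mult mangoldt_series_sums) auto
  then have sm: "(\<lambda>n. Re (?c n)) sums Re (3 * mangoldt_series (of_real \<sigma>) + 4 * mangoldt_series (Complex \<sigma> t) + mangoldt_series (Complex \<sigma> (2 * t)))"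
    by (rule sums_Re)
  have nn: "0 \<le> Re (?c n)" for n
  proof (cases "n = 0")
    case False
    define x where "x = ln (real n)"
    have pw: "of_nat n powr (- Complex \<sigma> u) = of_real (real n powr (- \<sigma>)) * cis (- u * x)" for u
    proof -
      have "of_nat n powr (- Complex \<sigma> u) = exp (- Complex \<sigma> u * of_real x)"
        using False unfolding x_def by (simp add: powr_def Ln_of_nat)
      also have "- Complex \<sigma> u * of_real x = of_real (- \<sigma> * x) + \<i> * of_real (- u * x)"
        by (simp add: complex_eq_iff)
      also have "exp \<dots> = of_real (exp (- \<sigma> * x)) * cis (- u * x)"
        by (simp only: exp_add cis_conv_exp exp_of_real)
      also have "exp (- \<sigma> * x) = real n powr (- \<sigma>)" using False unfolding x_def by (simp add: powr_def)
      finally show ?thesis .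
    qed
    have m: "mangoldt n = (of_real (mangoldt n) :: complex)" by simp
    have r: "Re (mangoldt n * of_nat n powr (- Complex \<sigma> u) :: complex) = mangoldt n * real n powr (- \<sigma>) * cos (u * x)" for u
      unfolding pw by (subst m) (simp add: Re_divide)
    have o: "of_real \<sigma> = Complex \<sigma> 0" by (simp add: complex_eq_iff)
    have lin: "Re (3 * X + 4 * Y + Z) = 3 * Re X + 4 * Re Y + Re Z" for X Y Z :: complex by simp
    have "Re (?c n) = mangoldt n * real n powr (- \<sigma>) * (3 + 4 * cos (t * x) + cos (2 * (t * x)))"
      unfolding o lin r by (simp add: algebra_simps)
    also have "3 + 4 * cos (t * x) + cos (2 * (t * x)) = 2 * (1 + cos (t * x))\<^sup>2"
      unfolding cos_double_cos by (simp add: power2_eq_square algebra_simps)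
    finally show ?thesis by (simp add: mangoldt_nonneg)
  qed auto
  have "0 \<le> (\<Sum>n. Re (?c n))" by (rule suminf_nonneg[OF sums_summable[OF sm] nn])
  also have "\<dots> = Re (3 * mangoldt_series (of_real \<sigma>) + 4 * mangoldt_series (Complex \<sigma> t) + mangoldt_series (Complex \<sigma> (2 * t)))"
    using sm by (rule sums_unique[symmetric])
  finally show ?thesis .
qed

text \<open>
  If \<kappa>, \<mu>, \<nu> are the orders of the zeros at \<sigma>, s and \<sigma> + 2 i t, the inequality above gives
  3 ([\<sigma> = 1] - \<kappa>) - 4 \<mu> - \<nu> \<ge> 0, which forces \<mu> = 0. This also covers \<sigma> > 1.
\<close>
lemma pzeta_nonzero:
  assumes s: "Re s \<ge> 1"
  shows "pzeta s \<noteq> 0"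
proof (cases "s = 1")
  case True
  then show ?thesis by (simp add: pzeta_1)
next
  case False
  define \<sigma> t where "\<sigma> = Re s" and "t = Im s"
  have s_eq: "s = Complex \<sigma> t" unfolding \<sigma>_def t_def by simp
  define \<kappa> \<mu> \<nu> where "\<kappa> = nat (zorder pzeta (of_real \<sigma>))" and "\<mu> = nat (zorder pzeta s)"
    and "\<nu> = nat (zorder pzeta (Complex \<sigma> (2 * t)))"
  have re: "Re (of_real \<sigma>) \<ge> 1" "Re (Complex \<sigma> (2 * t)) \<ge> 1" using s unfolding \<sigma>_def by auto
  note \<kappa> = mangoldt_series_limit[OF re(1), folded \<kappa>_def]
  note \<mu> = mangoldt_series_limit[OF s, folded \<mu>_def]
  note \<nu> = mangoldt_series_limit(2)[OF re(2), folded \<nu>_def]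
  have ne2: "Complex \<sigma> (2 * t) \<noteq> 1" using False s_eq by (auto simp: complex_eq_iff)
  let ?G = "\<lambda>\<epsilon>. 3 * (of_real \<epsilon> * mangoldt_series (of_real \<sigma> + of_real \<epsilon>)) + 4 * (of_real \<epsilon> * mangoldt_series (s + of_real \<epsilon>))
      + of_real \<epsilon> * mangoldt_series (Complex \<sigma> (2 * t) + of_real \<epsilon>)"
  define l where "l = 3 * ((if \<sigma> = 1 then 1 else 0) - real \<kappa>) + 4 * (- real \<mu>) + (- real \<nu>)"
  have "((\<lambda>\<epsilon>. Re (?G \<epsilon>)) \<longlongrightarrow>
     Re (3 * ((if of_real \<sigma> = (1::complex) then 1 else 0) - of_nat \<kappa>) + 4 * ((if s = 1 then 1 else 0) - of_nat \<mu>)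
      + ((if Complex \<sigma> (2 * t) = 1 then 1 else 0) - of_nat \<nu>))) (at_right 0)"
    by (intro tendsto_intros \<kappa>(2) \<mu>(2) \<nu>)
  also have "Re (3 * ((if of_real \<sigma> = (1::complex) then 1 else 0) - of_nat \<kappa>) + 4 * ((if s = 1 then 1 else 0) - of_nat \<mu>)
      + ((if Complex \<sigma> (2 * t) = 1 then 1 else 0) - of_nat \<nu>)) = l"
    unfolding l_def using False ne2 by simp
  finally have lim: "((\<lambda>\<epsilon>. Re (?G \<epsilon>)) \<longlongrightarrow> l) (at_right 0)" .
  have "0 \<le> l"
  proof (rule tendsto_lowerbound[OF lim])
    show "eventually (\<lambda>\<epsilon>. 0 \<le> Re (?G \<epsilon>)) (at_right 0)"
      using eventually_at_right_less[of 0]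
    proof eventually_elim
      case (elim \<epsilon>)
      have 1: "\<sigma> + \<epsilon> > 1" using s elim unfolding \<sigma>_def by simp
      have e: "of_real \<sigma> + of_real \<epsilon> = (of_real (\<sigma> + \<epsilon>) :: complex)" "s + of_real \<epsilon> = Complex (\<sigma> + \<epsilon>) t"
        "Complex \<sigma> (2 * t) + of_real \<epsilon> = Complex (\<sigma> + \<epsilon>) (2 * t)"
        unfolding s_eq by (auto simp: complex_eq_iff)
      have "?G \<epsilon>
        = of_real \<epsilon> * (3 * mangoldt_series (of_real (\<sigma> + \<epsilon>)) + 4 * mangoldt_series (Complex (\<sigma> + \<epsilon>) t)
          + mangoldt_series (Complex (\<sigma> + \<epsilon>) (2 * t)))"
        unfolding e by (simp add: algebra_simps)
      moreover have "Re (of_real \<epsilon> * X) = \<epsilon> * Re X" for X by simp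
      ultimately show ?case using three_four_one[OF 1, of t] elim
        by (simp only:) (intro mult_nonneg_nonneg, simp_all)
    qed
  qed simp
  moreover have "\<sigma> = 1 \<Longrightarrow> \<kappa> = 0" using \<kappa>(1) pzeta_1 by simp
  ultimately have "\<mu> = 0" unfolding l_def by (cases "\<sigma> = 1") (auto split: if_splits)
  then show ?thesis using \<mu>(1) by simp
qed

section \<open>Chebyshev's function and its Dirichlet series\<close>

definition psi :: "nat \<Rightarrow> real" where
  "psi n = (\<Sum>k\<in>{1..n}. mangoldt k)"

lemma psi_Suc: "psi (Suc n) = psi n + mangoldt (Suc n)"
  unfolding psi_def by simp

lemma psi_mono: "m \<le> n \<Longrightarrow> psi m \<le> psi n"
  unfolding psi_def by (intro sum_mono2) (auto simp: mangoldt_nonneg)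

lemma psi_nonneg: "0 \<le> psi n"
  unfolding psi_def by (intro sum_nonneg) (auto simp: mangoldt_nonneg)

lemma ln_fact_mangoldt: "ln (fact n) = (\<Sum>d\<in>{1..n}. mangoldt d * real (n div d))"
proof -
  have "ln (fact n :: real) = (\<Sum>k\<in>{1..n}. ln (real k))"
  proof -
    have "(\<Sum>k\<in>{1..n}. ln (real k)) = ln (\<Prod>k\<in>{1..n}. real k)" by (intro ln_prod[symmetric]) auto
    then show ?thesis by (simp add: fact_prod)
  qed
  also have "\<dots> = (\<Sum>k\<in>{1..n}. \<Sum>d | d \<in> {1..n} \<and> d dvd k. mangoldt d)"
  proof (intro sum.cong refl)
    fix k assume k: "k \<in> {1..n}"
    have "{d. d \<in> {1..n} \<and> d dvd k} = {d. d dvd k}"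
      using k by (auto dest: dvd_imp_le intro: Suc_leI Nat.gr0I)
    then show "ln (real k) = (\<Sum>d | d \<in> {1..n} \<and> d dvd k. mangoldt d)"
      using k mangoldt_sum[of k, where 'a=real] by simp
  qed
  also have "\<dots> = (\<Sum>d\<in>{1..n}. \<Sum>k | k \<in> {1..n} \<and> d dvd k. mangoldt d)"
    by (rule sum.swap_restrict) auto
  also have "\<dots> = (\<Sum>d\<in>{1..n}. mangoldt d * real (n div d))"
  proof (intro sum.cong refl)
    fix d assume d: "d \<in> {1..n}"
    have "{k. k \<in> {1..n} \<and> d dvd k} = (\<lambda>j. j * d) ` {1..n div d}"
    proof (intro equalityI subsetI)
      fix k assume k: "k \<in> {k. k \<in> {1..n} \<and> d dvd k}"
      then have "k = k div d * d" "k div d \<le> n div d" by (auto intro: div_le_mono)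
      moreover have "1 \<le> k div d" using k d by (auto simp: Suc_le_eq div_greater_zero_iff dest: dvd_imp_le)
      ultimately show "k \<in> (\<lambda>j. j * d) ` {1..n div d}" by (intro image_eqI[of _ _ "k div d"]) auto
    next
      fix k assume "k \<in> (\<lambda>j. j * d) ` {1..n div d}"
      then obtain j where j: "k = j * d" "j \<in> {1..n div d}" by blast
      then show "k \<in> {k. k \<in> {1..n} \<and> d dvd k}" using progression_term_bounds[OF j(2)] by simp
    qed
    moreover have "inj_on (\<lambda>j. j * d) {1..n div d}" using d by (auto simp: inj_on_def)
    ultimately have "card {k. k \<in> {1..n} \<and> d dvd k} = n div d" by (simp add: card_image)
    then show "(\<Sum>k | k \<in> {1..n} \<and> d dvd k. mangoldt d) = mangoldt d * real (n div d)" by simp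
  qed
  finally show ?thesis .
qed

text \<open>
  Chebyshev's argument: the primes and prime powers between m and 2 m contribute with weight 1
  to the logarithm of the central binomial coefficient, and no weight is negative.
\<close>
lemma psi_double: "psi (2 * m) \<le> psi m + 2 * real m"
proof -
  have c: "(\<Sum>d\<in>{1..2*m}. mangoldt d * (real (2 * m div d) - 2 * real (m div d))) = ln (fact (2 * m)) - 2 * ln (fact m)"
  proof -
    have "(\<Sum>d\<in>{1..m}. mangoldt d * real (m div d)) = (\<Sum>d\<in>{1..2*m}. mangoldt d * real (m div d))"
      by (rule sum.mono_neutral_left) auto
    then show ?thesis unfolding ln_fact_mangoldt
      by (simp add: right_diff_distrib sum_subtractf sum_distrib_left mult.left_commute)
  qed
  have "psi (2 * m) - psi m = (\<Sum>d\<in>{m<..2*m}. mangoldt d)"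
  proof -
    have "{1..2*m} = {1..m} \<union> {m<..2*m}" by auto
    then have "psi (2 * m) = psi m + (\<Sum>d\<in>{m<..2*m}. mangoldt d)"
      unfolding psi_def by (simp only:) (subst sum.union_disjoint, auto)
    then show ?thesis by simp
  qed
  also have "\<dots> = (\<Sum>d\<in>{m<..2*m}. mangoldt d * (real (2 * m div d) - 2 * real (m div d)))"
  proof (intro sum.cong refl)
    fix d assume d: "d \<in> {m<..2*m}"
    have "2 * m div d = 1" using d by (intro div_nat_eqI) auto
    moreover have "m div d = 0" using d by simp
    ultimately show "mangoldt d = mangoldt d * (real (2 * m div d) - 2 * real (m div d))" by simp
  qed
  also have "\<dots> \<le> (\<Sum>d\<in>{1..2*m}. mangoldt d * (real (2 * m div d) - 2 * real (m div d)))"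
  proof (intro sum_mono2)
    fix d :: nat
    have "2 * (m div d) \<le> 2 * m div d"
      by (cases "d = 0") (auto simp: less_eq_div_iff_mult_less_eq mult.assoc)
    then have "0 \<le> real (2 * m div d) - 2 * real (m div d)" by linarith
    then show "0 \<le> mangoldt d * (real (2 * m div d) - 2 * real (m div d))" by (simp add: mangoldt_nonneg)
  qed auto
  also have "\<dots> = ln (real (2 * m choose m))"
  proof -
    have "real (2 * m choose m) = fact (2 * m) / (fact m * fact m)" by (subst binomial_fact) auto
    then show ?thesis unfolding c by (simp add: ln_div ln_mult)
  qed
  also have "\<dots> \<le> ln (2 ^ (2 * m))"
  proof -
    have "2 * m choose m \<le> 2 ^ (2 * m)" by (rule binomial_le_pow2)
    then have "real (2 * m choose m) \<le> 2 ^ (2 * m)" by (metis of_nat_le_iff of_nat_numeral of_nat_power)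
    moreover have "0 < real (2 * m choose m)" by simp
    ultimately show ?thesis by (simp del: of_nat_0_less_iff)
  qed
  also have "\<dots> = 2 * real m * ln 2" by (simp add: ln_realpow)
  also have "\<dots> \<le> 2 * real m * 1" by (intro mult_left_mono) (auto simp: ln_2_less_1 less_imp_le)
  finally show ?thesis by simp
qed

lemma psi_le: "psi n \<le> 4 * real n"
proof (induction n rule: less_induct)
  case (less n)
  define m where "m = n div 2"
  show ?case
  proof (cases "even n")
    case True
    then have n: "n = 2 * m" unfolding m_def by auto
    show ?thesis
    proof (cases "m = 0")
      case False
      then have "psi m \<le> 4 * real m" using less n by auto
      then show ?thesis using psi_double[of m] n by simp
    qed (auto simp: n psi_def)
  next
    case False
    then have n: "n = Suc (2 * m)" unfolding m_def by (simp add: odd_two_times_div_two_succ)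
    have "mangoldt n \<le> ln (real n)" using n by (intro mangoldt_le) auto
    also have "\<dots> \<le> real n - 1" using n by (intro ln_le_minus_one) auto
    finally have "mangoldt n \<le> 2 * real m" using n by simp
    moreover have "psi m \<le> 4 * real m" using less n by auto
    ultimately show ?thesis using psi_double[of m] n by (simp add: psi_Suc)
  qed
qed

lemma abs_psi_diff_le: "\<bar>psi n - real n\<bar> \<le> 5 * real n"
  using psi_le[of n] psi_nonneg[of n] by (auto simp: abs_if)

lemma abel_mangoldt:
  fixes s :: complex
  shows "(\<Sum>n<N. of_real (psi (Suc n) - real (Suc n)) * (of_nat (Suc n) powr (-s) - of_nat (Suc (Suc n)) powr (-s)))
    = (\<Sum>n<N. (mangoldt (Suc n) - 1) * of_nat (Suc n) powr (-s)) - of_real (psi N - real N) * of_nat (Suc N) powr (-s)"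
proof (induction N)
  case 0
  then show ?case by (simp add: psi_def)
next
  case (Suc N)
  show ?case unfolding sum.lessThan_Suc Suc.IH
    by (simp add: psi_Suc[of N] algebra_simps)
qed

text \<open>
  Partial summation turns the difference of the two series into the sum of
  (psi(n) - n) (n^(-s) - (n+1)^(-s)). The last factor is s n^(-s-1) up to the error zeta_term with s + 1
  in place of s.
\<close>
lemma psi_dirichlet_series:
  fixes s :: complex
  assumes s: "Re s > 1"
  shows "(\<lambda>n. of_real ((psi (Suc n) - real (Suc n)) / real (Suc n)) * of_nat (Suc n) powr (-s)) sums
    ((mangoldt_series s - zeta_series s + (\<Sum>n. of_real (psi (Suc n) - real (Suc n)) * zeta_term n (s + 1))) / s)"
proof -
  define A where "A n = complex_of_real (psi (Suc n) - real (Suc n))" for n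
  have s0: "s \<noteq> 0" using s by auto
  have nA: "norm (A n) \<le> 5 * real (Suc n) powr 1" for n
    unfolding A_def norm_of_real using abs_psi_diff_le[of "Suc n"] by simp
  have R: "(\<lambda>n. A n * zeta_term n (s + 1)) sums (\<Sum>n. A n * zeta_term n (s + 1))"
    using weighted_zeta_series(2)[OF nA, of "s + 1"] s by (intro summable_sums) auto
  have "(\<lambda>n. mangoldt (Suc n) * of_nat (Suc n) powr (-s)) sums mangoldt_series s"
    using mangoldt_series_sums[OF s] by (subst sums_Suc_iff) simp
  moreover have "(\<lambda>n. of_nat (Suc n) powr (-s) :: complex) sums zeta_series s"
  proof -
    have "(\<lambda>n. of_nat n powr (-s) :: complex) sums zeta_series s"
      unfolding zeta_series_def using summable_norm_cancel[OF summable_norm_nat_powr[OF s]] by (rule summable_sums)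
    then show ?thesis by (subst sums_Suc_iff) simp
  qed
  ultimately have "(\<lambda>n. mangoldt (Suc n) * of_nat (Suc n) powr (-s) - of_nat (Suc n) powr (-s)) sums (mangoldt_series s - zeta_series s)"
    by (rule sums_diff)
  then have 1: "(\<lambda>N. \<Sum>n<N. (mangoldt (Suc n) - 1) * of_nat (Suc n) powr (-s)) \<longlonglongrightarrow> mangoldt_series s - zeta_series s"
    unfolding sums_def by (simp add: left_diff_distrib)
  have 2: "(\<lambda>N. of_real (psi N - real N) * of_nat (Suc N) powr (-s)) \<longlonglongrightarrow> (0::complex)"
  proof (rule Lim_null_comparison)
    show "eventually (\<lambda>N. norm (of_real (psi N - real N) * of_nat (Suc N) powr (-s) :: complex) \<le> 5 * real (Suc N) powr (1 - Re s)) sequentially"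
    proof (intro always_eventually allI)
      fix N
      have "norm (of_real (psi N - real N) * of_nat (Suc N) powr (-s) :: complex) = \<bar>psi N - real N\<bar> * real (Suc N) powr (- Re s)"
        unfolding norm_mult norm_of_real norm_nat_powr[OF zero_less_Suc] by simp
      also have "\<dots> \<le> (5 * real (Suc N)) * real (Suc N) powr (- Re s)"
        using abs_psi_diff_le[of N] by (intro mult_right_mono) auto
      also have "\<dots> = 5 * real (Suc N) powr (1 - Re s)" by (simp add: powr_diff powr_minus divide_inverse)
      finally show "norm (of_real (psi N - real N) * of_nat (Suc N) powr (-s) :: complex) \<le> 5 * real (Suc N) powr (1 - Re s)" .
    qed
    show "(\<lambda>N. 5 * real (Suc N) powr (1 - Re s)) \<longlonglongrightarrow> 0" using s by real_asymp
  qed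
  have "(\<lambda>n. A n * (of_nat (Suc n) powr (-s) - of_nat (Suc (Suc n)) powr (-s))) sums (mangoldt_series s - zeta_series s)"
    unfolding sums_def A_def abel_mangoldt using tendsto_diff[OF 1 2] by simp
  from sums_divide[OF sums_add[OF this R], of s]
  have "(\<lambda>n. (A n * (of_nat (Suc n) powr (-s) - of_nat (Suc (Suc n)) powr (-s)) + A n * zeta_term n (s + 1)) / s) sums
    ((mangoldt_series s - zeta_series s + (\<Sum>n. A n * zeta_term n (s + 1))) / s)" .
  moreover have "(A n * (of_nat (Suc n) powr (-s) - of_nat (Suc (Suc n)) powr (-s)) + A n * zeta_term n (s + 1)) / s
      = of_real ((psi (Suc n) - real (Suc n)) / real (Suc n)) * of_nat (Suc n) powr (-s)" for n
  proof -
    have p: "of_nat (Suc n) powr (- (s + 1)) = of_nat (Suc n) powr (-s) / (of_nat (Suc n) :: complex)"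
    proof -
      have "- (s + 1) = - s - 1" by simp
      then show ?thesis by (simp add: powr_diff del: of_nat_Suc)
    qed
    have "A n * (of_nat (Suc n) powr (-s) - of_nat (Suc (Suc n)) powr (-s)) + A n * zeta_term n (s + 1)
       = A n * (s * (of_nat (Suc n) powr (-s) / of_nat (Suc n)))"
      unfolding zeta_term_def p by (simp add: algebra_simps del: of_nat_Suc)
    then show ?thesis using s0 unfolding A_def by (simp del: of_nat_Suc)
  qed
  ultimately show ?thesis unfolding A_def by simp
qed

text \<open>
  By the formula for the logarithmic derivative, the poles of the von Mangoldt series and of zeta
  at s = 1 cancel, and what remains is holomorphic at every point with Re s > 0 where pzeta is not zero.
\<close>
lemma summable_psi_diff: "summable (\<lambda>n. (psi (Suc n) - real (Suc n)) / real (Suc n) ^ 2)"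
proof -
  define A where "A n = complex_of_real (psi (Suc n) - real (Suc n))" for n
  define a where "a n = complex_of_real ((psi (Suc n) - real (Suc n)) / real (Suc n))" for n
  define R where "R s = (\<Sum>n. A n * zeta_term n (s + 1))" for s
  define P where "P s = (if s = 1 then deriv pzeta 1 else (pzeta s - pzeta 1) / (s - 1))" for s
  define F where "F s = (- (deriv pzeta s / pzeta s) - P s + R s) / s" for s
  define V where "V = {s. Re s > 0} \<inter> {s. Re s > 0 \<and> pzeta s \<noteq> 0}"
  have H: "open {s. Re s > 0}" by (rule open_halfspace_Re_gt)
  have nA: "norm (A n) \<le> 5 * real (Suc n) powr 1" for n
    unfolding A_def norm_of_real using abs_psi_diff_le[of "Suc n"] by simp
  have hR: "R holomorphic_on {s. Re s > 0}"
  proof -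
    have "(\<lambda>s. \<Sum>n. A n * zeta_term n s) \<circ> (\<lambda>s. s + 1) holomorphic_on {s. Re s > 0}"
      by (rule holomorphic_on_compose_gen[OF _ weighted_zeta_series(1)[OF nA]]) (auto intro!: holomorphic_intros)
    then show ?thesis unfolding R_def by (simp add: o_def)
  qed
  have hP: "P holomorphic_on {s. Re s > 0}"
    unfolding P_def using pole_lemma_open[OF pzeta_holomorphic H, of 1] by simp
  have opV: "open V"
  proof -
    have "continuous_on {s. Re s > 0} pzeta" using pzeta_holomorphic by (rule holomorphic_on_imp_continuous_on)
    then have "open ({s. Re s > 0} \<inter> pzeta -` (- {0}))"
      using H by (rule continuous_open_preimage) auto
    moreover have "{s. Re s > 0} \<inter> pzeta -` (- {0}) = V" unfolding V_def by auto
    ultimately show ?thesis by simp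
  qed
  have hF: "F holomorphic_on V"
  proof -
    have sub: "V \<subseteq> {s. Re s > 0}" unfolding V_def by auto
    have "pzeta holomorphic_on V" "deriv pzeta holomorphic_on V" "P holomorphic_on V" "R holomorphic_on V"
      using pzeta_holomorphic holomorphic_deriv[OF pzeta_holomorphic H] hP hR sub
      by (auto intro: holomorphic_on_subset)
    then show ?thesis unfolding F_def
      by (intro holomorphic_on_divide holomorphic_on_add holomorphic_on_diff holomorphic_on_minus holomorphic_on_ident)
        (auto simp: V_def)
  qed
  define U where "U = (\<lambda>z. 1 + z) -` V"
  have "(\<lambda>n. a n / of_nat (Suc n)) sums F (1 + 0)"
  proof (rule newman[where U=U and C=5 and f="\<lambda>z. F (1 + z)"])
    show "norm (a n) \<le> 5" for n
    proof -
      have "norm (a n) = \<bar>psi (Suc n) - real (Suc n)\<bar> / real (Suc n)"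
        unfolding a_def norm_of_real by (simp add: abs_divide del: of_nat_Suc)
      also have "\<dots> \<le> 5" using abs_psi_diff_le[of "Suc n"] by (simp add: divide_le_eq del: of_nat_Suc)
      finally show ?thesis .
    qed
    show "open U" unfolding U_def using opV by (rule open_vimage) (auto intro!: continuous_intros)
    show "{z. 0 \<le> Re z} \<subseteq> U" unfolding U_def V_def using pzeta_nonzero by auto
    have "F \<circ> (\<lambda>z. 1 + z) holomorphic_on U"
      by (rule holomorphic_on_compose_gen[OF _ hF]) (auto simp: U_def intro!: holomorphic_intros)
    then show "(\<lambda>z. F (1 + z)) holomorphic_on U" by (simp add: o_def)
    fix z :: complex assume z: "Re z > 0"
    define s where "s = 1 + z"
    have s: "Re s > 1" "s \<noteq> 1" using z unfolding s_def by auto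
    have pn: "pzeta s \<noteq> 0" using s by (intro pzeta_nonzero) auto
    have "mangoldt_series s = 1 / (s - 1) - deriv pzeta s / pzeta s"
      using mangoldt_series_pzeta[OF s(1)] pn by (simp add: field_simps)
    moreover have "zeta_series s = pzeta s / (s - 1)" using pzeta_eq[OF s(1)] s(2) by simp
    ultimately have "mangoldt_series s - zeta_series s = - (deriv pzeta s / pzeta s) - P s"
      unfolding P_def using s(2) by (simp add: pzeta_1 diff_divide_distrib)
    then have "F s = (mangoldt_series s - zeta_series s + R s) / s" unfolding F_def by simp
    then have "(\<lambda>n. a n * of_nat (Suc n) powr (-s)) sums F s"
      using psi_dirichlet_series[OF s(1)] unfolding a_def R_def A_def by simp
    then show "(\<lambda>n. a n * of_nat (Suc n) powr (- 1 - z)) sums F (1 + z)" unfolding s_def by simp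
  qed
  then have "summable (\<lambda>n. Re (a n / of_nat (Suc n)))"
    by (intro summable_Re) (auto simp: sums_iff)
  moreover have "Re (a n / of_nat (Suc n)) = (psi (Suc n) - real (Suc n)) / real (Suc n) ^ 2" for n
  proof -
    have "a n / of_nat (Suc n) = of_real ((psi (Suc n) - real (Suc n)) / real (Suc n) / real (Suc n))"
      unfolding a_def by simp
    then show ?thesis by (simp only: Re_complex_of_real power2_eq_square divide_divide_eq_left)
  qed
  ultimately show ?thesis by simp
qed

section \<open>The prime number theorem\<close>

text \<open>
  If psi N exceeded (1 + \<epsilon>) N, then by monotonicity psi k - k would be of order \<epsilon> N for all k
  in an interval of length \<epsilon> N / 2 to the right of N, and the terms of the convergent series would add up
  to a fixed amount there. For psi N below (1 - \<epsilon>) N the interval to the left of N is used.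
\<close>
lemma psi_asymptotic: "(\<lambda>n. psi n / real n) \<longlonglongrightarrow> 1"
proof -
  define t where "t k = (psi k - real k) / real k ^ 2" for k
  have "summable (\<lambda>n. t (Suc n))" using summable_psi_diff unfolding t_def .
  then have sm: "summable t" by (subst (asm) summable_Suc_iff)
  have block: "\<exists>N0. \<forall>m n. N0 \<le> m \<longrightarrow> \<bar>sum t {m..n}\<bar> < \<eta>" if \<eta>: "\<eta> > 0" for \<eta> :: real
  proof -
    obtain N0 where N0: "\<And>m n. m \<ge> N0 \<Longrightarrow> norm (sum t {m..<n}) < \<eta>"
      using sm \<eta> unfolding summable_Cauchy by blast
    have "\<bar>sum t {m..n}\<bar> < \<eta>" if "N0 \<le> m" for m n
      using N0[OF that, of "Suc n"] by (simp add: atLeastLessThanSuc_atLeastAtMost)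
    then show ?thesis by blast
  qed
  show ?thesis
  proof (rule LIMSEQ_I)
    fix \<epsilon>' :: real assume "\<epsilon>' > 0"
    define \<epsilon> where "\<epsilon> = min \<epsilon>' (1/2) / 2"
    have \<epsilon>: "0 < \<epsilon>" "\<epsilon> < 1 / 2" "\<epsilon> < \<epsilon>'" using \<open>\<epsilon>' > 0\<close> unfolding \<epsilon>_def by (auto simp: min_def)
    \<comment> \<open>An interval of \<epsilon> N / 2 terms of size \<epsilon> / (8 N) contributes this amount.\<close>
    define \<eta> where "\<eta> = \<epsilon>\<^sup>2 / 16"
    have \<eta>: "\<eta> > 0" unfolding \<eta>_def using \<epsilon> by simp
    obtain N0 where N0: "\<And>m n. N0 \<le> m \<Longrightarrow> \<bar>sum t {m..n}\<bar> < \<eta>" using block[OF \<eta>] by blast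
    have "\<bar>psi N / real N - 1\<bar> < \<epsilon>'" if N: "N \<ge> 2 * N0 + 1" for N
    proof -
      have Npos: "real N > 0" using N by simp
      define h where "h = nat \<lfloor>\<epsilon> * real N / 2\<rfloor>"
      have h: "real h \<le> \<epsilon> * real N / 2" "\<epsilon> * real N / 2 < real h + 1"
      proof -
        have "0 \<le> \<epsilon> * real N / 2" using \<epsilon> Npos by simp
        then show "real h \<le> \<epsilon> * real N / 2" unfolding h_def by (rule of_nat_floor)
        show "\<epsilon> * real N / 2 < real h + 1" unfolding h_def by linarith
      qed
      have hN: "real h \<le> real N / 2"
      proof -
        have "\<epsilon> * real N \<le> 1 * real N" using \<epsilon> by (intro mult_right_mono) auto
        then show ?thesis using h(1) by simp
      qed
      have "psi N < (1 + \<epsilon>) * real N"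
      proof (rule ccontr)
        assume "\<not> ?thesis"
        then have big: "(1 + \<epsilon>) * real N \<le> psi N" by simp
        have "\<epsilon> / (8 * real N) \<le> t k" if k: "k \<in> {N..N + h}" for k
        proof -
          have "real k \<le> real N + \<epsilon> * real N / 2" using k h(1) by simp
          moreover have "psi N \<le> psi k" using k by (intro psi_mono) auto
          ultimately have num: "\<epsilon> * real N / 2 \<le> psi k - real k" using big by (simp add: algebra_simps)
          have "real k \<le> 2 * real N" using k hN by simp
          then have "real k ^ 2 \<le> (2 * real N) ^ 2" by (intro power_mono) auto
          then have den: "real k ^ 2 \<le> 4 * real N ^ 2" by (simp add: power_mult_distrib)
          have kpos: "0 < real k ^ 2" using k Npos by auto
          have "\<epsilon> / (8 * real N) = (\<epsilon> * real N / 2) / (4 * real N ^ 2)" using Npos by (simp add: power2_eq_square)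
          also have "\<dots> \<le> (\<epsilon> * real N / 2) / real k ^ 2"
            using den kpos \<epsilon> Npos by (intro divide_left_mono mult_pos_pos) auto
          also have "\<dots> \<le> t k" unfolding t_def using num by (intro divide_right_mono) auto
          finally show ?thesis .
        qed
        then have "(\<Sum>k\<in>{N..N + h}. \<epsilon> / (8 * real N)) \<le> sum t {N..N + h}" by (rule sum_mono)
        moreover have "\<eta> \<le> (\<Sum>k\<in>{N..N + h}. \<epsilon> / (8 * real N))"
        proof -
          have "\<epsilon> * real N / 2 * (\<epsilon> / (8 * real N)) \<le> (real h + 1) * (\<epsilon> / (8 * real N))"
            using h(2) \<epsilon> Npos by (intro mult_right_mono) auto
          moreover have "\<epsilon> * real N / 2 * (\<epsilon> / (8 * real N)) = \<eta>"
            unfolding \<eta>_def using Npos by (simp add: power2_eq_square)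
          ultimately show ?thesis by (simp add: add.commute)
        qed
        moreover have "\<bar>sum t {N..N + h}\<bar> < \<eta>" using N by (intro N0) auto
        ultimately show False by linarith
      qed
      moreover have "(1 - \<epsilon>) * real N < psi N"
      proof (rule ccontr)
        assume "\<not> ?thesis"
        then have small: "psi N \<le> (1 - \<epsilon>) * real N" by simp
        have hN': "h \<le> N" using hN Npos by linarith
        have t: "t k \<le> - (\<epsilon> / (2 * real N))" if k: "k \<in> {N - h..N}" for k
        proof -
          have "real k \<ge> real N - \<epsilon> * real N / 2" using k h(1) hN' by auto
          moreover have "psi k \<le> psi N" using k by (intro psi_mono) auto
          ultimately have num: "\<epsilon> * real N / 2 \<le> real k - psi k" using small by (simp add: algebra_simps)
          have "real k ^ 2 \<le> real N ^ 2" using k by (intro power_mono) auto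
          moreover have "real k \<ge> real N / 2" using k hN hN' by auto
          then have kpos: "0 < real k ^ 2" using Npos by auto
          have "\<epsilon> / (2 * real N) = (\<epsilon> * real N / 2) / (real N ^ 2)" using Npos by (simp add: power2_eq_square)
          also have "\<dots> \<le> (\<epsilon> * real N / 2) / real k ^ 2"
            using \<open>real k ^ 2 \<le> real N ^ 2\<close> kpos \<epsilon> Npos by (intro divide_left_mono mult_pos_pos) auto
          also have "\<dots> \<le> (real k - psi k) / real k ^ 2" using num by (intro divide_right_mono) auto
          also have "\<dots> = - t k" unfolding t_def by (simp add: minus_divide_left)
          finally show ?thesis by simp
        qed
        then have "sum t {N - h..N} \<le> (\<Sum>k\<in>{N - h..N}. - (\<epsilon> / (2 * real N)))" by (rule sum_mono)
        moreover have "\<eta> \<le> (\<Sum>k\<in>{N - h..N}. \<epsilon> / (2 * real N))"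
        proof -
          have "\<epsilon> * real N / 2 * (\<epsilon> / (2 * real N)) \<le> (real h + 1) * (\<epsilon> / (2 * real N))"
            using h(2) \<epsilon> Npos by (intro mult_right_mono) auto
          moreover have "\<epsilon> * real N / 2 * (\<epsilon> / (2 * real N)) = 4 * \<eta>"
            unfolding \<eta>_def using Npos by (simp add: power2_eq_square)
          moreover have "real (card {N - h..N}) = real h + 1" using hN' by (simp add: Suc_diff_le)
          ultimately show ?thesis using \<eta> by (simp add: add.commute)
        qed
        moreover have "\<bar>sum t {N - h..N}\<bar> < \<eta>"
        proof (intro N0)
          have "real N0 \<le> real (N - h)" using N hN hN' by (simp add: of_nat_diff)
          then show "N0 \<le> N - h" by simp
        qed
        ultimately show False by (simp add: sum_negf)
      qed
      ultimately have "1 - \<epsilon> < psi N / real N" "psi N / real N < 1 + \<epsilon>"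
        using Npos by (simp_all add: field_simps)
      then show ?thesis using \<epsilon> by (simp add: abs_less_iff)
    qed
    then show "\<exists>no. \<forall>n\<ge>no. norm (psi n / real n - 1) < \<epsilon>'" by (metis real_norm_def)
  qed
qed

definition prime_count :: "nat \<Rightarrow> nat" where
  "prime_count n = card {p. prime p \<and> p \<le> n}"

lemma finite_primes_le: "finite {p::nat. prime p \<and> p \<le> n}"
  by (rule finite_subset[of _ "{..n}"]) auto

text \<open>
  Each prime p contributes ln p for every power of p up to n, in total at most ln n.
\<close>
lemma psi_le_prime_count: "psi n \<le> real (prime_count n) * ln n"
proof (cases "n = 0")
  case False
  define K where "K = {k \<in> {1..n}. primepow k}"
  have "psi n = (\<Sum>k\<in>K. ln (real (aprimedivisor k)))"
    unfolding psi_def K_def by (intro sum.mono_neutral_cong_right) (auto simp: mangoldt_def)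
  also have "\<dots> = (\<Sum>p | prime p \<and> p \<le> n. \<Sum>k | k \<in> K \<and> aprimedivisor k = p. ln (real (aprimedivisor k)))"
  proof (rule sum.group[symmetric])
    show "aprimedivisor ` K \<subseteq> {p. prime p \<and> p \<le> n}"
    proof
      fix q assume "q \<in> aprimedivisor ` K"
      then obtain k where k: "q = aprimedivisor k" "k \<in> K" by auto
      then have "k > Suc 0" "k \<le> n" unfolding K_def by (auto intro: primepow_gt_Suc_0)
      then show "q \<in> {p. prime p \<and> p \<le> n}"
        using k aprimedivisor_nat[of k] aprimedivisor_le_nat[of k] by auto
    qed
  qed (auto simp: K_def finite_primes_le)
  also have "\<dots> \<le> (\<Sum>p | prime p \<and> p \<le> n. ln (real n))"
  proof (rule sum_mono)
    fix p assume "p \<in> {p. prime p \<and> p \<le> n}"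
    then have p: "prime p" "p \<le> n" by auto
    have lp: "ln (real p) > 0" using prime_gt_1_nat[OF p(1)] by simp
    define J where "J = nat \<lfloor>ln (real n) / ln (real p)\<rfloor>"
    have "{k \<in> K. aprimedivisor k = p} \<subseteq> (\<lambda>j. p ^ j) ` {1..J}"
    proof
      fix k assume "k \<in> {k \<in> K. aprimedivisor k = p}"
      then have k: "primepow k" "aprimedivisor k = p" "k \<le> n" unfolding K_def by auto
      then obtain j q where j: "prime q" "j > 0" "k = q ^ j" unfolding primepow_def by auto
      then have "q = p" using k aprimedivisor_prime_power[of q j] by auto
      then have "p ^ j \<le> n" using j k by simp
      then have "real p ^ j \<le> real n" by (metis of_nat_le_iff of_nat_power)
      then have "ln (real p ^ j) \<le> ln (real n)" using p prime_gt_0_nat[OF p(1)] by (subst ln_le_cancel_iff) auto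
      then have "real j \<le> ln (real n) / ln (real p)"
        using lp prime_gt_0_nat[OF p(1)] by (simp add: ln_realpow field_simps)
      then have "j \<le> J" unfolding J_def by (rule le_nat_floor)
      then show "k \<in> (\<lambda>j. p ^ j) ` {1..J}" using j \<open>q = p\<close> by auto
    qed
    then have "card {k \<in> K. aprimedivisor k = p} \<le> card {1..J}"
      by (meson card_image_le card_mono finite_atLeastAtMost finite_imageI order_trans)
    then have "real (card {k \<in> K. aprimedivisor k = p}) \<le> real J" by simp
    also have "\<dots> \<le> ln (real n) / ln (real p)"
      unfolding J_def using lp False by (intro of_nat_floor) (simp add: ln_ge_zero)
    finally have "real (card {k \<in> K. aprimedivisor k = p}) * ln (real p) \<le> ln (real n)"
      using lp by (simp add: field_simps)
    then show "(\<Sum>k | k \<in> K \<and> aprimedivisor k = p. ln (real (aprimedivisor k))) \<le> ln (real n)" by simp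
  qed
  finally show ?thesis unfolding prime_count_def by simp
qed (simp add: psi_def)

text \<open>
  All primes above n^(1 - \<delta>) contribute at least (1 - \<delta>) ln n to psi n.
\<close>
lemma prime_count_le_psi:
  fixes \<delta> :: real
  assumes \<delta>: "0 < \<delta>" "\<delta> < 1" and n: "n \<ge> 2"
  shows "real (prime_count n) \<le> real n powr (1 - \<delta>) + psi n / ((1 - \<delta>) * ln n)"
proof -
  define y where "y = real n powr (1 - \<delta>)"
  define A where "A = {p. prime p \<and> p \<le> n \<and> y < real p}"
  have fA: "finite A" unfolding A_def by (rule finite_subset[OF _ finite_primes_le[of n]]) auto
  have "{p. prime p \<and> p \<le> n} \<subseteq> A \<union> {1..nat \<lfloor>y\<rfloor>}"
  proof
    fix p assume p: "p \<in> {p. prime p \<and> p \<le> n}"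
    show "p \<in> A \<union> {1..nat \<lfloor>y\<rfloor>}"
      using p prime_gt_0_nat[of p] by (cases "y < real p") (auto simp: A_def intro: le_nat_floor)
  qed
  then have "prime_count n \<le> card (A \<union> {1..nat \<lfloor>y\<rfloor>})"
    unfolding prime_count_def using fA by (intro card_mono) auto
  also have "\<dots> \<le> card A + nat \<lfloor>y\<rfloor>" using card_Un_le[of A "{1..nat \<lfloor>y\<rfloor>}"] by simp
  finally have "real (prime_count n) \<le> real (card A) + real (nat \<lfloor>y\<rfloor>)" by linarith
  also have "real (nat \<lfloor>y\<rfloor>) \<le> y" unfolding y_def by (intro of_nat_floor) auto
  finally have 1: "real (prime_count n) \<le> real (card A) + y" by simp
  have "real (card A) * ((1 - \<delta>) * ln n) = (\<Sum>p\<in>A. (1 - \<delta>) * ln n)" by simp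
  also have "\<dots> \<le> (\<Sum>p\<in>A. mangoldt p)"
  proof (rule sum_mono)
    fix p assume p: "p \<in> A"
    have "(1 - \<delta>) * ln n = ln y" unfolding y_def using n by (simp add: ln_powr)
    also have "\<dots> \<le> ln (real p)" using p n unfolding A_def y_def by (subst ln_le_cancel_iff) (auto intro: prime_gt_0_nat)
    also have "\<dots> = mangoldt p" using p unfolding A_def by simp
    finally show "(1 - \<delta>) * ln n \<le> mangoldt p" .
  qed
  also have "\<dots> \<le> psi n"
    unfolding psi_def A_def
    by (intro sum_mono2) (auto simp: mangoldt_nonneg Suc_le_eq intro: prime_gt_0_nat)
  finally have "real (card A) \<le> psi n / ((1 - \<delta>) * ln n)"
    using \<delta> n by (simp add: field_simps)
  then show ?thesis using 1 unfolding y_def by simp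
qed

theorem prime_number_theorem: "(\<lambda>n. real (prime_count n) * ln n / real n) \<longlonglongrightarrow> 1"
proof (rule LIMSEQ_I)
  fix \<epsilon> :: real assume \<epsilon>: "\<epsilon> > 0"
  \<comment> \<open>The upper bound has the limit 1 / (1 - \<delta>), which must be less than 1 + \<epsilon>.\<close>
  define \<delta> where "\<delta> = min (\<epsilon> / (2 + 2 * \<epsilon>)) (1 / 2)"
  have \<delta>: "0 < \<delta>" "\<delta> < 1" "1 / (1 - \<delta>) < 1 + \<epsilon>"
  proof -
    show "0 < \<delta>" "\<delta> < 1" unfolding \<delta>_def using \<epsilon> by auto
    have "\<delta> \<le> \<epsilon> / (2 + 2 * \<epsilon>)" unfolding \<delta>_def by simp
    also have "\<dots> < \<epsilon> / (1 + \<epsilon>)" using \<epsilon> by (intro divide_strict_left_mono) auto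
    finally have "\<delta> * (1 + \<epsilon>) < \<epsilon>" using \<epsilon> by (simp add: field_simps)
    then show "1 / (1 - \<delta>) < 1 + \<epsilon>" using \<open>\<delta> < 1\<close> by (simp add: field_simps)
  qed
  have "(\<lambda>n. real n powr (-\<delta>) * ln n + psi n / real n * (1 / (1 - \<delta>))) \<longlonglongrightarrow> 0 + 1 * (1 / (1 - \<delta>))"
  proof (intro tendsto_add tendsto_mult psi_asymptotic tendsto_const)
    show "(\<lambda>n. real n powr (-\<delta>) * ln (real n)) \<longlonglongrightarrow> 0" using \<delta> by real_asymp
  qed
  then have up: "eventually (\<lambda>n. real n powr (-\<delta>) * ln n + psi n / real n * (1 / (1 - \<delta>)) < 1 + \<epsilon>) sequentially"
    using \<delta>(3) by (intro order_tendstoD) auto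
  have lo: "eventually (\<lambda>n. 1 - \<epsilon> < psi n / real n) sequentially"
    using psi_asymptotic \<epsilon> by (intro order_tendstoD) auto
  have "eventually (\<lambda>n. norm (real (prime_count n) * ln n / real n - 1) < \<epsilon>) sequentially"
    using up lo eventually_ge_at_top[of 2]
  proof eventually_elim
    case (elim n)
    have n: "real n > 0" "ln (real n) > 0" using elim by auto
    have "psi n / real n \<le> real (prime_count n) * ln n / real n"
      using psi_le_prime_count[of n] n by (intro divide_right_mono) auto
    then have 1: "1 - \<epsilon> < real (prime_count n) * ln n / real n" using elim by simp
    have "real (prime_count n) * ln n / real n \<le> (real n powr (1 - \<delta>) + psi n / ((1 - \<delta>) * ln n)) * ln n / real n"
      using prime_count_le_psi[OF \<delta>(1,2)] elim n by (intro divide_right_mono mult_right_mono) auto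
    also have "\<dots> = real n powr (-\<delta>) * ln n + psi n / real n * (1 / (1 - \<delta>))"
    proof -
      have "real n powr (1 - \<delta>) = real n * real n powr (-\<delta>)" using n by (simp add: powr_diff powr_minus divide_inverse)
      then show ?thesis using n \<delta> by (simp add: field_simps)
    qed
    finally show ?case using 1 elim by (simp add: abs_less_iff)
  qed
  then show "\<exists>no. \<forall>n\<ge>no. norm (real (prime_count n) * ln n / real n - 1) < \<epsilon>"
    by (simp add: eventually_sequentially)
qed

section \<open>The main term and the upper bound\<close>

lemma stolz_cesaro:
  fixes x y :: "nat \<Rightarrow> real"
  assumes y: "eventually (\<lambda>n. y n < y (Suc n)) sequentially" "filterlim y at_top sequentially"
    and L: "(\<lambda>n. (x (Suc n) - x n) / (y (Suc n) - y n)) \<longlonglongrightarrow> L"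
  shows "(\<lambda>n. x n / y n) \<longlonglongrightarrow> L"
proof (rule LIMSEQ_I)
  fix \<epsilon> :: real assume \<epsilon>: "\<epsilon> > 0"
  have "eventually (\<lambda>n. \<bar>(x (Suc n) - x n) / (y (Suc n) - y n) - L\<bar> < \<epsilon> / 2) sequentially"
    using tendstoD[OF L, of "\<epsilon> / 2"] \<epsilon> by (simp add: dist_real_def)
  from eventually_conj[OF this y(1)] obtain N where
    N: "\<And>n. n \<ge> N \<Longrightarrow> \<bar>(x (Suc n) - x n) / (y (Suc n) - y n) - L\<bar> < \<epsilon> / 2 \<and> y n < y (Suc n)"
    unfolding eventually_sequentially by blast
  have incr: "\<bar>(x (Suc n) - L * y (Suc n)) - (x n - L * y n)\<bar> \<le> \<epsilon> / 2 * (y (Suc n) - y n)" if "n \<ge> N" for n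
  proof -
    have pos: "y (Suc n) - y n > 0" using N[OF that] by simp
    have "(x (Suc n) - L * y (Suc n)) - (x n - L * y n) = ((x (Suc n) - x n) / (y (Suc n) - y n) - L) * (y (Suc n) - y n)"
      using pos by (simp add: field_simps)
    then have "\<bar>(x (Suc n) - L * y (Suc n)) - (x n - L * y n)\<bar> = \<bar>(x (Suc n) - x n) / (y (Suc n) - y n) - L\<bar> * (y (Suc n) - y n)"
      using pos by (simp add: abs_mult)
    also have "\<dots> \<le> \<epsilon> / 2 * (y (Suc n) - y n)" using N[OF that] pos by (intro mult_right_mono) auto
    finally show ?thesis .
  qed
  have tot: "\<bar>(x n - L * y n) - (x N - L * y N)\<bar> \<le> \<epsilon> / 2 * (y n - y N)" if "n \<ge> N" for n
    using that
  proof (induction n rule: dec_induct)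
    case (step n)
    have "\<epsilon> / 2 * (y (Suc n) - y N) = \<epsilon> / 2 * (y n - y N) + \<epsilon> / 2 * (y (Suc n) - y n)"
      unfolding distrib_left[symmetric] by simp
    then show ?case using step.IH incr[OF step.hyps(1)] by linarith
  qed simp
  define B where "B = \<bar>x N - L * y N\<bar> + \<epsilon> / 2 * \<bar>y N\<bar>"
  have "eventually (\<lambda>n. y n > max 0 (2 * B / \<epsilon>)) sequentially"
    using y(2) unfolding filterlim_at_top_dense by blast
  then have "eventually (\<lambda>n. norm (x n / y n - L) < \<epsilon>) sequentially"
    using eventually_ge_at_top[of N]
  proof eventually_elim
    case (elim n)
    have yn: "y n > 0" "2 * B / \<epsilon> < y n" using elim by auto
    have "\<epsilon> / 2 * (y n - y N) \<le> \<epsilon> / 2 * y n + \<epsilon> / 2 * \<bar>y N\<bar>"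
      using \<epsilon> by (simp add: algebra_simps) (smt (verit) mult_left_mono mult_minus_right)
    then have "\<bar>x n - L * y n\<bar> \<le> \<epsilon> / 2 * y n + B"
      using tot[of n] elim unfolding B_def by linarith
    also have "B < \<epsilon> / 2 * y n" using yn \<epsilon> by (simp add: field_simps)
    finally have "\<bar>x n - L * y n\<bar> < \<epsilon> * y n" by (simp add: field_simps)
    moreover have "x n / y n - L = (x n - L * y n) / y n" using yn by (simp add: field_simps)
    ultimately show ?case using yn by (simp add: abs_divide field_simps)
  qed
  then show "\<exists>no. \<forall>n\<ge>no. norm (x n / y n - L) < \<epsilon>" by (simp add: eventually_sequentially)
qed

definition prime_square_sum :: "nat \<Rightarrow> real" where
  "prime_square_sum n = (\<Sum>p | prime p \<and> p \<le> n. real p ^ 2)"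

lemma primes_le_Suc:
  "{p. prime p \<and> p \<le> Suc n} = (if prime (Suc n) then insert (Suc n) {p. prime p \<and> p \<le> n} else {p. prime p \<and> p \<le> n})"
  by (auto simp: le_Suc_eq)

lemma prime_square_sum_abel:
  "prime_square_sum n = real n ^ 2 * real (prime_count n) - (\<Sum>j<n. (2 * real j + 1) * real (prime_count j))"
proof (induction n)
  case 0
  have "{p::nat. prime p \<and> p \<le> 0} = {}" using prime_gt_0_nat by auto
  then show ?case by (simp add: prime_square_sum_def)
next
  case (Suc n)
  have "prime_square_sum (Suc n) = prime_square_sum n + (if prime (Suc n) then real (Suc n) ^ 2 else 0)"
    unfolding prime_square_sum_def primes_le_Suc by (auto simp: finite_primes_le)
  moreover have "real (prime_count (Suc n)) = real (prime_count n) + (if prime (Suc n) then 1 else 0)"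
    unfolding prime_count_def primes_le_Suc by (auto simp: finite_primes_le)
  ultimately show ?case using Suc by (auto simp: algebra_simps power2_eq_square)
qed

text \<open>
  After partial summation the sum of (2 j + 1) \<pi>(j) remains. Its terms are asymptotic to
  the increments of 2/3 n^3 / ln n.
\<close>
lemma prime_square_sum_asymptotic: "(\<lambda>n. prime_square_sum n * ln n / real n ^ 3) \<longlonglongrightarrow> 1 / 3"
proof -
  define x where "x n = (\<Sum>j<n. (2 * real j + 1) * real (prime_count j))" for n
  define y where "y n = real n ^ 3 / ln (real n)" for n
  have "(\<lambda>n. x n / y n) \<longlonglongrightarrow> 2 / 3"
  proof (rule stolz_cesaro)
    show "eventually (\<lambda>n. y n < y (Suc n)) sequentially" unfolding y_def by real_asymp
    show "filterlim y at_top sequentially" unfolding y_def by real_asymp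
    have "(\<lambda>n. real (prime_count n) * ln n / real n * ((2 * real n + 1) * (real n / ln (real n)) / (y (Suc n) - y n))) \<longlonglongrightarrow> 1 * (2 / 3)"
    proof (intro tendsto_mult prime_number_theorem)
      show "(\<lambda>n. (2 * real n + 1) * (real n / ln (real n)) / (y (Suc n) - y n)) \<longlonglongrightarrow> 2 / 3"
        unfolding y_def by real_asymp
    qed
    then have "(\<lambda>n. real (prime_count n) * ln n / real n * ((2 * real n + 1) * (real n / ln (real n)) / (y (Suc n) - y n))) \<longlonglongrightarrow> 2 / 3"
      by simp
    then show "(\<lambda>n. (x (Suc n) - x n) / (y (Suc n) - y n)) \<longlonglongrightarrow> 2 / 3"
    proof (rule Lim_transform_eventually)
      show "eventually (\<lambda>n. real (prime_count n) * ln n / real n * ((2 * real n + 1) * (real n / ln (real n)) / (y (Suc n) - y n))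
          = (x (Suc n) - x n) / (y (Suc n) - y n)) sequentially"
        using eventually_gt_at_top[of 1]
      proof eventually_elim
        case (elim n)
        then show ?case unfolding x_def by simp
      qed
    qed
  qed
  from tendsto_diff[OF prime_number_theorem this]
  have "(\<lambda>n. real (prime_count n) * ln n / real n - x n / y n) \<longlonglongrightarrow> 1 / 3" by simp
  then show ?thesis
  proof (rule Lim_transform_eventually)
    show "eventually (\<lambda>n. real (prime_count n) * ln n / real n - x n / y n = prime_square_sum n * ln n / real n ^ 3) sequentially"
      using eventually_gt_at_top[of 1]
    proof eventually_elim
      case (elim n)
      have "ln (real n) > 0" using elim by simp
      then show ?case unfolding prime_square_sum_abel x_def[symmetric] y_def using elim
        by (simp add: field_simps power2_eq_square power3_eq_cube)
    qed
  qed
qed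

definition main_term :: "nat \<Rightarrow> nat \<Rightarrow> real" where
  "main_term n k = (\<Sum>p | prime p \<and> p \<le> k. real n - real p ^ 2)"

lemma main_term_eq: "main_term n k = real n * real (prime_count k) - prime_square_sum k"
  unfolding main_term_def prime_count_def prime_square_sum_def by (simp add: sum_subtractf)

text \<open>
  Only the ratio k^2 / n enters besides k, and it is at most 1; this makes the estimate
  uniform in n.
\<close>
lemma main_term_estimate:
  assumes \<epsilon>: "\<epsilon> > 0"
  shows "\<exists>k0. \<forall>k\<ge>k0. \<forall>n. k * k \<le> n \<longrightarrow>
    \<bar>main_term n k * (ln k / (real k * real n)) - (1 - real k ^ 2 / (3 * real n))\<bar> \<le> \<epsilon>"
proof -
  have "eventually (\<lambda>k. \<bar>real (prime_count k) * ln k / real k - 1\<bar> < \<epsilon> / 2) sequentially"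
    using tendstoD[OF prime_number_theorem, of "\<epsilon> / 2"] \<epsilon> by (simp add: dist_real_def)
  moreover have "eventually (\<lambda>k. \<bar>prime_square_sum k * ln k / real k ^ 3 - 1 / 3\<bar> < \<epsilon> / 2) sequentially"
    using tendstoD[OF prime_square_sum_asymptotic, of "\<epsilon> / 2"] \<epsilon> by (simp add: dist_real_def)
  ultimately have "eventually (\<lambda>k. \<forall>n. k * k \<le> n \<longrightarrow>
    \<bar>main_term n k * (ln k / (real k * real n)) - (1 - real k ^ 2 / (3 * real n))\<bar> \<le> \<epsilon>) sequentially"
    using eventually_gt_at_top[of 1]
  proof eventually_elim
    case (elim k)
    show ?case
    proof (intro allI impI)
      fix n assume kn: "k * k \<le> n"
      define A where "A = real (prime_count k) * ln k / real k"
      define B where "B = prime_square_sum k * ln k / real k ^ 3"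
      define q where "q = real k ^ 2 / real n"
      have k: "real k > 0" using elim by simp
      have "k * k > 0" using elim by simp
      then have n: "real n > 0" using kn by linarith
      have "real (k * k) \<le> real n" using kn by linarith
      then have q: "0 \<le> q" "q \<le> 1" unfolding q_def using n by (auto simp: power2_eq_square)
      have "main_term n k * (ln k / (real k * real n)) = A - q * B"
        unfolding main_term_eq A_def B_def q_def using k n by (simp add: field_simps power2_eq_square power3_eq_cube)
      moreover have "real k ^ 2 / (3 * real n) = q * (1 / 3)" unfolding q_def by simp
      ultimately have "main_term n k * (ln k / (real k * real n)) - (1 - real k ^ 2 / (3 * real n)) = (A - 1) - q * (B - 1 / 3)"
        by (simp add: algebra_simps)
      moreover have "\<bar>q * (B - 1 / 3)\<bar> \<le> 1 * (\<epsilon> / 2)"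
        unfolding abs_mult using q elim by (intro mult_mono) (auto simp: B_def)
      moreover have "\<bar>A - 1\<bar> < \<epsilon> / 2" using elim unfolding A_def by simp
      ultimately show "\<bar>main_term n k * (ln k / (real k * real n)) - (1 - real k ^ 2 / (3 * real n))\<bar> \<le> \<epsilon>" by linarith
    qed
  qed
  then show ?thesis by (simp add: eventually_sequentially)
qed

lemma le_sqrt_iff: "real p \<le> sqrt (real n) \<longleftrightarrow> p \<le> nat \<lfloor>sqrt (real n)\<rfloor>"
  by (simp add: le_nat_iff le_floor_iff)

text \<open>
  The families to which both bounds apply with the same main term. They comprise all d \<le> k, the
  primes up to k, and, for k the integral part of sqrt n, all d \<le> n.
\<close>
definition admissible :: "nat \<Rightarrow> nat \<Rightarrow> nat set \<Rightarrow> bool" where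
  "admissible n k D \<longleftrightarrow> real k \<le> sqrt n \<and> {p. prime p \<and> p \<le> k} \<subseteq> D \<and> D \<subseteq> {1..n} \<and>
    (\<forall>d\<in>D. (\<exists>q. prime q \<and> q dvd d \<and> sqrt n < real q) \<or> (\<forall>q. prime q \<longrightarrow> q dvd d \<longrightarrow> q \<le> k))"

text \<open>
  The parameters of the packing lemmas are X = n^(1/2 + \<eta>), Z = n^(1/2 - \<eta>), H = n^\<eta> and
  a = n^(2 \<eta>). The product of the differences in a cluster is at most H^(m^2), and \<eta> is chosen so
  that the resulting error n^(1 + 2 \<eta> + m^2 \<eta>) equals n^(3/2 - \<eta>).
\<close>
lemma packing_number_upper_bound:
  fixes m :: nat and \<eta> :: real
  assumes m: "m \<ge> 2" and \<eta>: "\<eta> = 1 / (2 * (real m ^ 2 + 3))" and adm: "admissible n k D"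
    and n: "n \<ge> 2" "4 \<le> real n powr (1 / 2 - 5 * \<eta>)"
  shows "real (packing_number D n) \<le> main_term n k
    + real n powr (3 / 2 - \<eta>) * (24 + 4 * real m + ln n) + real n * real (prime_count (nat \<lfloor>sqrt n\<rfloor>)) / m"
proof -
  define N where "N = real n"
  define w where "w = N powr (3 / 2 - \<eta>)"
  define X where "X = N powr (1 / 2 + \<eta>)"
  define Z where "Z = N powr (1 / 2 - \<eta>)"
  define H where "H = N powr \<eta>"
  define a where "a = nat \<lceil>N powr (2 * \<eta>)\<rceil>"
  have N: "N > 1" unfolding N_def using n by simp
  have m2: "real m ^ 2 \<ge> 4"
  proof -
    have "(2::real) ^ 2 \<le> real m ^ 2" using m by (intro power_mono) auto
    then show ?thesis by simp
  qed
  have \<eta>0: "\<eta> > 0" unfolding \<eta> using m2 by simp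
  have \<eta>1: "\<eta> \<le> 1 / 14"
  proof -
    have "14 \<le> 2 * (real m ^ 2 + 3)" using m2 by simp
    then show ?thesis unfolding \<eta> by (intro divide_left_mono) auto
  qed
  have \<eta>m: "\<eta> * (real m ^ 2 + 3) = 1 / 2"
  proof -
    have "real m ^ 2 + 3 \<noteq> 0" using m2 by linarith
    then show ?thesis unfolding \<eta> by (simp add: field_simps)
  qed
  have mono: "N powr x \<le> N powr y" if "x \<le> y" for x y using that N by (intro powr_mono) auto
  have ge1: "1 \<le> N powr x" if "0 \<le> x" for x using mono[of 0 x] that N by simp
  have sq: "sqrt N = N powr (1 / 2)" using N by (simp add: powr_half_sqrt)
  have pos: "X > 0" "Z > 0" "H > 0" unfolding X_def Z_def H_def using N by auto
  have H1: "1 \<le> H" unfolding H_def using \<eta>0 by (intro ge1) auto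
  have HZ: "H < Z" unfolding H_def Z_def using N \<eta>1 by (intro powr_less_mono) auto
  have a_lo: "N powr (2 * \<eta>) \<le> real a" unfolding a_def by (rule real_nat_ceiling_ge)
  have a1: "1 \<le> a" using a_lo ge1[of "2 * \<eta>"] \<eta>0 by linarith
  have a_hi: "real a \<le> 2 * N powr (2 * \<eta>)"
  proof -
    have "real a < N powr (2 * \<eta>) + 1"
      unfolding a_def using ge1[of "2 * \<eta>"] \<eta>0 by linarith
    then show ?thesis using ge1[of "2 * \<eta>"] \<eta>0 by linarith
  qed
  \<comment> \<open>The factor 4 comes from rounding up a; it is the reason for the second assumption on n.\<close>
  have aZ: "real a * real a \<le> Z"
  proof -
    have "real a * real a \<le> (2 * N powr (2 * \<eta>)) * (2 * N powr (2 * \<eta>))"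
      using a_hi by (intro mult_mono) auto
    also have "\<dots> = 4 * N powr (4 * \<eta>)" by (simp add: powr_add[symmetric])
    also have "\<dots> \<le> N powr (1 / 2 - 5 * \<eta>) * N powr (4 * \<eta>)"
      using n(2) unfolding N_def by (intro mult_right_mono) auto
    also have "\<dots> = Z" unfolding Z_def by (simp add: powr_add[symmetric])
    finally show ?thesis .
  qed
  have ZN: "Z \<le> N" "Z \<le> X" unfolding Z_def X_def using mono[of "1/2 - \<eta>" 1] N \<eta>0 by (auto intro: mono)
  have XZZ: "X < Z * Z"
  proof -
    have "N powr (1 / 2 + \<eta>) < N powr (1 - 2 * \<eta>)" using N \<eta>1 by (intro powr_less_mono) auto
    then show ?thesis unfolding X_def Z_def by (simp add: powr_add[symmetric])
  qed
  have kn: "real k \<le> sqrt n" and Dn: "D \<subseteq> {1..n}" using adm unfolding admissible_def by auto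
  let ?B = "{d. 1 \<le> d \<and> real d \<le> X \<and> (\<exists>P. prime P \<and> P dvd d \<and> sqrt n < real P)}"
  define D0 where "D0 = {d\<in>D. real d \<le> X \<and> (\<forall>q. prime q \<longrightarrow> q dvd d \<longrightarrow> q \<le> k)}"
  have f0: "fits D0 n ((\<Sum>p | prime p \<and> real p \<le> real k. real n - real p ^ 2)
     + (real a * n + 2 * real n * (Z + 2 * X / a)
     + sqrt n * (H * (3 * sqrt n + n / Z) + 9 * (X / Z) * H ^ (m * m) * sqrt n)
     + real n * card {p. prime p \<and> real p \<le> sqrt n} / m
     + 2 * real n * m * (sqrt n / H + 1)))"
    using Dn m kn a1 aZ H1 HZ ZN XZZ
    by (intro fits_small_prime_factors) (auto simp: D0_def N_def)
  have f1: "fits ?B n (X / sqrt n * real n)"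
    using n pos by (intro fits_large_prime_factor) auto
  have f2: "fits {d. X < real d \<and> d \<le> n} n (real n + real n / X * (real n * (ln n + 1)))"
    using n pos by (intro fits_large_differences) auto
  have sub: "D \<subseteq> D0 \<union> ?B \<union> {d. X < real d \<and> d \<le> n}"
  proof
    fix d assume d: "d \<in> D"
    then have "1 \<le> d" "d \<le> n" using Dn by auto
    moreover have "(\<exists>q. prime q \<and> q dvd d \<and> sqrt n < real q) \<or> (\<forall>q. prime q \<longrightarrow> q dvd d \<longrightarrow> q \<le> k)"
      using adm d unfolding admissible_def by blast
    ultimately show "d \<in> D0 \<union> ?B \<union> {d. X < real d \<and> d \<le> n}"
      using d unfolding D0_def by (cases "real d \<le> X") auto
  qed
  have w1: "N \<le> w" unfolding w_def using mono[of 1 "3/2 - \<eta>"] N \<eta>1 by simp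
  have t1: "real a * N \<le> 2 * w"
  proof -
    have "real a * N \<le> 2 * N powr (2 * \<eta>) * N powr 1" using a_hi N by (intro mult_mono) auto
    also have "\<dots> = 2 * N powr (2 * \<eta> + 1)" by (simp add: powr_add)
    also have "\<dots> \<le> 2 * w" unfolding w_def using \<eta>1 by (intro mult_left_mono mono) auto
    finally show ?thesis .
  qed
  have t2: "2 * N * (Z + 2 * X / a) \<le> 6 * w"
  proof -
    have "X / a \<le> X / N powr (2 * \<eta>)" using a_lo N pos a1 by (intro divide_left_mono mult_pos_pos) auto
    also have "\<dots> = Z" unfolding X_def Z_def by (simp add: powr_diff[symmetric])
    finally have "2 * N * (Z + 2 * X / a) \<le> 2 * N * (3 * Z)" using N by (intro mult_left_mono) auto
    also have "\<dots> = 6 * (N powr 1 * Z)" using N by simp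
    also have "N powr 1 * Z = w" unfolding Z_def w_def by (subst powr_add[symmetric]) simp
    finally show ?thesis .
  qed
  \<comment> \<open>The last of the three summands is the one that dictates the choice of \<eta>.\<close>
  have t3: "sqrt N * (H * (3 * sqrt N + N / Z) + 9 * (X / Z) * H ^ (m * m) * sqrt N) \<le> 13 * w"
  proof -
    have e1: "sqrt N * H * sqrt N = N powr (1 + \<eta>)"
      unfolding sq H_def by (simp add: powr_add[symmetric])
    have e2: "sqrt N * H * (N / Z) = N powr (1 + 2 * \<eta>)"
    proof -
      have "N / Z = N powr 1 / N powr (1 / 2 - \<eta>)" unfolding Z_def using N by simp
      also have "\<dots> = N powr (1 / 2 + \<eta>)" unfolding powr_diff[symmetric] by simp
      finally have "N / Z = N powr (1 / 2 + \<eta>)" .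
      then show ?thesis unfolding sq H_def by (simp add: powr_add[symmetric])
    qed
    have e3: "sqrt N * (X / Z) * H ^ (m * m) * sqrt N = N powr (1 + 2 * \<eta> + \<eta> * real m ^ 2)"
    proof -
      have "X / Z = N powr (2 * \<eta>)" unfolding X_def Z_def by (simp add: powr_diff[symmetric])
      moreover have "H ^ (m * m) = N powr (\<eta> * real m ^ 2)"
        unfolding H_def using N by (simp add: powr_realpow[symmetric] powr_powr power2_eq_square)
      ultimately show ?thesis unfolding sq by (simp add: powr_add[symmetric] add.assoc)
    qed
    have "sqrt N * (H * (3 * sqrt N + N / Z) + 9 * (X / Z) * H ^ (m * m) * sqrt N)
       = 3 * (sqrt N * H * sqrt N) + sqrt N * H * (N / Z) + 9 * (sqrt N * (X / Z) * H ^ (m * m) * sqrt N)"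
      by (simp add: algebra_simps)
    also have "\<dots> \<le> 3 * w + w + 9 * w"
      unfolding e1 e2 e3 w_def using \<eta>1 \<eta>m
      by (intro add_mono mult_left_mono mono) (auto simp: algebra_simps)
    finally show ?thesis by simp
  qed
  have t4: "2 * N * m * (sqrt N / H + 1) \<le> 4 * real m * w"
  proof -
    have "N * (sqrt N / H) = N powr 1 * (N powr (1 / 2) / N powr \<eta>)" unfolding sq H_def using N by simp
    also have "\<dots> = w" unfolding w_def powr_diff[symmetric] powr_add[symmetric] by simp
    finally have "N * (sqrt N / H) + N \<le> 2 * w" using w1 by simp
    then have "2 * real m * (N * (sqrt N / H) + N) \<le> 2 * real m * (2 * w)" by (intro mult_left_mono) auto
    then show ?thesis by (simp add: algebra_simps)
  qed
  have t5: "X / sqrt N * N \<le> w"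
  proof -
    have "X / sqrt N * N = N powr (1 / 2 + \<eta>) / N powr (1 / 2) * N powr 1" unfolding X_def sq using N by simp
    also have "\<dots> = N powr (1 + \<eta>)" unfolding powr_diff[symmetric] powr_add[symmetric]
      by (simp add: add.commute)
    also have "\<dots> \<le> w" unfolding w_def using \<eta>1 by (intro mono) auto
    finally show ?thesis .
  qed
  have t6: "N / X * (N * (ln N + 1)) = w * (ln N + 1)"
  proof -
    have "N / X * N = N powr 1 / N powr (1 / 2 + \<eta>) * N powr 1" unfolding X_def using N by simp
    also have "\<dots> = w" unfolding w_def powr_diff[symmetric] powr_add[symmetric] by simp
    finally have "N / X * N = w" .
    moreover have "N / X * (N * (ln N + 1)) = N / X * N * (ln N + 1)" by (simp only: mult.assoc)
    ultimately show ?thesis by simp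
  qed
  have main: "(\<Sum>p | prime p \<and> real p \<le> real k. real n - real p ^ 2) = main_term n k"
    unfolding main_term_def by simp
  have pc: "card {p. prime p \<and> real p \<le> sqrt n} = prime_count (nat \<lfloor>sqrt n\<rfloor>)"
    unfolding prime_count_def le_sqrt_iff ..
  have lnN: "ln N \<ge> 0" using N by simp
  have main0: "0 \<le> main_term n k"
    unfolding main_term_def
  proof (rule sum_nonneg)
    fix p assume "p \<in> {p. prime p \<and> p \<le> k}"
    then have "real p \<le> sqrt n" using kn by auto
    then have "real p ^ 2 \<le> sqrt n ^ 2" by (intro power_mono) auto
    then show "0 \<le> real n - real p ^ 2" by simp
  qed
  have "fits D n (main_term n k + w * (24 + 4 * real m + ln N) + N * real (prime_count (nat \<lfloor>sqrt n\<rfloor>)) / m)"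
  proof (rule fits_mono[OF fits_Un[OF fits_Un[OF f0 f1] f2] sub])
    show "(\<Sum>p | prime p \<and> real p \<le> real k. real n - real p ^ 2)
     + (real a * n + 2 * real n * (Z + 2 * X / a)
     + sqrt n * (H * (3 * sqrt n + n / Z) + 9 * (X / Z) * H ^ (m * m) * sqrt n)
     + real n * card {p. prime p \<and> real p \<le> sqrt n} / m
     + 2 * real n * m * (sqrt n / H + 1)) + X / sqrt n * real n + (real n + real n / X * (real n * (ln n + 1)))
     \<le> main_term n k + w * (24 + 4 * real m + ln N) + N * real (prime_count (nat \<lfloor>sqrt n\<rfloor>)) / m"
      unfolding main pc
      unfolding N_def[symmetric] t6
      using t1 t2 t3 t4 t5 w1 by (simp add: algebra_simps)
  qed
  moreover have "1 \<le> main_term n k + w * (24 + 4 * real m + ln N) + N * real (prime_count (nat \<lfloor>sqrt n\<rfloor>)) / m"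
  proof -
    have "1 * 24 \<le> w * (24 + 4 * real m + ln N)" using w1 N lnN by (intro mult_mono) auto
    moreover have "0 \<le> N * real (prime_count (nat \<lfloor>sqrt n\<rfloor>)) / m" using N by simp
    ultimately show ?thesis using main0 by linarith
  qed
  ultimately show ?thesis unfolding w_def N_def by (rule packing_number_le)
qed

section \<open>Asymptotics of the packing numbers\<close>

lemma powr_three_halves: "real n powr (3 / 2) = real n * sqrt n"
proof -
  have "real n powr (3 / 2) = real n powr (1 + 1 / 2)" by simp
  also have "\<dots> = real n * sqrt n" unfolding powr_add by (simp add: powr_half_sqrt)
  finally show ?thesis .
qed

lemma admissible_upto: "real k \<le> sqrt n \<Longrightarrow> admissible n k {1..k}"
  unfolding admissible_def
proof (intro conjI ballI disjI2 allI impI)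
  assume k: "real k \<le> sqrt n"
  show "real k \<le> sqrt n" by fact
  show "{p. prime p \<and> p \<le> k} \<subseteq> {1..k}" by (auto simp: Suc_le_eq prime_gt_0_nat)
  have "real k * real k \<le> sqrt n * sqrt n" using k by (intro mult_mono) auto
  then have "real (k * k) \<le> real n" by simp
  then have "k * k \<le> n" by linarith
  moreover have "k \<le> k * k" by (cases k) auto
  ultimately have "k \<le> n" by linarith
  then show "{1..k} \<subseteq> {1..n}" by auto
  fix d q assume "d \<in> {1..k}" "prime q" "q dvd d"
  then show "q \<le> k" using dvd_imp_le[of q d] by auto
qed

lemma admissible_primes:
  assumes "real k \<le> sqrt n"
  shows "admissible n k {p. prime p \<and> p \<le> k}"
proof -
  have "{p. prime p \<and> p \<le> k} \<subseteq> {1..k}" by (auto simp: Suc_le_eq prime_gt_0_nat)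
  then show ?thesis using admissible_upto[OF assms] unfolding admissible_def by blast
qed

lemma admissible_all: "admissible n (nat \<lfloor>sqrt n\<rfloor>) {1..n}"
proof -
  have k: "real (nat \<lfloor>sqrt n\<rfloor>) \<le> sqrt n" by (intro of_nat_floor) auto
  have "{p. prime p \<and> p \<le> nat \<lfloor>sqrt n\<rfloor>} \<subseteq> {1..n}"
    using admissible_upto[OF k] unfolding admissible_def by (meson order_trans)
  moreover have "(\<exists>q. prime q \<and> q dvd d \<and> sqrt n < real q) \<or> (\<forall>q. prime q \<longrightarrow> q dvd d \<longrightarrow> q \<le> nat \<lfloor>sqrt n\<rfloor>)" for d
    unfolding le_sqrt_iff[symmetric] by (meson not_less)
  ultimately show ?thesis using k unfolding admissible_def by blast
qed

lemma packing_number_lower_bound: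
  assumes "admissible n k D"
  shows "main_term n k - 3 * real n \<le> real (packing_number D n)"
proof -
  have D: "finite D" "{p. prime p \<and> p \<le> k} \<subseteq> D" "real k \<le> sqrt n"
    using assms finite_subset unfolding admissible_def by blast+
  have "packed_into {p. prime p \<and> p \<le> k} (multiples_set n) (packing_number D n)"
    using packing_number_packed[OF D(1)] packed_into_mono[OF _ D(2)] by blast
  then show ?thesis
    unfolding main_term_def using D(3) by (intro packed_primes_lower_bound) (auto simp: finite_primes_le intro: order_trans)
qed

text \<open>
  Choosing m of order 1 / \<delta> makes the waste n \<pi>(sqrt n) / m of the clusters small; the other errors
  are smaller by a power of n, up to logarithms.
\<close>
lemma packing_number_estimate:
  assumes \<delta>: "\<delta> > 0"
  shows "\<exists>n0. \<forall>n\<ge>n0. \<forall>k D. admissible n k D \<longrightarrow>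
    \<bar>real (packing_number D n) - main_term n k\<bar> \<le> \<delta> * (real n powr (3 / 2) / ln n)"
proof -
  \<comment> \<open>As \<pi>(sqrt n) \<le> 8 sqrt n / ln n, this makes n \<pi>(sqrt n) / m at most half of the allowed error.\<close>
  define m where "m = nat \<lceil>16 / \<delta>\<rceil> + 2"
  define \<eta> where "\<eta> = 1 / (2 * (real m ^ 2 + 3))"
  have m: "m \<ge> 2" "16 / \<delta> \<le> real m" unfolding m_def using real_nat_ceiling_ge[of "16 / \<delta>"] by auto
  have \<eta>: "0 < \<eta>" "\<eta> \<le> 1 / 14"
  proof -
    have "(2::real) ^ 2 \<le> real m ^ 2" using m by (intro power_mono) auto
    then have "14 \<le> 2 * (real m ^ 2 + 3)" by simp
    then show "0 < \<eta>" "\<eta> \<le> 1 / 14" unfolding \<eta>_def by (auto intro: divide_left_mono)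
  qed
  have small: "eventually (\<lambda>n. real n powr (3 / 2 - \<eta>) * (24 + 4 * real m + ln n) \<le> \<delta> / 2 * (real n powr (3 / 2) / ln n)) sequentially"
  proof -
    have "(\<lambda>n. real n powr (- \<eta>) * (24 + 4 * real m + ln n) * ln n) \<longlonglongrightarrow> 0"
      using \<eta> by real_asymp
    then have "eventually (\<lambda>n. real n powr (- \<eta>) * (24 + 4 * real m + ln n) * ln n < \<delta> / 2) sequentially"
      using \<delta> by (intro order_tendstoD) auto
    then show ?thesis using eventually_gt_at_top[of 1]
    proof eventually_elim
      case (elim n)
      have ln: "ln (real n) > 0" using elim by simp
      have "real n powr (3 / 2 - \<eta>) * (24 + 4 * real m + ln n)
         = real n powr (3 / 2) / ln n * (real n powr (- \<eta>) * (24 + 4 * real m + ln n) * ln n)"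
      proof -
        have "real n powr (3 / 2 - \<eta>) = real n powr (3 / 2) * real n powr (- \<eta>)"
          unfolding powr_add[symmetric] by simp
        then show ?thesis using ln by simp
      qed
      also have "\<dots> \<le> real n powr (3 / 2) / ln n * (\<delta> / 2)"
        using elim ln by (intro mult_left_mono) auto
      finally show ?case by (simp add: mult.commute)
    qed
  qed
  have sqrt_lim: "filterlim (\<lambda>n::nat. nat \<lfloor>sqrt n\<rfloor>) at_top sequentially"
  proof -
    have "filterlim (\<lambda>n::nat. sqrt n) at_top sequentially" by real_asymp
    then show ?thesis
      by (intro filterlim_compose[OF filterlim_nat_sequentially] filterlim_compose[OF filterlim_floor_sequentially])
  qed
  have "eventually (\<lambda>j. real (prime_count j) * ln j / real j < 2) sequentially"
    using prime_number_theorem by (intro order_tendstoD) auto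
  then have "eventually (\<lambda>n. real (prime_count (nat \<lfloor>sqrt (real n)\<rfloor>)) * ln (nat \<lfloor>sqrt (real n)\<rfloor>) / real (nat \<lfloor>sqrt (real n)\<rfloor>) < 2) sequentially"
    by (rule eventually_compose_filterlim[OF _ sqrt_lim])
  moreover have "eventually (\<lambda>n::nat. ln (sqrt (real n) - 1) > ln (real n) / 4) sequentially" by real_asymp
  moreover have "eventually (\<lambda>n::nat. sqrt (real n) - 1 > 1) sequentially" by real_asymp
  ultimately have primes: "eventually (\<lambda>n. real n * real (prime_count (nat \<lfloor>sqrt n\<rfloor>)) / m \<le> \<delta> / 2 * (real n powr (3 / 2) / ln n)) sequentially"
    using eventually_gt_at_top[of 1]
  proof eventually_elim
    case (elim n)
    define j where "j = nat \<lfloor>sqrt (real n)\<rfloor>"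
    have j: "real j \<le> sqrt n" "sqrt n - 1 < real j" unfolding j_def by (auto simp: of_nat_floor)
    have lnn: "ln (real n) > 0" using elim by simp
    have lj: "ln (real n) / 4 \<le> ln (real j)"
    proof -
      have "ln (sqrt n - 1) \<le> ln (real j)" using j elim by (subst ln_le_cancel_iff) auto
      then show ?thesis using elim by linarith
    qed
    have jpos: "real j > 0" using j elim by linarith
    have "real (prime_count j) * ln j \<le> 2 * real j" using elim jpos unfolding j_def[symmetric] by (simp add: field_simps)
    moreover have "real (prime_count j) * (ln n / 4) \<le> real (prime_count j) * ln j" using lj by (intro mult_left_mono) auto
    ultimately have "real (prime_count j) * (ln n / 4) \<le> 2 * sqrt n" using j by linarith
    then have pc: "real (prime_count j) \<le> 8 * sqrt n / ln n" using lnn by (simp add: field_simps)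
    have "1 / real m \<le> \<delta> / 16" using m \<delta> by (simp add: field_simps)
    then have "real n * real (prime_count j) * (1 / real m) \<le> real n * (8 * sqrt n / ln n) * (\<delta> / 16)"
      using pc lnn by (intro mult_mono) auto
    also have "\<dots> = \<delta> / 2 * (real n * sqrt n / ln n)" by simp
    also have "real n * sqrt n = real n powr (3 / 2)" by (simp add: powr_three_halves)
    finally show ?case unfolding j_def by simp
  qed
  have four: "eventually (\<lambda>n::nat. 4 \<le> real n powr (1 / 2 - 5 * \<eta>)) sequentially"
  proof -
    have "1 / 2 - 5 * \<eta> > 0" using \<eta> by simp
    then show ?thesis by real_asymp
  qed
  have low: "eventually (\<lambda>n::nat. 3 * real n \<le> \<delta> * (real n powr (3 / 2) / ln n)) sequentially"
    using \<delta> by real_asymp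
  have "eventually (\<lambda>n. \<forall>k D. admissible n k D \<longrightarrow>
    \<bar>real (packing_number D n) - main_term n k\<bar> \<le> \<delta> * (real n powr (3 / 2) / ln n)) sequentially"
    using small primes four low eventually_ge_at_top[of 2]
  proof eventually_elim
    case (elim n)
    show ?case
    proof (intro allI impI)
      fix k D assume adm: "admissible n k D"
      have "real (packing_number D n) \<le> main_term n k
         + real n powr (3 / 2 - \<eta>) * (24 + 4 * real m + ln n) + real n * real (prime_count (nat \<lfloor>sqrt n\<rfloor>)) / m"
        using elim by (intro packing_number_upper_bound[OF m(1) \<eta>_def adm]) auto
      moreover have "main_term n k - 3 * real n \<le> real (packing_number D n)"
        using adm by (rule packing_number_lower_bound)
      ultimately show "\<bar>real (packing_number D n) - main_term n k\<bar> \<le> \<delta> * (real n powr (3 / 2) / ln n)"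
        using elim unfolding abs_le_iff by linarith
    qed
  qed
  then show ?thesis by (simp add: eventually_sequentially)
qed

lemma packing_number_asymptotic:
  assumes c: "c > 0" and \<epsilon>: "\<epsilon> > 0"
  shows "\<exists>n0. \<forall>n\<ge>n0. \<forall>k D. admissible n k D \<and> c * sqrt n \<le> real k \<longrightarrow>
    \<bar>real (packing_number D n) * (ln k / (real k * real n)) - (1 - real k ^ 2 / (3 * real n))\<bar> \<le> \<epsilon>"
proof -
  let ?dev = "\<lambda>n k D. real (packing_number D n) * (ln k / (real k * real n)) - (1 - real k ^ 2 / (3 * real n))"
  obtain k0 where k0: "\<And>k n. k \<ge> k0 \<Longrightarrow> k * k \<le> n \<Longrightarrow>
    \<bar>main_term n k * (ln k / (real k * real n)) - (1 - real k ^ 2 / (3 * real n))\<bar> \<le> \<epsilon> / 2"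
    using main_term_estimate[of "\<epsilon> / 2"] \<epsilon> by auto
  obtain n1 where n1: "\<And>n k D. n \<ge> n1 \<Longrightarrow> admissible n k D \<Longrightarrow>
    \<bar>real (packing_number D n) - main_term n k\<bar> \<le> (c * \<epsilon>) * (real n powr (3 / 2) / ln n)"
    using packing_number_estimate[of "c * \<epsilon>"] c \<epsilon> by auto
  have "eventually (\<lambda>n::nat. c * sqrt (real n) > real k0 + 1) sequentially" using c by real_asymp
  then have "eventually (\<lambda>n. \<forall>k D. admissible n k D \<and> c * sqrt n \<le> real k \<longrightarrow>
    \<bar>?dev n k D\<bar> \<le> \<epsilon>) sequentially"
    using eventually_ge_at_top[of "max 2 n1"]
  proof eventually_elim
    case (elim n)
    show ?case
    proof (intro allI impI)
      fix k D assume "admissible n k D \<and> c * sqrt n \<le> real k"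
      then have adm: "admissible n k D" and ck: "c * sqrt n \<le> real k" by auto
      have kn: "real k \<le> sqrt n" using adm unfolding admissible_def by simp
      have k: "k \<ge> k0" "real k > 1" using ck elim by linarith+
      have n: "real n > 1" "n \<ge> n1" using elim by auto
      have "real k * real k \<le> sqrt n * sqrt n" using kn by (intro mult_mono) auto
      then have "real (k * k) \<le> real n" by simp
      then have kk: "k * k \<le> n" by linarith
      define f where "f = ln (real k) / (real k * real n)"
      have f0: "f \<ge> 0" unfolding f_def using k n by simp
      have f1: "f \<le> ln n / (2 * c * real n powr (3 / 2))"
      proof -
        have "ln (real k) \<le> ln (sqrt n)" using kn k n by (subst ln_le_cancel_iff) auto
        then have l: "ln (real k) \<le> ln n / 2" using n by (simp add: ln_sqrt)
        have "c * real n powr (3 / 2) = c * sqrt n * real n"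
          by (simp add: powr_three_halves)
        also have "\<dots> \<le> real k * real n" using ck by (intro mult_right_mono) auto
        finally have "c * real n powr (3 / 2) \<le> real k * real n" .
        then have "f \<le> (ln n / 2) / (c * real n powr (3 / 2))"
          unfolding f_def using l n k c by (intro frac_le) auto
        then show ?thesis by (simp add: mult.assoc)
      qed
      have "\<bar>real (packing_number D n) * f - main_term n k * f\<bar> = \<bar>real (packing_number D n) - main_term n k\<bar> * f"
        using f0 by (simp add: left_diff_distrib[symmetric] abs_mult)
      also have "\<dots> \<le> (c * \<epsilon>) * (real n powr (3 / 2) / ln n) * (ln n / (2 * c * real n powr (3 / 2)))"
        using n1[OF n(2) adm] f1 f0 c \<epsilon> n by (intro mult_mono) auto
      also have "\<dots> = \<epsilon> / 2"
      proof -
        have "ln (real n) > 0" "real n powr (3 / 2) > 0" using n by auto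
        then show ?thesis using c by (simp add: field_simps)
      qed
      finally have "\<bar>real (packing_number D n) * f - main_term n k * f\<bar> \<le> \<epsilon> / 2" .
      moreover have "\<bar>main_term n k * f - (1 - real k ^ 2 / (3 * real n))\<bar> \<le> \<epsilon> / 2"
        unfolding f_def using k0[OF k(1) kk] .
      ultimately show "\<bar>?dev n k D\<bar> \<le> \<epsilon>"
        unfolding f_def[symmetric] by linarith
    qed
  qed
  then show ?thesis by (simp add: eventually_sequentially)
qed

text \<open>
  For k the integral part of sqrt n, k^2 / n tends to 1 and ln k / ln n to 1/2, so that
  1 - k^2 / (3 n) tends to 2/3 and k n / ln k is asymptotic to 2 n^(3/2) / ln n.
\<close>
lemma packing_number_asymp_equiv:
  assumes adm: "\<And>n. admissible n (nat \<lfloor>sqrt n\<rfloor>) (D n)"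
  shows "(\<lambda>n. real (packing_number (D n) n)) \<sim>[at_top] (\<lambda>n. 4 * real n powr (3 / 2) / (3 * ln n))"
proof -
  define k where "k n = nat \<lfloor>sqrt (real n)\<rfloor>" for n :: nat
  have k: "real (k n) \<le> sqrt n" "sqrt n - 1 \<le> real (k n)" for n
    unfolding k_def by (auto simp: of_nat_floor)
  let ?dev = "\<lambda>n. real (packing_number (D n) n) * (ln (k n) / (real (k n) * real n)) - (1 - real (k n) ^ 2 / (3 * real n))"
  have big: "eventually (\<lambda>n::nat. sqrt (real n) > 2) sequentially" by real_asymp
  have ratio: "(\<lambda>n. real (k n) / sqrt n) \<longlonglongrightarrow> 1"
  proof (rule tendsto_sandwich)
    show "eventually (\<lambda>n. (sqrt n - 1) / sqrt n \<le> real (k n) / sqrt n) sequentially"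
      using k by (intro always_eventually allI divide_right_mono) auto
    show "eventually (\<lambda>n. real (k n) / sqrt n \<le> 1) sequentially"
      using big
    proof eventually_elim
      case (elim n)
      then show ?case using k(1)[of n] by (simp add: divide_le_eq)
    qed
    show "(\<lambda>n::nat. (sqrt (real n) - 1) / sqrt (real n)) \<longlonglongrightarrow> 1" by real_asymp
  qed simp
  have logs: "(\<lambda>n. ln (k n) / ln n) \<longlonglongrightarrow> 1 / 2"
  proof (rule tendsto_sandwich)
    show "eventually (\<lambda>n. ln (sqrt n - 1) / ln n \<le> ln (k n) / ln n) sequentially"
      using big eventually_gt_at_top[of 1]
    proof eventually_elim
      case (elim n)
      then show ?case using k(2)[of n] by (intro divide_right_mono) (auto simp: ln_le_cancel_iff)
    qed
    show "eventually (\<lambda>n. ln (k n) / ln n \<le> ln (sqrt n) / ln n) sequentially"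
      using big eventually_gt_at_top[of 1]
    proof eventually_elim
      case (elim n)
      have "real (k n) > 0" using k(2)[of n] elim by linarith
      then show ?case using k(1)[of n] elim by (intro divide_right_mono) (auto simp: ln_le_cancel_iff)
    qed
    show "(\<lambda>n::nat. ln (sqrt (real n) - 1) / ln (real n)) \<longlonglongrightarrow> 1 / 2" by real_asymp
    show "(\<lambda>n::nat. ln (sqrt (real n)) / ln (real n)) \<longlonglongrightarrow> 1 / 2" by real_asymp
  qed
  have diff: "(\<lambda>n. ?dev n) \<longlonglongrightarrow> 0"
  proof (rule LIMSEQ_I)
    fix \<epsilon> :: real assume \<epsilon>: "\<epsilon> > 0"
    obtain n0 where n0: "\<And>n k D. n \<ge> n0 \<Longrightarrow> admissible n k D \<Longrightarrow> 1 / 2 * sqrt n \<le> real k \<Longrightarrow>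
      \<bar>real (packing_number D n) * (ln k / (real k * real n)) - (1 - real k ^ 2 / (3 * real n))\<bar> \<le> \<epsilon> / 2"
      using packing_number_asymptotic[of "1/2" "\<epsilon> / 2"] \<epsilon> by auto
    have "eventually (\<lambda>n. norm (?dev n - 0) < \<epsilon>) sequentially"
      using big eventually_ge_at_top[of n0]
    proof eventually_elim
      case (elim n)
      have "1 / 2 * sqrt n \<le> real (k n)" using k(2)[of n] elim by linarith
      from n0[OF elim(2) adm[of n, folded k_def] this] show ?case using \<epsilon> by simp
    qed
    then show "\<exists>no. \<forall>n\<ge>no. norm (?dev n - 0) < \<epsilon>"
      by (simp add: eventually_sequentially)
  qed
  have sqr: "(\<lambda>n. 1 - (real (k n) / sqrt n) ^ 2 / 3) \<longlonglongrightarrow> 1 - 1 ^ 2 / 3"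
    by (intro tendsto_intros ratio) auto
  have "(\<lambda>n. (?dev n
      + (1 - (real (k n) / sqrt n) ^ 2 / 3)) * (real (k n) / sqrt n) / (ln (k n) / ln n) * (3 / 4)) \<longlonglongrightarrow>
     (0 + (1 - 1 ^ 2 / 3)) * 1 / (1 / 2) * (3 / 4)"
    by (intro tendsto_mult tendsto_divide tendsto_add diff sqr ratio logs tendsto_const) auto
  then have lim: "(\<lambda>n. (?dev n
      + (1 - (real (k n) / sqrt n) ^ 2 / 3)) * (real (k n) / sqrt n) / (ln (k n) / ln n) * (3 / 4)) \<longlonglongrightarrow> 1"
    by simp
  have "(\<lambda>n. real (packing_number (D n) n) / (4 * real n powr (3 / 2) / (3 * ln n))) \<longlonglongrightarrow> 1"
  proof (rule Lim_transform_eventually[OF lim])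
    show "eventually (\<lambda>n. (?dev n
      + (1 - (real (k n) / sqrt n) ^ 2 / 3)) * (real (k n) / sqrt n) / (ln (k n) / ln n) * (3 / 4)
      = real (packing_number (D n) n) / (4 * real n powr (3 / 2) / (3 * ln n))) sequentially"
      using big eventually_gt_at_top[of 1]
    proof eventually_elim
      case (elim n)
      have n: "real n > 0" "ln (real n) > 0" "sqrt n > 0" using elim by auto
      have kp: "real (k n) > 1" using k(2)[of n] elim by linarith
      then have lk: "ln (real (k n)) > 0" by simp
      have "(real (k n) / sqrt n) ^ 2 / 3 = real (k n) ^ 2 / (3 * real n)"
        using n by (simp add: power_divide)
      then show ?case using n kp lk by (simp add: powr_three_halves field_simps)
    qed
  qed
  then show ?thesis by (rule asymp_equivI')
qed

theorem theorem1p2: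
  shows "(\<lambda>n. real (packing_number_upto n n))
           \<sim>[at_top] (\<lambda>n. real (packing_number (primes_upto (sqrt (real n))) n))
       \<and> (\<lambda>n. real (packing_number (primes_upto (sqrt (real n))) n))
           \<sim>[at_top] (\<lambda>n. 4 * real n powr (3 / 2) / (3 * ln (real n)))
       \<and> (\<forall>c::real. 0 < c \<and> c < 1 \<longrightarrow>
            (\<forall>\<epsilon>::real. \<epsilon> > 0 \<longrightarrow>
              (\<exists>n0::nat. \<forall>n\<ge>n0. \<forall>k::nat.
                 c * sqrt (real n) \<le> real k \<and> real k < sqrt (real n) \<longrightarrow>
                 \<bar>real (packing_number_upto k n) * (ln (real k) / (real k * real n))
                    - (1 - (real k)\<^sup>2 / (3 * real n))\<bar> \<le> \<epsilon>)))"
proof (intro conjI allI impI)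
  have all: "(\<lambda>n. real (packing_number_upto n n)) \<sim>[at_top] (\<lambda>n. 4 * real n powr (3 / 2) / (3 * ln (real n)))"
    unfolding packing_number_upto_def by (rule packing_number_asymp_equiv[OF admissible_all])
  have eq: "primes_upto (sqrt (real n)) = {p. prime p \<and> p \<le> nat \<lfloor>sqrt (real n)\<rfloor>}" for n
    unfolding primes_upto_def le_sqrt_iff ..
  have "real (nat \<lfloor>sqrt (real n)\<rfloor>) \<le> sqrt n" for n by (intro of_nat_floor) auto
  then show primes: "(\<lambda>n. real (packing_number (primes_upto (sqrt (real n))) n))
      \<sim>[at_top] (\<lambda>n. 4 * real n powr (3 / 2) / (3 * ln (real n)))"
    unfolding eq by (intro packing_number_asymp_equiv admissible_primes)
  show "(\<lambda>n. real (packing_number_upto n n)) \<sim>[at_top] (\<lambda>n. real (packing_number (primes_upto (sqrt (real n))) n))"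
    using asymp_equiv_trans[OF all asymp_equiv_symI[OF primes]] .
next
  fix c \<epsilon> :: real assume c: "0 < c \<and> c < 1" and \<epsilon>: "\<epsilon> > 0"
  obtain n0 where n0: "\<And>n k D. n \<ge> n0 \<Longrightarrow> admissible n k D \<Longrightarrow> c * sqrt n \<le> real k \<Longrightarrow>
      \<bar>real (packing_number D n) * (ln k / (real k * real n)) - (1 - real k ^ 2 / (3 * real n))\<bar> \<le> \<epsilon>"
    using packing_number_asymptotic[of c \<epsilon>] c \<epsilon> by auto
  show "\<exists>n0::nat. \<forall>n\<ge>n0. \<forall>k::nat. c * sqrt (real n) \<le> real k \<and> real k < sqrt (real n) \<longrightarrow>
     \<bar>real (packing_number_upto k n) * (ln (real k) / (real k * real n)) - (1 - (real k)\<^sup>2 / (3 * real n))\<bar> \<le> \<epsilon>"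
    unfolding packing_number_upto_def
    using n0 admissible_upto by (intro exI[of _ n0]) (auto intro: less_imp_le)
qed

end
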